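(* Thompson's group $T$ has property $R_\infty$.
   Context: Thompson's group $T=\mathrm{PL}_2(S^1)$ is the group of orientation-preserving piecewise-linear homeomorphisms of the circle $S^1=\mathbb{R}/\mathbb{Z}$ which map dyadic rationals to dyadic rationals, have finitely many breakpoints, all at dyadic rational points, and have all slopes integral powers of $2$. For a group $G$ and $\varphi\in\mathrm{Aut}(G)$, two elements $y,z\in G$ are $\varphi$-twisted conjugate if there is $g\in G$ with $z=g^{-1}y\varphi(g)$. A group $G$ has property $R_\infty$ if, for every $\varphi\in\mathrm{Aut}(G)$, there are infinitely many distinct $\varphi$-twisted conjugacy classes in $G$; equivalently, for every $\varphi\in\mathrm{Aut}(G)$ there is a sequence $\{z_i\}_{i\in\mathbb{N}}$ of pairwise distinct elements of $G$ which are pairwise not $\varphi$-twisted conjugate. *)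

theory Defs
  imports "HOL-Analysis.Analysis" "HOL-Algebra.Bij"
begin

quotient_type circle = real / "\<lambda>x y. x - y \<in> \<int>"
  morphisms rep_circle circle_of
proof (rule equivpI)
  show "reflp (\<lambda>x y::real. x - y \<in> \<int>)"
    by (simp add: reflp_def)
  show "symp (\<lambda>x y::real. x - y \<in> \<int>)"
    by (metis (no_types, lifting) Ints_minus minus_diff_eq sympI)
  show "transp (\<lambda>x y::real. x - y \<in> \<int>)"
  proof (rule transpI)
    fix x y z :: real
    assume "x - y \<in> \<int>" "y - z \<in> \<int>"
    then have "(x - y) + (y - z) \<in> \<int>" by (rule Ints_add)
    then show "x - z \<in> \<int>" by simp
  qed
qed

text \<open>The quotient topology.\<close>

instantiation circle :: topological_space
begin

definition open_circle :: "circle set \<Rightarrow> bool" where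
  "open_circle U \<longleftrightarrow> open (circle_of -` U)"

instance
proof
  show "open (UNIV :: circle set)"
    by (simp add: open_circle_def)
  show "open (S \<inter> T)" if "open S" "open T" for S T :: "circle set"
    using that by (simp add: open_circle_def open_Int)
  show "open (\<Union> K)" if "\<forall>S\<in>K. open S" for K :: "circle set set"
    using that by (simp add: open_circle_def vimage_Union open_UN)
qed

end

definition dyadic :: "real set" where
  "dyadic = {of_int m / 2 ^ n | (m::int) (n::nat). True}"

definition is_lift :: "(real \<Rightarrow> real) \<Rightarrow> (circle \<Rightarrow> circle) \<Rightarrow> bool" where
  "is_lift F f \<longleftrightarrow> continuous_on UNIV F \<and> (\<forall>x. circle_of (F x) = f (circle_of x))"

definition affine_near :: "(real \<Rightarrow> real) \<Rightarrow> real \<Rightarrow> real \<Rightarrow> bool" where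
  "affine_near F a x \<longleftrightarrow> (\<forall>\<^sub>F y in nhds x. F y = F x + a * (y - x))"

definition breakpoints :: "(real \<Rightarrow> real) \<Rightarrow> real set" where
  "breakpoints F = {x. \<nexists>a. affine_near F a x}"

text \<open>
  Piecewise linearity, breakpoints and slopes of a circle map are read off a lift; lifts of the
  same map differ by an integer constant, so the choice of lift is immaterial. A homeomorphism of
  the circle preserves orientation iff it has a strictly increasing lift. The breakpoints of a
  lift form a \<open>\<int>\<close>-periodic subset of the line, so finiteness is required of their image
  in the circle; together with continuity this is piecewise linearity.
\<close>

definition in_thompson_T :: "(circle \<Rightarrow> circle) \<Rightarrow> bool" where
  "in_thompson_T f \<longleftrightarrow>
     (\<exists>g. homeomorphism UNIV UNIV f g) \<and>
     f ` (circle_of ` dyadic) \<subseteq> circle_of ` dyadic \<and>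
     (\<exists>F. is_lift F f \<and> strict_mono F \<and>
          finite (circle_of ` breakpoints F) \<and> breakpoints F \<subseteq> dyadic \<and>
          (\<forall>a x. affine_near F a x \<longrightarrow> (\<exists>k::int. a = 2 powi k)))"

definition thompson_T :: "(circle \<Rightarrow> circle) monoid" where
  "thompson_T = \<lparr>carrier = {f. in_thompson_T f}, mult = (\<circ>), one = id\<rparr>"

definition twisted_conj :: "('a, 'b) monoid_scheme \<Rightarrow> ('a \<Rightarrow> 'a) \<Rightarrow> ('a \<times> 'a) set" where
  "twisted_conj G \<phi> =
     {(y, z). y \<in> carrier G \<and> z \<in> carrier G \<and>
        (\<exists>g\<in>carrier G. z = inv\<^bsub>G\<^esub> g \<otimes>\<^bsub>G\<^esub> y \<otimes>\<^bsub>G\<^esub> \<phi> g)}"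

definition has_R_infinity :: "('a, 'b) monoid_scheme \<Rightarrow> bool" where
  "has_R_infinity G \<longleftrightarrow>
     group G \<and> (\<forall>\<phi>\<in>auto G. infinite (carrier G // twisted_conj G \<phi>))"

end

theory Submission
  imports Defs
begin

text \<open>
  Every automorphism \<open>\<phi>\<close> of \<open>T\<close> is spatial: there is a homeomorphism \<open>h\<close> of the circle with
  \<open>\<phi> g = h g h\<inverse>\<close> for all \<open>g\<close>. Hence \<open>z = g\<inverse> y \<phi>(g)\<close> says that \<open>z h = g\<inverse> (y h) g\<close>, and the task is to
  find infinitely many elements of the coset \<open>T h\<close> that are pairwise not conjugate by an element of \<open>T\<close>.

  The homeomorphism \<open>h\<close> is reconstructed from \<open>\<phi>\<close> in the manner of Rubin's theorem. Following Belk,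
  Elliott and Matucci, a condition on commutators alone (\<open>alg_disjoint\<close>) comes close enough to disjointness
  of supports to make the relation \<open>supp k \<subseteq> closure (supp f)\<close> expressible in the group
  (\<open>supp_le_closure_iff\<close>). The point \<open>h x\<close> is then the only point common to the sets
  \<open>closure (supp (\<phi> f))\<close>, where \<open>f\<close> ranges over the elements that move \<open>x\<close> (\<open>spatial_automorphism\<close>). A dyadic
  point is recognised topologically as a boundary point of the support of an element of \<open>T\<close>, so \<open>h\<close> preserves
  dyadic points, and after composition with a dyadic rotation it fixes the base point \<open>0\<close>. Being a
  homeomorphism, it then has a monotone lift to the line (\<open>circle_homeo_lift\<close>).

  If the lift increases, the transitivity of \<open>T\<close> on cyclically ordered dyadic tuples yields for every \<open>n = 2 ^ k\<close>
  an element \<open>y\<close> such that some lift of \<open>y h\<close> satisfies \<open>F ^ n (x) = x + 1\<close> for some \<open>x\<close>. This means rotation number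
  \<open>1 / n\<close> modulo \<open>1\<close>, so different \<open>n\<close> give non-conjugate elements (\<open>rotates_once_dvd\<close>).

  If the lift decreases, all rotation numbers of squares vanish, and germs take over. Let \<open>k\<close> be an element
  of \<open>T\<close> that doubles near \<open>0\<close> to the right and is the identity near \<open>0\<close> to the left. Right germs at \<open>0\<close> of
  elements of \<open>T\<close> that fix \<open>0\<close> are powers of the doubling germ, and
  conjugation by \<open>h\<^sup>2\<close> induces an order preserving automorphism of this infinite cyclic group; hence \<open>h\<^sup>2\<close> commutes
  with all of them. The square of \<open>k ^ m h\<close> has the right germ \<open>2 ^ m h\<^sup>2\<close> at \<open>0\<close>, so conjugation by
  an element of \<open>T\<close> that fixes \<open>0\<close> cannot change \<open>m\<close> (\<open>reversing_germ_rigidity\<close>). An orientation reversing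
  homeomorphism has at most one fixed point besides \<open>0\<close>, which leaves room for only one further value
  of \<open>m\<close> in each class.
\<close>

section \<open>Supports and commutators of bijections\<close>

text \<open>
  The usual notation for the inverse of a function is taken by the inverse of a group element.
\<close>

abbreviation fun_inv :: "('a \<Rightarrow> 'b) \<Rightarrow> 'b \<Rightarrow> 'a" where
  "fun_inv f \<equiv> inv_into UNIV f"

definition supp :: "('a \<Rightarrow> 'a) \<Rightarrow> 'a set" where
  "supp g = {x. g x \<noteq> x}"

lemma supp_empty_iff: "supp g = {} \<longleftrightarrow> g = id"
  by (auto simp: supp_def)

lemma supp_comp: "supp (f \<circ> g) \<subseteq> supp f \<union> supp g"
  by (auto simp: supp_def)

lemma supp_inv:
  assumes "bij f" shows "supp (fun_inv f) = supp f"
proof -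
  have "fun_inv f x = x \<longleftrightarrow> f x = x" for x using bij_inv_eq_iff[OF assms, of x x] by auto
  then show ?thesis by (simp add: supp_def)
qed

lemma supp_conj:
  assumes "bij f" shows "supp (f \<circ> g \<circ> fun_inv f) = f ` supp g"
proof -
  have 1: "f (fun_inv f x) = x" "fun_inv f (f y) = y" for x y
    using assms by (simp_all add: bij_is_surj surj_f_inv_f bij_is_inj)
  have "x \<in> supp (f \<circ> g \<circ> fun_inv f) \<longleftrightarrow> fun_inv f x \<in> supp g" for x
    unfolding supp_def comp_apply mem_Collect_eq using 1 by metis
  moreover have "x \<in> f ` supp g \<longleftrightarrow> fun_inv f x \<in> supp g" for x
    using 1 by (metis image_iff)
  ultimately show ?thesis by blast
qed

lemma supp_invariant: "inj f \<Longrightarrow> x \<in> supp f \<Longrightarrow> f x \<in> supp f"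
  by (auto simp: supp_def dest: injD)

lemma disjoint_supp_commute:
  assumes "inj f" "inj g" "supp f \<inter> supp g = {}" shows "f \<circ> g = g \<circ> f"
proof
  fix x
  show "(f \<circ> g) x = (g \<circ> f) x"
  proof (cases "x \<in> supp f")
    case True
    then have "g x = x" "g (f x) = f x"
      using assms supp_invariant[OF assms(1) True] by (auto simp: supp_def)
    then show ?thesis by simp
  next
    case False
    then have fx: "f x = x" by (simp add: supp_def)
    show ?thesis
    proof (cases "x \<in> supp g")
      case True
      then have "f (g x) = g x"
        using assms supp_invariant[OF assms(2) True] by (auto simp: supp_def)
      then show ?thesis using fx by simp
    qed (use fx in \<open>auto simp: supp_def\<close>)
  qed
qed

definition commutator :: "('a \<Rightarrow> 'a) \<Rightarrow> ('a \<Rightarrow> 'a) \<Rightarrow> 'a \<Rightarrow> 'a" where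
  "commutator f g = f \<circ> g \<circ> fun_inv f \<circ> fun_inv g"

lemma supp_commutator:
  assumes "bij f" "bij g" shows "supp (commutator f g) \<subseteq> f ` supp g \<union> supp g"
proof -
  have "supp (commutator f g) \<subseteq> supp (f \<circ> g \<circ> fun_inv f) \<union> supp (fun_inv g)"
    unfolding commutator_def by (rule supp_comp)
  then show ?thesis using assms by (simp add: supp_conj supp_inv)
qed

lemma commutator_eq_id_iff:
  assumes "bij f" "bij g" shows "commutator f g = id \<longleftrightarrow> f \<circ> g = g \<circ> f"
proof
  assume "commutator f g = id"
  then have "commutator f g (g (f x)) = g (f x)" for x by simp
  then have "f (g x) = g (f x)" for x
    using assms by (simp add: commutator_def bij_is_inj)
  then show "f \<circ> g = g \<circ> f" by auto
next
  assume eq: "f \<circ> g = g \<circ> f"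
  have "commutator f g x = x" for x
  proof -
    have "f (g (fun_inv f (fun_inv g x))) = g (f (fun_inv f (fun_inv g x)))" using eq by (metis comp_apply)
    then show ?thesis using assms by (simp add: commutator_def bij_is_surj surj_f_inv_f)
  qed
  then show "commutator f g = id" by auto
qed

section \<open>Algebraic detection of disjoint supports\<close>

text \<open>
  The last axiom is the only one about richness. The exponent \<open>12 = lcm(1, 2, 3, 4)\<close> is the one needed in
  \<open>alg_disjoint_imp_disjoint\<close>: \<open>g ^^ 12\<close> moves \<open>x\<close> only if \<open>x\<close> and its images under \<open>g\<close>, \<open>g ^^ 2\<close>, \<open>g ^^ 3\<close>, \<open>g ^^ 4\<close> are
  five different points.
\<close>

locale homeo_group =
  fixes G :: "('a::t2_space \<Rightarrow> 'a) set"
  assumes continuous: "g \<in> G \<Longrightarrow> continuous_on UNIV g"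
    and bijective: "g \<in> G \<Longrightarrow> bij g"
    and id_mem: "id \<in> G"
    and comp_mem: "f \<in> G \<Longrightarrow> g \<in> G \<Longrightarrow> f \<circ> g \<in> G"
    and inv_mem: "g \<in> G \<Longrightarrow> fun_inv g \<in> G"
    and moving: "open U \<Longrightarrow> x \<in> U \<Longrightarrow> \<exists>g\<in>G. supp g \<subseteq> U \<and> (g ^^ 12) x \<noteq> x"
begin

lemma moving_point:
  assumes "open U" "x \<in> U" obtains g where "g \<in> G" "supp g \<subseteq> U" "g x \<noteq> x"
proof -
  obtain g where g: "g \<in> G" "supp g \<subseteq> U" "(g ^^ 12) x \<noteq> x"
    using moving[OF assms] by auto
  have "(g ^^ n) x = x" if "g x = x" for n
    by (induction n) (use that in auto)
  then have "g x \<noteq> x" using g(3) by blast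
  then show ?thesis using that g by blast
qed

lemma injective: "g \<in> G \<Longrightarrow> inj g"
  using bijective bij_is_inj by auto

lemma power_mem: "g \<in> G \<Longrightarrow> g ^^ n \<in> G"
  by (induction n) (auto simp: id_mem comp_mem simp flip: id_def)

lemma commutator_mem: "f \<in> G \<Longrightarrow> g \<in> G \<Longrightarrow> commutator f g \<in> G"
  by (simp add: commutator_def comp_mem inv_mem)

lemma open_supp: "g \<in> G \<Longrightarrow> open (supp g)"
  unfolding supp_def by (intro open_Collect_neq continuous continuous_on_id)

lemma displaced_neighbourhood:
  assumes "g \<in> G" "g x \<noteq> x"
  obtains U where "open U" "x \<in> U" "g ` U \<inter> U = {}"
proof -
  obtain V W where VW: "open V" "open W" "x \<in> V" "g x \<in> W" "V \<inter> W = {}"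
    using hausdorff[of x "g x"] assms(2) by metis
  have "open (g -` W)" using continuous[OF assms(1)] VW(2) by (simp add: open_vimage)
  then show ?thesis using that[of "V \<inter> g -` W"] VW by fastforce
qed

lemma noncommuting_pair:
  assumes "open U" "x \<in> U"
  obtains f h where "f \<in> G" "h \<in> G" "supp f \<subseteq> U" "supp h \<subseteq> U" "f \<circ> h \<noteq> h \<circ> f"
proof -
  obtain f where f: "f \<in> G" "supp f \<subseteq> U" "f x \<noteq> x" using moving_point[OF assms] by metis
  obtain V where V: "open V" "x \<in> V" "f ` V \<inter> V = {}"
    using displaced_neighbourhood f by metis
  obtain h where h: "h \<in> G" "supp h \<subseteq> U \<inter> V" "h x \<noteq> x"
    using moving_point[of "U \<inter> V" x] V assms by blast
  have "f x \<notin> V" using V by blast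
  then have "h (f x) = f x" using h(2) by (auto simp: supp_def)
  moreover have "f (h x) \<noteq> f x" using h(3) injective[OF f(1)] by (auto dest: injD)
  ultimately have "f \<circ> h \<noteq> h \<circ> f" by (metis comp_apply)
  then show ?thesis using that f h by blast
qed

text \<open>
  Only \<open>f\<close>, \<open>g\<close> and the group operations occur, so automorphisms preserve this relation. It is implied by
  \<open>supp f \<inter> supp g = {}\<close> and implies \<open>supp f \<inter> supp (g ^^ 12) = {}\<close>.
\<close>

definition alg_disjoint :: "('a \<Rightarrow> 'a) \<Rightarrow> ('a \<Rightarrow> 'a) \<Rightarrow> bool" where
  "alg_disjoint f g \<longleftrightarrow> (\<forall>h\<in>G. f \<circ> h \<noteq> h \<circ> f \<longrightarrow>
     (\<exists>a\<in>G. \<exists>b\<in>G. a \<circ> g = g \<circ> a \<and> b \<circ> g = g \<circ> b \<and>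
        commutator a (commutator b h) \<circ> g = g \<circ> commutator a (commutator b h) \<and>
        commutator a (commutator b h) \<noteq> id))"

text \<open>
  If \<open>h\<close> does not commute with \<open>f\<close>, it moves a point of \<open>supp f\<close> and hence displaces a small open set \<open>U \<subseteq> supp f\<close>.
  For \<open>a\<close>, \<open>b\<close> supported in \<open>U\<close>, the commutator of \<open>b\<close> and \<open>h\<close> agrees with \<open>b\<close> on \<open>U\<close>, and its other factor lives in
  \<open>h ` U\<close>, where \<open>a\<close> is trivial. So the double commutator collapses to that of \<open>a\<close> and \<open>b\<close>, which is
  supported in \<open>U\<close> and commutes with \<open>g\<close>.
\<close>

lemma disjoint_imp_alg_disjoint:
  assumes f: "f \<in> G" and g: "g \<in> G" and disj: "supp f \<inter> supp g = {}"
  shows "alg_disjoint f g"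
  unfolding alg_disjoint_def
proof (intro ballI impI)
  fix h assume h: "h \<in> G" and ne: "f \<circ> h \<noteq> h \<circ> f"
  have "supp f \<inter> supp h \<noteq> {}"
    using disjoint_supp_commute[OF injective[OF f] injective[OF h]] ne by blast
  then obtain x where x: "f x \<noteq> x" "h x \<noteq> x" by (auto simp: supp_def)
  obtain V where V: "open V" "x \<in> V" "h ` V \<inter> V = {}"
    using displaced_neighbourhood[OF h x(2)] by metis
  define U where "U = V \<inter> supp f"
  have U: "open U" "x \<in> U" "h ` U \<inter> U = {}" "U \<inter> supp g = {}"
    using V open_supp[OF f] x(1) disj by (auto simp: U_def supp_def)
  obtain a b where ab: "a \<in> G" "b \<in> G" "supp a \<subseteq> U" "supp b \<subseteq> U" "a \<circ> b \<noteq> b \<circ> a"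
    using noncommuting_pair[OF U(1,2)] by metis
  have bij: "bij a" "bij b" "bij h" "bij g" using ab h g bijective by auto
  have comm_g: "k \<circ> g = g \<circ> k" if "k \<in> G" "supp k \<subseteq> U" for k
    using disjoint_supp_commute[OF injective[OF that(1)] injective[OF g]] that U(4) by blast
  define c where "c = h \<circ> fun_inv b \<circ> fun_inv h"
  have c: "supp c = h ` supp b" using bij by (simp add: c_def supp_conj supp_inv)
  have cG: "c \<in> G" unfolding c_def using h ab by (intro comp_mem inv_mem)
  have bc: "commutator b h = b \<circ> c" by (auto simp: commutator_def c_def)
  have ac: "a \<circ> c = c \<circ> a"
    by (rule disjoint_supp_commute) (use injective ab cG c U(3) in blast)+
  have "commutator a (commutator b h) = commutator a b"
  proof -
    have inv_bc: "fun_inv (b \<circ> c) = fun_inv c \<circ> fun_inv b"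
      using bij bijective[OF cG] by (simp add: o_inv_distrib)
    have "commutator a (b \<circ> c) = a \<circ> b \<circ> (c \<circ> fun_inv a \<circ> fun_inv c) \<circ> fun_inv b"
      unfolding commutator_def inv_bc by (simp add: comp_assoc)
    moreover have "c \<circ> fun_inv a \<circ> fun_inv c = fun_inv a"
    proof -
      have "c \<circ> fun_inv a = fun_inv a \<circ> c"
        by (rule disjoint_supp_commute)
          (use injective inv_mem[OF ab(1)] cG c U(3) ab supp_inv[OF bij(1)] in blast)+
      then have "c \<circ> fun_inv a \<circ> fun_inv c = fun_inv a \<circ> (c \<circ> fun_inv c)" by (simp add: comp_assoc)
      then show ?thesis using surj_iff[of c] bij_is_surj[OF bijective[OF cG]] by simp
    qed
    ultimately show ?thesis unfolding bc by (simp add: commutator_def)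
  qed
  moreover have "supp (commutator a b) \<subseteq> U"
  proof -
    have "a ` supp b \<subseteq> U"
    proof
      fix y assume "y \<in> a ` supp b"
      then obtain z where z: "y = a z" "z \<in> U" using ab by auto
      show "y \<in> U"
      proof (cases "z \<in> supp a")
        case True then show ?thesis using supp_invariant[of a z] injective[OF ab(1)] z ab by blast
      next
        case False then show ?thesis using z by (simp add: supp_def)
      qed
    qed
    then show ?thesis using supp_commutator[OF bij(1,2)] ab by blast
  qed
  moreover have "commutator a b \<noteq> id" using commutator_eq_id_iff[OF bij(1,2)] ab by blast
  moreover have "commutator a b \<in> G" using ab by (simp add: commutator_mem)
  ultimately show "\<exists>a\<in>G. \<exists>b\<in>G. a \<circ> g = g \<circ> a \<and> b \<circ> g = g \<circ> b \<and>
        commutator a (commutator b h) \<circ> g = g \<circ> commutator a (commutator b h) \<and>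
        commutator a (commutator b h) \<noteq> id"
    using ab comm_g by metis
qed

text \<open>
  At a point of \<open>supp f \<inter> supp (g ^^ 12)\<close> there is a small \<open>U\<close> that is disjoint from its images under \<open>f\<close> and under the
  first four powers of \<open>g\<close>. An \<open>h\<close> supported in \<open>U\<close> fails to commute with \<open>f\<close>, and the double commutator \<open>w\<close> is then
  supported in at most four sets \<open>k ` U\<close> with \<open>k\<close> commuting with \<open>g\<close>. Since \<open>supp w\<close> is invariant under \<open>g\<close>, two
  among \<open>z, g z, \<dots>, (g ^^ 4) z\<close> lie in the same \<open>k ` U\<close>, whence a power of \<open>g\<close> maps a point of \<open>U\<close> into \<open>U\<close>.
\<close>

lemma alg_disjoint_imp_disjoint:
  assumes f: "f \<in> G" and g: "g \<in> G" and ad: "alg_disjoint f g"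
  shows "supp f \<inter> supp (g ^^ 12) = {}"
proof (rule ccontr)
  assume "supp f \<inter> supp (g ^^ 12) \<noteq> {}"
  then obtain x where x: "f x \<noteq> x" "(g ^^ 12) x \<noteq> x" by (auto simp: supp_def)
  have gi: "(g ^^ i) x \<noteq> x" if "i \<in> {1..4}" for i
  proof
    assume eq: "(g ^^ i) x = x"
    have "((g ^^ i) ^^ n) x = x" for n by (induction n) (use eq in auto)
    moreover have "i dvd 12"
    proof -
      have "i = 1 \<or> i = 2 \<or> i = 3 \<or> i = 4" using that by auto
      then show ?thesis by auto
    qed
    ultimately show False using x(2) by (metis dvdE funpow_mult)
  qed
  have "\<exists>V. open V \<and> x \<in> V \<and> (g ^^ i) ` V \<inter> V = {}" if "i \<in> {1..4}" for i
    using displaced_neighbourhood[OF power_mem[OF g] gi[OF that]] by metis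
  then obtain V where V: "\<And>i. i \<in> {1..4} \<Longrightarrow> open (V i) \<and> x \<in> V i \<and> (g ^^ i) ` V i \<inter> V i = {}"
    by metis
  obtain W where W: "open W" "x \<in> W" "f ` W \<inter> W = {}"
    using displaced_neighbourhood[OF f x(1)] by metis
  define U where "U = W \<inter> (\<Inter>i\<in>{1..4}. V i)"
  have U: "open U" "x \<in> U" using W V by (auto simp: U_def intro!: open_Int open_INT)
  have fU: "f ` U \<inter> U = {}" using W by (auto simp: U_def)
  have gU: "(g ^^ i) ` U \<inter> U = {}" if "i \<in> {1..4}" for i
    using V[OF that] that unfolding U_def by blast
  obtain h where h: "h \<in> G" "supp h \<subseteq> U" "h x \<noteq> x" using moving_point[OF U] by metis
  have "f x \<notin> U" using fU U by blast
  then have "h (f x) = f x" using h(2) by (auto simp: supp_def)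
  moreover have "f (h x) \<noteq> f x" using h(3) injective[OF f] by (auto dest: injD)
  ultimately have "f \<circ> h \<noteq> h \<circ> f" by (metis comp_apply)
  then obtain a b where ab: "a \<in> G" "b \<in> G" "a \<circ> g = g \<circ> a" "b \<circ> g = g \<circ> b"
    and wg: "commutator a (commutator b h) \<circ> g = g \<circ> commutator a (commutator b h)"
    and wid: "commutator a (commutator b h) \<noteq> id"
    using ad h(1) unfolding alg_disjoint_def by metis
  define w where "w = commutator a (commutator b h)"
  have bij: "bij a" "bij b" "bij h" "bij g" using ab h g bijective by auto
  \<comment> \<open>The translates of \<open>U\<close> by these four maps cover the support of the double commutator.\<close>
  define Ks where "Ks = {id, a, b, a \<circ> b}"
  have bh: "supp (commutator b h) \<subseteq> b ` U \<union> U"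
    using supp_commutator[OF bij(2,3)] h(2) by blast
  have "supp w \<subseteq> a ` supp (commutator b h) \<union> supp (commutator b h)"
    unfolding w_def by (intro supp_commutator bij bijective commutator_mem ab h)
  also have "\<dots> \<subseteq> a ` (b ` U \<union> U) \<union> (b ` U \<union> U)"
    using bh by (intro Un_mono image_mono)
  finally have "supp w \<subseteq> a ` (b ` U \<union> U) \<union> (b ` U \<union> U)" .
  then have cover: "\<exists>k\<in>Ks. z \<in> k ` U" if "z \<in> supp w" for z
    using that unfolding Ks_def by fastforce
  obtain z where z: "z \<in> supp w" using wid supp_empty_iff[of w] by (auto simp: w_def)
  have wz: "(g ^^ i) z \<in> supp w" for i
  proof (induction i)
    case (Suc i)
    have "w (g y) = g (w y)" for y using wg unfolding w_def by (metis comp_apply)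
    then show ?case using Suc injective[OF g] by (auto simp: supp_def dest: injD)
  qed (use z in simp)
  define \<kappa> where "\<kappa> i = (SOME k. k \<in> Ks \<and> (g ^^ i) z \<in> k ` U)" for i
  have \<kappa>: "\<kappa> i \<in> Ks \<and> (g ^^ i) z \<in> \<kappa> i ` U" for i
    unfolding \<kappa>_def using someI_ex[of "\<lambda>k. k \<in> Ks \<and> (g ^^ i) z \<in> k ` U"] cover[OF wz, of i]
    by blast
  have "card (\<kappa> ` {0..4::nat}) \<le> card Ks"
    by (rule card_mono) (use \<kappa> in \<open>auto simp: Ks_def\<close>)
  also have "\<dots> \<le> 4" unfolding Ks_def
    using card_length[of "[id, a, b, a \<circ> b]"] by simp
  finally have "\<not> inj_on \<kappa> {0..4::nat}" by (auto dest: card_image)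
  then obtain i j where ij: "i < j" "j \<le> 4" "\<kappa> i = \<kappa> j"
    unfolding inj_on_def by (metis atLeastAtMost_iff linorder_neqE_nat)
  obtain u v where uv: "u \<in> U" "v \<in> U" "(g ^^ i) z = \<kappa> i u" "(g ^^ j) z = \<kappa> i v"
    using \<kappa>[of i] \<kappa>[of j] ij(3) by auto
  have k: "\<kappa> i \<in> G" "\<kappa> i \<circ> g = g \<circ> \<kappa> i"
  proof -
    have "(a \<circ> b) \<circ> g = g \<circ> (a \<circ> b)" using ab(3,4) by (metis comp_assoc)
    then show "\<kappa> i \<in> G" "\<kappa> i \<circ> g = g \<circ> \<kappa> i"
      using \<kappa>[of i] ab by (auto simp: Ks_def id_mem comp_mem)
  qed
  have kn: "\<kappa> i ((g ^^ n) y) = (g ^^ n) (\<kappa> i y)" for n y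
    by (induction n) (use k(2) in \<open>auto simp: fun_eq_iff\<close>)
  have "(g ^^ j) z = (g ^^ (j - i)) ((g ^^ i) z)"
    using ij(1) funpow_add[of "j - i" i g] by simp
  then have "\<kappa> i v = \<kappa> i ((g ^^ (j - i)) u)" using uv kn by simp
  then have "v = (g ^^ (j - i)) u" using injective[OF k(1)] by (auto dest: injD)
  then show False using gU[of "j - i"] ij uv by fastforce
qed

text \<open>
  Write \<open>S\<close> for the set of all \<open>g ^^ 12\<close> with \<open>alg_disjoint f g\<close>. The supports of elements of \<open>S\<close> avoid
  \<open>supp f\<close>, and they accumulate at every point outside \<open>closure (supp f)\<close>; so the centraliser of \<open>S\<close> consists of
  the elements supported in \<open>closure (supp f)\<close>.
\<close>

lemma supp_le_closure_iff:
  assumes f: "f \<in> G" and k: "k \<in> G"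
  shows "supp k \<subseteq> closure (supp f) \<longleftrightarrow>
    (\<forall>g\<in>G. alg_disjoint f g \<longrightarrow> k \<circ> (g ^^ 12) = (g ^^ 12) \<circ> k)"
proof safe
  fix g assume le: "supp k \<subseteq> closure (supp f)" and g: "g \<in> G" "alg_disjoint f g"
  have "supp f \<inter> supp (g ^^ 12) = {}" using alg_disjoint_imp_disjoint f g by auto
  then have "closure (supp f) \<inter> supp (g ^^ 12) = {}"
    using open_supp[OF power_mem[OF g(1)]] by (metis open_Int_closure_eq_empty Int_commute)
  then show "k \<circ> (g ^^ 12) = (g ^^ 12) \<circ> k"
    using disjoint_supp_commute[OF injective[OF k] injective[OF power_mem[OF g(1)]]] le by blast
next
  fix x
  assume comm: "\<forall>g\<in>G. alg_disjoint f g \<longrightarrow> k \<circ> (g ^^ 12) = (g ^^ 12) \<circ> k"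
    and x: "x \<in> supp k"
  show "x \<in> closure (supp f)"
  proof (rule ccontr)
    assume nx: "x \<notin> closure (supp f)"
    obtain V where V: "open V" "x \<in> V" "k ` V \<inter> V = {}"
      using displaced_neighbourhood[OF k] x by (auto simp: supp_def)
    define U where "U = V - closure (supp f)"
    have U: "open U" "x \<in> U" using V nx by (auto simp: U_def)
    obtain g where g: "g \<in> G" "supp g \<subseteq> U" "(g ^^ 12) x \<noteq> x" using moving[OF U] by auto
    have "supp f \<inter> supp g = {}" using g(2) closure_subset by (auto simp: U_def)
    then have eq: "k ((g ^^ 12) x) = (g ^^ 12) (k x)"
      using comm disjoint_imp_alg_disjoint[OF f g(1)] g(1) by (metis comp_apply)
    have "k x \<notin> U" using V by (auto simp: U_def)
    then have gk: "g (k x) = k x" using g(2) by (auto simp: supp_def)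
    have "(g ^^ n) (k x) = k x" for n by (induction n) (use gk in auto)
    then show False using eq g(3) injective[OF k] by (metis injD)
  qed
qed

text \<open>
  This expresses disjointness through the relation that is already known to be preserved by automorphisms.
\<close>

lemma disjoint_supp_iff:
  assumes f: "f \<in> G" and g: "g \<in> G"
  shows "supp f \<inter> supp g = {} \<longleftrightarrow>
    (\<forall>k\<in>G. supp k \<subseteq> closure (supp f) \<and> supp k \<subseteq> closure (supp g) \<longrightarrow> k = id)"
proof safe
  fix k assume disj: "supp f \<inter> supp g = {}" and k: "k \<in> G"
    "supp k \<subseteq> closure (supp f)" "supp k \<subseteq> closure (supp g)"
  have "closure (supp f) \<inter> supp g = {}"
    using disj open_supp[OF g] by (metis open_Int_closure_eq_empty Int_commute)
  then have "supp k \<inter> supp g = {}" using k(2) by blast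
  then have "supp k \<inter> closure (supp g) = {}"
    using open_supp[OF k(1)] by (metis open_Int_closure_eq_empty)
  then have "supp k = {}" using k(3) by blast
  then show "k = id" by (simp add: supp_empty_iff)
next
  fix x assume triv: "\<forall>k\<in>G. supp k \<subseteq> closure (supp f) \<and> supp k \<subseteq> closure (supp g) \<longrightarrow> k = id"
    and x: "x \<in> supp f" "x \<in> supp g"
  obtain k where "k \<in> G" "supp k \<subseteq> supp f \<inter> supp g" "k x \<noteq> x"
    using moving_point[of "supp f \<inter> supp g" x] x open_supp[OF f] open_supp[OF g] by blast
  moreover from this have "k = id" using triv closure_subset by (metis le_infE subset_trans)
  ultimately show "x \<in> {}" by simp
qed

end

section \<open>Automorphisms of locally dense groups are spatial\<close>

locale homeo_group_automorphism = homeo_group G for G :: "('a::t2_space \<Rightarrow> 'a) set" +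
  fixes \<phi> :: "('a \<Rightarrow> 'a) \<Rightarrow> ('a \<Rightarrow> 'a)"
  assumes bij_auto: "bij_betw \<phi> G G"
    and hom: "f \<in> G \<Longrightarrow> g \<in> G \<Longrightarrow> \<phi> (f \<circ> g) = \<phi> f \<circ> \<phi> g"
begin

lemma auto_mem: "g \<in> G \<Longrightarrow> \<phi> g \<in> G"
  using bij_auto by (auto dest: bij_betwE)

lemma auto_surj: "g \<in> G \<Longrightarrow> \<exists>f\<in>G. g = \<phi> f"
  using bij_auto by (auto simp: bij_betw_def)

lemma ball_auto: "(\<forall>g\<in>G. P g) \<longleftrightarrow> (\<forall>g\<in>G. P (\<phi> g))"
  using auto_mem auto_surj by metis

lemma bex_auto: "(\<exists>g\<in>G. P g) \<longleftrightarrow> (\<exists>g\<in>G. P (\<phi> g))"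
  using auto_mem auto_surj by metis

lemma auto_eq_iff: "f \<in> G \<Longrightarrow> g \<in> G \<Longrightarrow> \<phi> f = \<phi> g \<longleftrightarrow> f = g"
  using bij_auto by (auto simp: bij_betw_def inj_on_def)

lemma auto_id: "\<phi> id = id"
proof -
  have "\<phi> id \<circ> \<phi> id = \<phi> id" using hom[OF id_mem id_mem] by simp
  then have "\<phi> id (\<phi> id x) = \<phi> id x" for x by (metis comp_apply)
  then have "\<phi> id x = x" for x using injective[OF auto_mem[OF id_mem]] by (metis injD)
  then show ?thesis by auto
qed

lemma auto_eq_id_iff: "f \<in> G \<Longrightarrow> \<phi> f = id \<longleftrightarrow> f = id"
  using auto_eq_iff[OF _ id_mem] auto_id by metis

lemma auto_inv: assumes "g \<in> G" shows "\<phi> (fun_inv g) = fun_inv (\<phi> g)"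
proof -
  have "\<phi> g \<circ> \<phi> (fun_inv g) = id"
    using hom[OF assms inv_mem[OF assms]] auto_id bij_is_surj[OF bijective[OF assms]]
    by (simp add: surj_iff)
  then show ?thesis
    using bijective[OF auto_mem[OF assms]] by (metis inv_unique_comp bij_is_inj inj_iff
        comp_assoc comp_id id_comp)
qed

lemma auto_power: "g \<in> G \<Longrightarrow> \<phi> (g ^^ n) = \<phi> g ^^ n"
  by (induction n) (auto simp: hom power_mem auto_id simp flip: id_def)

lemma auto_commutator: "f \<in> G \<Longrightarrow> g \<in> G \<Longrightarrow> \<phi> (commutator f g) = commutator (\<phi> f) (\<phi> g)"
  by (simp add: commutator_def hom comp_mem inv_mem auto_inv)

lemma auto_commute_iff:
  "f \<in> G \<Longrightarrow> g \<in> G \<Longrightarrow> \<phi> f \<circ> \<phi> g = \<phi> g \<circ> \<phi> f \<longleftrightarrow> f \<circ> g = g \<circ> f"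
  by (metis hom auto_eq_iff comp_mem)

lemma auto_alg_disjoint:
  assumes f: "f \<in> G" and g: "g \<in> G" shows "alg_disjoint (\<phi> f) (\<phi> g) \<longleftrightarrow> alg_disjoint f g"
proof -
  show ?thesis
    unfolding alg_disjoint_def
    by (subst ball_auto, subst bex_auto, subst (2) bex_auto)
      (simp add: auto_commute_iff f g auto_eq_id_iff commutator_mem flip: auto_commutator
        cong: conj_cong)
qed

lemma auto_supp_le_closure:
  assumes f: "f \<in> G" and k: "k \<in> G"
  shows "supp (\<phi> k) \<subseteq> closure (supp (\<phi> f)) \<longleftrightarrow> supp k \<subseteq> closure (supp f)"
proof -
  show ?thesis
    by (simp add: supp_le_closure_iff auto_mem f k, subst ball_auto)
      (simp add: auto_alg_disjoint f k auto_commute_iff power_mem flip: auto_power)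
qed

lemma auto_disjoint:
  assumes f: "f \<in> G" and g: "g \<in> G"
  shows "supp (\<phi> f) \<inter> supp (\<phi> g) = {} \<longleftrightarrow> supp f \<inter> supp g = {}"
proof -
  show ?thesis
    by (simp only: disjoint_supp_iff auto_mem f g, subst ball_auto)
      (simp add: auto_supp_le_closure f g auto_eq_id_iff)
qed

lemma inverse_automorphism: "homeo_group_automorphism G (inv_into G \<phi>)"
proof
  show "bij_betw (inv_into G \<phi>) G G" using bij_auto by (rule bij_betw_inv_into)
  fix f g assume "f \<in> G" "g \<in> G"
  moreover from this obtain f' g' where "f' \<in> G" "g' \<in> G" "f = \<phi> f'" "g = \<phi> g'"
    using auto_surj by metis
  ultimately show "inv_into G \<phi> (f \<circ> g) = inv_into G \<phi> f \<circ> inv_into G \<phi> g"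
    using bij_auto by (simp add: comp_mem bij_betw_def flip: hom)
qed

text \<open>
  The candidates for the image of \<open>x\<close> under the homeomorphism that induces \<open>\<phi>\<close>.
\<close>

definition image_points :: "'a \<Rightarrow> 'a set" where
  "image_points x = (\<Inter>f\<in>{f\<in>G. x \<in> supp f}. closure (supp (\<phi> f)))"

lemma image_pointsD: "y \<in> image_points x \<Longrightarrow> f \<in> G \<Longrightarrow> f x \<noteq> x \<Longrightarrow> y \<in> closure (supp (\<phi> f))"
  by (auto simp: image_points_def supp_def)

text \<open>
  Finitely many elements that move \<open>x\<close> have a common \<open>k\<close> supported in all their supports, and \<open>\<phi> k\<close> shows
  that the closed sets in question have the finite intersection property.
\<close>

lemma image_points_nonempty:
  assumes compact: "compact (UNIV :: 'a set)"
  shows "image_points x \<noteq> {}"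
proof -
  let ?C = "(\<lambda>f. closure (supp (\<phi> f))) ` {f\<in>G. x \<in> supp f}"
  have "UNIV \<inter> \<Inter>?C \<noteq> {}"
  proof (rule compact_imp_fip[OF compact])
    show "closed T" if "T \<in> ?C" for T using that by auto
    fix A assume A: "finite A" "A \<subseteq> ?C"
    then obtain B where B: "B \<subseteq> {f\<in>G. x \<in> supp f}" "finite B"
      "A = (\<lambda>f. closure (supp (\<phi> f))) ` B"
      using finite_subset_image[OF A] by blast
    let ?U = "\<Inter>f\<in>B. supp f"
    have "open ?U" "x \<in> ?U" using B open_supp by (auto intro!: open_INT)
    then obtain k where k: "k \<in> G" "supp k \<subseteq> ?U" "k x \<noteq> x" using moving_point by metis
    have "supp (\<phi> k) \<subseteq> closure (supp (\<phi> f))" if "f \<in> B" for f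
      using auto_supp_le_closure[of f k] that B(1) k closure_subset by blast
    moreover have "supp (\<phi> k) \<noteq> {}"
      using k auto_eq_id_iff[OF k(1)] by (auto simp: supp_empty_iff)
    ultimately show "UNIV \<inter> \<Inter>A \<noteq> {}" using B(3) by blast
  qed
  then show ?thesis by (simp add: image_points_def)
qed

lemma image_points_conj:
  assumes g: "g \<in> G" and y: "y \<in> image_points x" shows "\<phi> g y \<in> image_points (g x)"
  unfolding image_points_def
proof
  fix f assume "f \<in> {f\<in>G. g x \<in> supp f}"
  then have f: "f \<in> G" "f (g x) \<noteq> g x" by (auto simp: supp_def)
  define k where "k = fun_inv g \<circ> f \<circ> g"
  have gb: "bij g" using bijective g by auto
  have k: "k \<in> G" "g \<circ> k \<circ> fun_inv g = f"
    using g f gb by (auto simp: k_def comp_mem inv_mem fun_eq_iff bij_is_surj surj_f_inv_f)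
  have "k x \<noteq> x" using f(2) k(2) gb by (metis bij_is_inj comp_apply inv_f_f)
  then have "y \<in> closure (supp (\<phi> k))" using image_pointsD[OF y k(1)] by simp
  then have "\<phi> g y \<in> closure (\<phi> g ` supp (\<phi> k))"
    using continuous_image_closure_subset[OF continuous[OF auto_mem[OF g]]] by blast
  moreover have "\<phi> f = \<phi> g \<circ> \<phi> k \<circ> fun_inv (\<phi> g)"
    using g k by (metis hom auto_inv comp_mem inv_mem)
  ultimately show "\<phi> g y \<in> closure (supp (\<phi> f))"
    using supp_conj[OF bijective[OF auto_mem[OF g]]] by simp
qed

text \<open>
  If \<open>x\<close> lay outside the closed support of \<open>\<psi> f\<close>, some \<open>m\<close> moving \<open>x\<close> would have support disjoint from that of
  \<open>\<psi> f\<close>; then the support of \<open>\<phi> m\<close>, whose closure contains \<open>y\<close>, would be disjoint from the neighbourhood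
  \<open>supp f\<close> of \<open>y\<close>.
\<close>

lemma image_points_inverse:
  assumes \<psi>: "homeo_group_automorphism G \<psi>" "\<And>f. f \<in> G \<Longrightarrow> \<phi> (\<psi> f) = f"
    and y: "y \<in> image_points x"
  shows "x \<in> homeo_group_automorphism.image_points G \<psi> y"
proof -
  interpret I: homeo_group_automorphism G \<psi> by fact
  show ?thesis
    unfolding I.image_points_def
  proof
    fix f assume "f \<in> {f\<in>G. y \<in> supp f}"
    then have f: "f \<in> G" "y \<in> supp f" by auto
    show "x \<in> closure (supp (\<psi> f))"
    proof (rule ccontr)
      assume "x \<notin> closure (supp (\<psi> f))"
      then obtain m where m: "m \<in> G" "supp m \<subseteq> - closure (supp (\<psi> f))" "m x \<noteq> x"
        using moving_point[of "- closure (supp (\<psi> f))" x] by auto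
      then have "supp m \<inter> supp (\<psi> f) = {}"
        using closure_subset[of "supp (\<psi> f)"] by blast
      then have "supp (\<phi> m) \<inter> supp f = {}"
        using auto_disjoint[OF m(1) I.auto_mem[OF f(1)]] \<psi>(2) f by simp
      then have "closure (supp (\<phi> m)) \<inter> supp f = {}"
        using open_supp[OF f(1)] by (metis open_Int_closure_eq_empty Int_commute)
      then show False using image_pointsD[OF y m(1,3)] f(2) by blast
    qed
  qed
qed

text \<open>
  Let \<open>y \<noteq> y'\<close> be candidates and \<open>V\<close> a small neighbourhood of \<open>y\<close>. An element whose image is supported in \<open>V\<close> must
  fix \<open>x\<close>, since otherwise \<open>y'\<close> would be in the closure of \<open>V\<close>. So the set of candidates is invariant under the
  elements supported in \<open>V\<close>, and by local density it has interior. But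
  it is contained in the closed support of \<open>\<phi> f\<close> for every \<open>f\<close> moving \<open>x\<close>, and \<open>f\<close> may be chosen so small that its support misses
  that of an \<open>m\<close> with \<open>\<phi> m\<close> supported in this interior.
\<close>

lemma image_points_unique:
  assumes dense: "\<And>U x. open U \<Longrightarrow> x \<in> U \<Longrightarrow>
      interior (closure {g x |g. g \<in> G \<and> supp g \<subseteq> U}) \<noteq> {}"
    and y: "y \<in> image_points x" "y' \<in> image_points x"
  shows "y = y'"
proof (rule ccontr)
  assume "y \<noteq> y'"
  then obtain V V' where V: "open V" "open V'" "y \<in> V" "y' \<in> V'" "V \<inter> V' = {}"
    using hausdorff by metis
  have y'V: "y' \<notin> closure V" using V by (metis disjoint_iff open_Int_closure_eq_empty)
  \<comment> \<open>Elements whose image is supported in \<open>V\<close> fix \<open>x\<close>, so they permute its candidates.\<close>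
  have fix_x: "g x = x" if "g \<in> G" "supp (\<phi> g) \<subseteq> V" for g
  proof (rule ccontr)
    assume "g x \<noteq> x"
    then have "y' \<in> closure (supp (\<phi> g))" using image_pointsD[OF y(2) that(1)] by blast
    then show False using y'V closure_mono[OF that(2)] by blast
  qed
  let ?O = "{g y |g. g \<in> G \<and> supp g \<subseteq> V}"
  have "?O \<subseteq> image_points x"
  proof
    fix z assume "z \<in> ?O"
    then obtain g where g: "g \<in> G" "supp (\<phi> g) \<subseteq> V" "z = \<phi> g y" using auto_surj by auto
    then show "z \<in> image_points x" using image_points_conj[OF g(1) y(1)] fix_x[OF g(1,2)] by metis
  qed
  moreover have "closed (image_points x)" by (auto simp: image_points_def)
  ultimately have sub: "interior (closure ?O) \<subseteq> image_points x"
    by (meson closure_minimal interior_subset subset_trans)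
  define W where "W = interior (closure ?O)"
  obtain z where "open W" "z \<in> W" using dense[OF V(1,3)] by (auto simp: W_def)
  then obtain k where k: "k \<in> G" "supp (\<phi> k) \<subseteq> W" "\<phi> k z \<noteq> z"
    using moving_point auto_surj by metis
  have "k \<noteq> id" using k(3) auto_id by auto
  then obtain t where t: "k t \<noteq> t" "t \<noteq> x"
    by (metis bijective bij_is_inj injD k(1) eq_id_iff)
  obtain A B where AB: "open A" "open B" "t \<in> A" "x \<in> B" "A \<inter> B = {}"
    using hausdorff[OF t(2)] by metis
  obtain m where m: "m \<in> G" "supp m \<subseteq> A \<inter> supp k" "m t \<noteq> t"
    using moving_point[of "A \<inter> supp k" t] AB open_supp[OF k(1)] t by (auto simp: supp_def)
  obtain f where f: "f \<in> G" "supp f \<subseteq> B" "f x \<noteq> x"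
    using moving_point[of B x] AB by auto
  have "supp (\<phi> m) \<inter> supp (\<phi> f) = {}" using auto_disjoint m f AB(5) by blast
  then have "supp (\<phi> m) \<inter> closure (supp (\<phi> f)) = {}"
    using open_supp[OF auto_mem[OF m(1)]] by (metis open_Int_closure_eq_empty)
  moreover have "W \<subseteq> closure (supp (\<phi> f))"
    using sub image_pointsD f unfolding W_def by blast
  moreover have "supp (\<phi> m) \<subseteq> closure W"
    using auto_supp_le_closure[OF k(1) m(1)] m(2) closure_subset[of "supp k"]
      closure_mono[OF k(2)] by blast
  ultimately have "supp (\<phi> m) \<inter> W = {}" "supp (\<phi> m) \<subseteq> closure W" by blast+
  then have "supp (\<phi> m) = {}"
    using open_Int_closure_eq_empty[OF open_supp[OF auto_mem[OF m(1)]]] by blast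
  then have "m = id" using auto_eq_id_iff[OF m(1)] by (simp add: supp_empty_iff)
  then show False using m(3) by simp
qed

end

text \<open>
  The hypothesis \<open>dense\<close> is Rubin's local density: orbits under the elements supported in an open set are
  somewhere dense.
\<close>

theorem spatial_automorphism:
  fixes G :: "('a::t2_space \<Rightarrow> 'a) set"
  assumes "homeo_group_automorphism G \<phi>" and compact: "compact (UNIV :: 'a set)"
    and dense: "\<And>U x. open U \<Longrightarrow> x \<in> U \<Longrightarrow>
      interior (closure {g x |g. g \<in> G \<and> supp g \<subseteq> U}) \<noteq> {}"
  obtains h where "bij h" "\<And>g x. g \<in> G \<Longrightarrow> h (g x) = \<phi> g (h x)"
proof -
  interpret homeo_group_automorphism G \<phi> by fact
  let ?\<psi> = "inv_into G \<phi>"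
  interpret I: homeo_group_automorphism G ?\<psi> by (rule inverse_automorphism)
  have \<phi>\<psi>: "\<phi> (?\<psi> f) = f" "?\<psi> (\<phi> f) = f" if "f \<in> G" for f
    using bij_auto that by (auto simp: bij_betw_def f_inv_into_f)
  define h where "h x = (SOME y. y \<in> image_points x)" for x
  define h' where "h' x = (SOME y. y \<in> I.image_points x)" for x
  have h: "h x \<in> image_points x" for x
    unfolding h_def using image_points_nonempty[OF compact, of x] some_in_eq by auto
  have h': "h' x \<in> I.image_points x" for x
    unfolding h'_def using I.image_points_nonempty[OF compact, of x] some_in_eq by auto
  have swap: "x \<in> I.image_points y" if "y \<in> image_points x" for x y
    using image_points_inverse[OF I.homeo_group_automorphism_axioms \<phi>\<psi>(1) that] .
  have swap': "x \<in> image_points y" if "y \<in> I.image_points x" for x y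
    using I.image_points_inverse[OF homeo_group_automorphism_axioms \<phi>\<psi>(2) that] .
  have "h' (h x) = x" "h (h' x) = x" for x
    using I.image_points_unique[OF dense h' swap[OF h]]
      image_points_unique[OF dense h swap'[OF h']] by auto
  then have "bij h" by (metis bij_betw_byWitness subset_UNIV)
  moreover have "h (g x) = \<phi> g (h x)" if "g \<in> G" for g x
    using image_points_unique[OF dense h image_points_conj[OF that h]] .
  ultimately show thesis using that by blast
qed

section \<open>The circle and lifts of its self-maps\<close>

lemma circle_of_eq_iff: "circle_of x = circle_of y \<longleftrightarrow> x - y \<in> \<int>"
  by (rule circle.abs_eq_iff)

lemma circle_of_add_int [simp]: "circle_of (x + of_int n) = circle_of x"
  by (simp add: circle_of_eq_iff)

lemma circle_of_add_1 [simp]: "circle_of (x + 1) = circle_of x"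
  using circle_of_add_int[of x 1] by simp

lemma circle_of_eqD: "circle_of x = circle_of y \<Longrightarrow> \<exists>n::int. x = y + of_int n"
  unfolding circle_of_eq_iff by (metis Ints_cases add.commute diff_add_cancel)

lemma circle_of_inj_unit:
  assumes "circle_of x = circle_of y" "\<bar>x - y\<bar> < 1" shows "x = y"
proof -
  obtain n :: int where "x = y + of_int n" using circle_of_eqD assms by blast
  then show ?thesis using assms(2) by auto
qed

lemma circle_of_frac: "circle_of (frac x) = circle_of x"
  by (simp add: circle_of_eq_iff frac_def)

lemma circle_cases: obtains x where "z = circle_of x" "0 \<le> x" "x < 1"
proof -
  obtain y where "z = circle_of y" by (metis Quotient_abs_rep Quotient_circle)
  then show ?thesis using that[of "frac y"] by (simp add: circle_of_frac frac_lt_1)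
qed

lemma open_circle_iff: "open U \<longleftrightarrow> open (circle_of -` U)"
  by (simp add: open_circle_def)

lemma continuous_circle_of: "continuous_on UNIV circle_of"
  by (simp add: continuous_on_open_vimage open_circle_iff)

lemma open_circle_image:
  assumes "open U" shows "open (circle_of ` U)"
proof -
  have "circle_of -` circle_of ` U = (\<Union>n::int. (+) (of_int n) ` U)"
  proof (intro subset_antisym subsetI)
    fix x assume "x \<in> circle_of -` circle_of ` U"
    then obtain u where "circle_of x = circle_of u" "u \<in> U" by auto
    moreover from this obtain n :: int where "x = u + of_int n" using circle_of_eqD by blast
    ultimately show "x \<in> (\<Union>n::int. (+) (of_int n) ` U)" by (auto simp: add.commute)
  next
    fix x assume "x \<in> (\<Union>n::int. (+) (of_int n) ` U)"
    then obtain n :: int and u where "x = u + of_int n" "u \<in> U" by (auto simp: add.commute)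
    then show "x \<in> circle_of -` circle_of ` U" by simp
  qed
  then show ?thesis using assms by (auto simp: open_circle_iff intro: open_translation)
qed

instance circle :: t2_space
proof
  fix z w :: circle assume "z \<noteq> w"
  obtain x where x: "z = circle_of x" "0 \<le> x" "x < 1" by (rule circle_cases)
  obtain y where y: "w = circle_of y" "0 \<le> y" "y < 1" by (rule circle_cases)
  define d where "d = min \<bar>x - y\<bar> (1 - \<bar>x - y\<bar>) / 2"
  have "x \<noteq> y" using \<open>z \<noteq> w\<close> x y by auto
  then have d: "d > 0" "2 * d \<le> \<bar>x - y\<bar>" "2 * d \<le> 1 - \<bar>x - y\<bar>" using x y by (auto simp: d_def)
  have disj: "circle_of ` ball x d \<inter> circle_of ` ball y d = {}"
  proof safe
    fix a b assume ab: "a \<in> ball x d" "b \<in> ball y d" and eq: "circle_of a = circle_of b"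
    have *: "\<bar>a - x\<bar> < d" "\<bar>b - y\<bar> < d" using ab by (auto simp: dist_real_def)
    then have "a = b" using d by (intro circle_of_inj_unit[OF eq]) linarith
    then have False using * d by linarith
    then show "circle_of a \<in> {}" by simp
  qed
  show "\<exists>U V. open U \<and> open V \<and> z \<in> U \<and> w \<in> V \<and> U \<inter> V = {}"
    by (intro exI[of _ "circle_of ` ball x d"] exI[of _ "circle_of ` ball y d"])
      (use disj x y d in \<open>auto intro: open_circle_image\<close>)
qed

lemma compact_circle: "compact (UNIV :: circle set)"
proof -
  have "z \<in> circle_of ` {0..1}" for z by (rule circle_cases[of z]) auto
  then have "circle_of ` {0..1} = UNIV" by blast
  moreover have "compact (circle_of ` {0..1})"
    by (rule compact_continuous_image) (auto intro: continuous_on_subset[OF continuous_circle_of])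
  ultimately show ?thesis by simp
qed

definition lifts :: "(real \<Rightarrow> real) \<Rightarrow> (circle \<Rightarrow> circle) \<Rightarrow> bool" where
  "lifts F f \<longleftrightarrow> (\<forall>x. circle_of (F x) = f (circle_of x))"

lemma liftsD: "lifts F f \<Longrightarrow> f (circle_of x) = circle_of (F x)"
  by (simp add: lifts_def)

lemma lifts_comp: "lifts F f \<Longrightarrow> lifts G g \<Longrightarrow> lifts (F \<circ> G) (f \<circ> g)"
  by (simp add: lifts_def)

lemma lifts_id: "lifts id id"
  by (simp add: lifts_def)

lemma lifts_funpow: "lifts F f \<Longrightarrow> lifts (F ^^ n) (f ^^ n)"
  by (induction n) (simp_all add: lifts_comp lifts_id)

lemma lifts_unique:
  assumes "lifts F f" "lifts F g" shows "f = g"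
proof
  fix z show "f z = g z" by (rule circle_cases[of z]) (metis assms lifts_def)
qed

text \<open>
  Continuity is automatic: a monotone surjection of the line is continuous. Leaving it out makes it easier to verify
  that a given function has this property.
\<close>

definition degree_one :: "(real \<Rightarrow> real) \<Rightarrow> bool" where
  "degree_one F \<longleftrightarrow> strict_mono F \<and> surj F \<and> (\<forall>x. F (x + 1) = F x + 1)"

lemma degree_oneD:
  assumes "degree_one F"
  shows "strict_mono F" "surj F" "F (x + 1) = F x + 1" "bij F" "inj F"
  using assms strict_mono_imp_inj_on[of F UNIV] by (auto simp: degree_one_def bij_def)

lemma degree_one_less_iff: "degree_one F \<Longrightarrow> F x < F y \<longleftrightarrow> x < y"
  by (simp add: degree_one_def strict_mono_less)

lemma degree_one_le_iff: "degree_one F \<Longrightarrow> F x \<le> F y \<longleftrightarrow> x \<le> y"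
  by (simp add: degree_one_def strict_mono_less_eq)

lemma degree_one_eq_iff: "degree_one F \<Longrightarrow> F x = F y \<longleftrightarrow> x = y"
  by (simp add: degree_one_def strict_mono_eq)

lemma periodic_add_int:
  fixes F :: "real \<Rightarrow> real"
  assumes "\<And>x. F (x + 1) = F x + 1" shows "F (x + of_int n) = F x + of_int n"
proof (induction n rule: int_induct[where k = 0])
  case (step1 i)
  then show ?case using assms[of "x + of_int i"] by (simp add: add_ac)
next
  case (step2 i)
  then show ?case using assms[of "x + of_int i - 1"] by (simp add: add_ac algebra_simps)
qed simp

lemma degree_one_add_int: "degree_one F \<Longrightarrow> F (x + of_int n) = F x + of_int n"
  by (rule periodic_add_int) (rule degree_oneD)

lemma degree_one_continuous:
  assumes "degree_one F" shows "continuous_on S F"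
proof -
  have "continuous_on UNIV F"
    by (rule continuous_onI_mono) (use assms in \<open>auto simp: degree_one_le_iff degree_oneD\<close>)
  then show ?thesis by (rule continuous_on_subset) simp
qed

lemma degree_one_id: "degree_one id"
  by (simp add: degree_one_def strict_mono_def)

lemma degree_one_comp: "degree_one F \<Longrightarrow> degree_one G \<Longrightarrow> degree_one (F \<circ> G)"
  using comp_surj[of G F] by (simp add: degree_one_def strict_mono_def)

lemma degree_one_funpow: "degree_one F \<Longrightarrow> degree_one (F ^^ n)"
  by (induction n) (simp_all add: degree_one_comp degree_one_id)

lemma degree_one_inv_apply:
  assumes "degree_one F" shows "F (fun_inv F x) = x" "fun_inv F (F x) = x"
  using degree_oneD[OF assms] by (simp_all add: surj_f_inv_f)

lemma degree_one_inv:
  assumes F: "degree_one F" shows "degree_one (fun_inv F)"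
  unfolding degree_one_def
proof (intro conjI allI)
  show "strict_mono (fun_inv F)"
  proof (rule strict_monoI)
    fix x y :: real assume "x < y"
    then show "fun_inv F x < fun_inv F y"
      using degree_one_less_iff[OF F, of "fun_inv F x" "fun_inv F y"]
      by (simp add: degree_one_inv_apply[OF F])
  qed
  show "surj (fun_inv F)" using F by (simp add: degree_oneD inj_imp_surj_inv)
  show "fun_inv F (x + 1) = fun_inv F x + 1" for x
    using degree_one_eq_iff[OF F, of "fun_inv F (x + 1)" "fun_inv F x + 1"]
    by (simp add: degree_one_inv_apply[OF F] degree_oneD(3)[OF F])
qed

lemma degree_one_translation: "degree_one (\<lambda>x. x + c)"
proof -
  have "surj (\<lambda>x. x + c)" by (rule surjI[of _ "\<lambda>x. x - c"]) simp
  then show ?thesis by (simp add: degree_one_def strict_mono_def)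
qed

text \<open>
  On \<open>{p..<p + 1}\<close> both functions take values in \<open>{p..<p + 1}\<close>, where the covering map is injective.
\<close>

lemma degree_one_fix_eq:
  assumes "degree_one F" "degree_one G" "lifts F f" "lifts G f" "F p = p" "G p = p"
  shows "F = G"
proof
  fix x
  define n where "n = \<lfloor>x - p\<rfloor>"
  define t where "t = x - of_int n"
  have t: "p \<le> t" "t < p + 1" "x = t + of_int n" by (simp_all add: t_def n_def) linarith+
  have "p \<le> F t" "F t < p + 1" "p \<le> G t" "G t < p + 1"
    using t assms degree_one_le_iff[of F p t] degree_one_less_iff[of F t "p + 1"]
      degree_one_le_iff[of G p t] degree_one_less_iff[of G t "p + 1"]
    by (simp_all add: degree_oneD(3))
  moreover have "circle_of (F t) = circle_of (G t)" using assms by (simp add: lifts_def)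
  ultimately have "F t = G t" by (intro circle_of_inj_unit) auto
  then show "F x = G x" using assms t(3) by (simp add: degree_one_add_int)
qed

lemma degree_one_int_shift:
  assumes "degree_one F" "degree_one G" "lifts F f" "lifts G f"
  obtains n :: int where "\<And>x. G x = F x + of_int n"
proof -
  obtain n :: int where n: "G 0 = F 0 + of_int n"
    using circle_of_eqD[of "G 0" "F 0"] assms by (auto simp: lifts_def)
  define H where "H = fun_inv F \<circ> (\<lambda>x. x - of_int n) \<circ> G"
  have H: "degree_one H"
    unfolding H_def using assms degree_one_translation[of "- of_int n"]
    by (intro degree_one_comp degree_one_inv) auto
  have "lifts H id" unfolding lifts_def
  proof
    fix x
    obtain m :: int where "G x = F x + of_int m"
      using circle_of_eqD[of "G x" "F x"] assms by (auto simp: lifts_def)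
    then have "G x - of_int n = F (x + of_int (m - n))"
      using degree_one_add_int[OF assms(1), of x "m - n"] by simp
    then have "H x = x + of_int (m - n)" using assms by (simp add: H_def degree_one_inv_apply)
    then show "circle_of (H x) = id (circle_of x)" by (metis circle_of_add_int id_apply)
  qed
  moreover have "H 0 = 0" using n assms by (simp add: H_def degree_one_inv_apply)
  ultimately have "H = id"
    using degree_one_fix_eq[OF H degree_one_id _ lifts_id, of 0] by simp
  then have "F (H x) = F x" for x by simp
  then have "G x = F x + of_int n" for x
    using assms by (simp add: H_def degree_one_inv_apply algebra_simps)
  then show ?thesis using that by blast
qed

lemma degree_one_descends:
  assumes "degree_one F" obtains f where "lifts F f"
proof -
  define f where "f z = circle_of (F (rep_circle z))" for z
  have "lifts F f" unfolding lifts_def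
  proof
    fix x
    define t where "t = rep_circle (circle_of x)"
    have "circle_of x = circle_of t"
      unfolding t_def by (metis Quotient_abs_rep Quotient_circle)
    then obtain n :: int where "x = t + of_int n" using circle_of_eqD by blast
    then have "F x = F t + of_int n" using degree_one_add_int[OF assms, of t n] by simp
    then show "circle_of (F x) = f (circle_of x)"
      unfolding f_def t_def[symmetric] by (simp only: circle_of_add_int)
  qed
  then show ?thesis using that by blast
qed

lemma lifts_continuous:
  assumes "lifts F f" "continuous_on UNIV F" shows "continuous_on UNIV f"
proof (rule continuous_on_open_vimage[THEN iffD2, rule_format])
  fix B :: "circle set" assume "open B"
  have "circle_of -` f -` B = F -` circle_of -` B"
    using assms(1) by (auto simp: lifts_def)
  then have "open (f -` B)"
    using \<open>open B\<close> assms(2) by (simp add: open_circle_iff open_vimage)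
  then show "open (f -` B \<inter> UNIV)" by simp
qed simp

lemma lifts_inv:
  assumes "degree_one F" "lifts F f"
  shows "bij f" "lifts (fun_inv F) (fun_inv f)"
proof -
  obtain g where g: "lifts (fun_inv F) g" using degree_one_descends degree_one_inv assms by metis
  have "F \<circ> fun_inv F = id" "fun_inv F \<circ> F = id"
    using assms by (auto simp: fun_eq_iff degree_one_inv_apply)
  then have "f \<circ> g = id" "g \<circ> f = id"
    using lifts_unique lifts_id lifts_comp[OF assms(2) g] lifts_comp[OF g assms(2)] by metis+
  then show "bij f" "lifts (fun_inv F) (fun_inv f)"
    using g by (metis o_bij, metis inv_unique_comp)
qed

lemma lifts_homeomorphism:
  assumes "degree_one F" "lifts F f" shows "homeomorphism UNIV UNIV f (fun_inv f)"
proof -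
  have "continuous_on UNIV f" "continuous_on UNIV (fun_inv f)"
    using lifts_continuous degree_one_continuous assms lifts_inv degree_one_inv by metis+
  then show ?thesis using lifts_inv(1)[OF assms]
    by (auto simp: homeomorphism_def bij_is_surj surj_f_inv_f bij_is_inj bij_imp_bij_inv)
qed

section \<open>Dyadic rationals\<close>

lemma dyadicE: assumes "x \<in> dyadic" obtains m :: int and n :: nat where "x = of_int m / 2 ^ n"
  using assms by (auto simp: dyadic_def)

lemma dyadicI: "of_int m / 2 ^ n \<in> dyadic"
  by (auto simp: dyadic_def)

lemma dyadic_of_int [simp]: "of_int m \<in> dyadic"
  using dyadicI[of m 0] by simp

lemma dyadic_0 [simp]: "0 \<in> dyadic" and dyadic_1 [simp]: "1 \<in> dyadic"
  using dyadic_of_int[of 0] dyadic_of_int[of 1] by simp_all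

lemma dyadic_minus: "x \<in> dyadic \<Longrightarrow> - x \<in> dyadic"
  by (elim dyadicE) (metis dyadicI minus_divide_left of_int_minus)

lemma dyadic_add:
  assumes "x \<in> dyadic" "y \<in> dyadic" shows "x + y \<in> dyadic"
proof -
  obtain m n m' n' where "x = of_int m / 2 ^ n" "y = of_int m' / 2 ^ n'"
    using assms by (elim dyadicE)
  then have "x + y = of_int (m * 2 ^ n' + m' * 2 ^ n) / 2 ^ (n + n')"
    by (simp add: add_frac_eq power_add)
  then show ?thesis by (metis dyadicI)
qed

lemma dyadic_diff: "x \<in> dyadic \<Longrightarrow> y \<in> dyadic \<Longrightarrow> x - y \<in> dyadic"
  using dyadic_add[of x "- y"] dyadic_minus[of y] by simp

lemma dyadic_mult:
  assumes "x \<in> dyadic" "y \<in> dyadic" shows "x * y \<in> dyadic"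
proof -
  obtain m n m' n' where "x = of_int m / 2 ^ n" "y = of_int m' / 2 ^ n'"
    using assms by (elim dyadicE)
  then have "x * y = of_int (m * m') / 2 ^ (n + n')"
    by (simp add: power_add)
  then show ?thesis by (metis dyadicI)
qed

lemma dyadic_powi: "2 powi k \<in> dyadic"
proof (cases "k \<ge> 0")
  case True
  then have "2 powi k = (of_int (2 ^ nat k) :: real)" by (simp add: power_int_def)
  then show ?thesis by (metis dyadic_of_int)
next
  case False
  then have "2 powi k = (of_int 1 / 2 ^ nat (- k) :: real)"
    by (simp add: power_int_def inverse_eq_divide power_divide)
  then show ?thesis by (metis dyadicI)
qed

lemma dyadic_powi_mult_iff: "2 powi k * x \<in> dyadic \<longleftrightarrow> x \<in> dyadic"
proof
  assume "2 powi k * x \<in> dyadic"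
  then have "2 powi (- k) * (2 powi k * x) \<in> dyadic" by (rule dyadic_mult[OF dyadic_powi])
  moreover have "2 powi (- k) * (2 powi k * x) = x" by (simp add: power_int_minus field_simps)
  ultimately show "x \<in> dyadic" by simp
qed (intro dyadic_mult dyadic_powi)

lemma dyadic_add_iff: "y \<in> dyadic \<Longrightarrow> x + y \<in> dyadic \<longleftrightarrow> x \<in> dyadic"
  using dyadic_add[of x y] dyadic_diff[of "x + y" y] by auto

lemma dyadic_dense:
  assumes "a < b" obtains q where "q \<in> dyadic" "a < q" "q < b"
proof -
  obtain n where "1 / (b - a) < 2 ^ n" using real_arch_pow[of 2] by auto
  then have n: "1 < (b - a) * 2 ^ n" using assms by (simp add: field_simps)
  define m where "m = \<lfloor>a * 2 ^ n\<rfloor> + 1"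
  have "a * 2 ^ n < of_int m" "of_int m \<le> a * 2 ^ n + 1" unfolding m_def by linarith+
  moreover from this n have "of_int m < b * 2 ^ n" by (simp add: algebra_simps)
  ultimately show ?thesis by (intro that[of "of_int m / 2 ^ n"] dyadicI) (simp_all add: field_simps)
qed

lemma countable_dyadic: "countable dyadic"
proof -
  have "dyadic = (\<lambda>(m :: int, n :: nat). of_int m / 2 ^ n) ` UNIV" by (auto simp: dyadic_def)
  then show ?thesis using countable_image[OF countableI_type] by metis
qed

text \<open>
  Used to find points away from the breakpoints; a neighbourhood is uncountable.
\<close>

lemma nondyadic_near:
  assumes "\<forall>\<^sub>F y in nhds x. P y" obtains y where "y \<notin> dyadic" "P (y::real)"
proof -
  obtain d where d: "d > 0" "\<And>y. dist y x < d \<Longrightarrow> P y"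
    using assms by (auto simp: eventually_nhds_metric)
  have "uncountable {x - d<..<x + d}" using d by (simp add: uncountable_open_interval)
  then obtain y where "y \<in> {x - d<..<x + d}" "y \<notin> dyadic"
    using countable_subset[OF _ countable_dyadic] by blast
  then show ?thesis using that d(2)[of y] by (auto simp: dist_real_def)
qed

section \<open>Locally affine functions\<close>

lemma affine_near_iff: "affine_near F a x \<longleftrightarrow> (\<exists>b. \<forall>\<^sub>F y in nhds x. F y = a * y + b)"
proof
  assume "affine_near F a x"
  then show "\<exists>b. \<forall>\<^sub>F y in nhds x. F y = a * y + b"
    unfolding affine_near_def by (intro exI[of _ "F x - a * x"]) (simp add: algebra_simps)
next
  assume "\<exists>b. \<forall>\<^sub>F y in nhds x. F y = a * y + b"
  then obtain b where b: "\<forall>\<^sub>F y in nhds x. F y = a * y + b" by blast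
  then have "F x = a * x + b" by (rule eventually_nhds_x_imp_x)
  then show "affine_near F a x"
    unfolding affine_near_def using b by (auto elim!: eventually_mono simp: algebra_simps)
qed

lemma affine_nearI: "open U \<Longrightarrow> x \<in> U \<Longrightarrow> (\<And>y. y \<in> U \<Longrightarrow> F y = a * y + b) \<Longrightarrow> affine_near F a x"
  unfolding affine_near_iff eventually_nhds by blast

lemma affine_near_open:
  assumes "affine_near F a x" shows "\<forall>\<^sub>F y in nhds x. affine_near F a y"
proof -
  obtain b where "\<forall>\<^sub>F y in nhds x. F y = a * y + b" using assms by (auto simp: affine_near_iff)
  then have "\<forall>\<^sub>F z in nhds x. \<forall>\<^sub>F y in nhds z. F y = a * y + b" by (simp add: eventually_eventually)
  then show ?thesis by (rule eventually_mono) (auto simp: affine_near_iff)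
qed

lemma affine_near_unique:
  assumes "affine_near F a x" "affine_near F b x" shows "a = b"
proof -
  have "\<forall>\<^sub>F y in nhds x. a * (y - x) = b * (y - x)"
    using assms unfolding affine_near_def by eventually_elim (metis add_left_cancel)
  then obtain e where "e > 0" "\<And>y. dist y x < e \<Longrightarrow> a * (y - x) = b * (y - x)"
    unfolding eventually_nhds_metric by blast
  from this(2)[of "x + e / 2"] this(1) show ?thesis by (simp add: dist_real_def)
qed

lemma affine_near_comp:
  assumes "affine_near F a (G x)" "affine_near G b x"
  shows "affine_near (F \<circ> G) (a * b) x"
proof -
  obtain c d where c: "\<forall>\<^sub>F y in nhds (G x). F y = a * y + c"
    and d: "\<forall>\<^sub>F y in nhds x. G y = b * y + d"
    using assms by (auto simp: affine_near_iff)
  have "((\<lambda>y. b * y + d) \<longlongrightarrow> b * x + d) (nhds x)"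
    by (intro tendsto_intros filterlim_ident)
  moreover have "G x = b * x + d" using d by (rule eventually_nhds_x_imp_x)
  ultimately have "filterlim (\<lambda>y. b * y + d) (nhds (G x)) (nhds x)" by simp
  then have "\<forall>\<^sub>F y in nhds x. F (b * y + d) = a * (b * y + d) + c"
    by (rule eventually_compose_filterlim[OF c])
  then have "\<forall>\<^sub>F y in nhds x. (F \<circ> G) y = a * b * y + (a * d + c)"
    using d by eventually_elim (simp add: algebra_simps)
  then show ?thesis by (auto simp: affine_near_iff)
qed

lemma affine_near_inv:
  assumes F: "degree_one F" and "affine_near F a x" and a: "a \<noteq> 0"
  shows "affine_near (fun_inv F) (1 / a) (F x)"
proof -
  obtain b where b: "\<forall>\<^sub>F y in nhds x. F y = a * y + b"
    using assms(2) by (auto simp: affine_near_iff)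
  have "continuous_on UNIV (fun_inv F)" using F degree_one_inv degree_one_continuous by blast
  then have "isCont (fun_inv F) (F x)" by (simp add: continuous_on_eq_continuous_at)
  then have "(fun_inv F \<longlongrightarrow> fun_inv F (F x)) (nhds (F x))"
    by (simp add: continuous_at tendsto_at_iff_tendsto_nhds)
  then have "filterlim (fun_inv F) (nhds x) (nhds (F x))" using F by (simp add: degree_one_inv_apply)
  then have "\<forall>\<^sub>F z in nhds (F x). F (fun_inv F z) = a * fun_inv F z + b"
    by (rule eventually_compose_filterlim[OF b])
  then have "\<forall>\<^sub>F z in nhds (F x). fun_inv F z = 1 / a * z + (- b / a)"
    using F a by (auto elim!: eventually_mono simp: degree_one_inv_apply field_simps)
  then show ?thesis unfolding affine_near_iff by blast
qed

section \<open>Lifts of elements of Thompson's group\<close>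

text \<open>
  Elements of \<open>T\<close> are handled through these lifts (\<open>in_thompson_T_iff\<close>). The set \<open>S\<close> may be larger than the set of
  breakpoints: the composition of two broken maps can be affine at a point where both are broken, and a superset
  is easier to follow through composition and inversion. Moreover, \<open>F\<close> is required to reflect dyadic points, which
  makes the class closed under inverses.
\<close>

definition pl_lift :: "(real \<Rightarrow> real) \<Rightarrow> bool" where
  "pl_lift F \<longleftrightarrow> degree_one F \<and> (\<forall>x. F x \<in> dyadic \<longleftrightarrow> x \<in> dyadic) \<and>
     (\<exists>S\<subseteq>dyadic. finite (circle_of ` S) \<and> (\<forall>x. x \<notin> S \<longrightarrow> (\<exists>k::int. affine_near F (2 powi k) x)))"

lemma pl_liftI:
  assumes "degree_one F" "\<And>x. F x \<in> dyadic \<longleftrightarrow> x \<in> dyadic" "S \<subseteq> dyadic" "finite (circle_of ` S)"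
    "\<And>x. x \<notin> S \<Longrightarrow> \<exists>k::int. affine_near F (2 powi k) x"
  shows "pl_lift F"
  using assms unfolding pl_lift_def by blast

lemma pl_lift_comp:
  assumes F: "pl_lift F" and G: "pl_lift G" shows "pl_lift (F \<circ> G)"
proof -
  obtain S where S: "S \<subseteq> dyadic" "finite (circle_of ` S)"
    "\<And>x. x \<notin> S \<Longrightarrow> \<exists>k::int. affine_near F (2 powi k) x" using F by (auto simp: pl_lift_def)
  obtain T where T: "T \<subseteq> dyadic" "finite (circle_of ` T)"
    "\<And>x. x \<notin> T \<Longrightarrow> \<exists>k::int. affine_near G (2 powi k) x" using G by (auto simp: pl_lift_def)
  have d: "degree_one F" "degree_one G" using F G by (auto simp: pl_lift_def)
  obtain g where g: "lifts G g" using degree_one_descends d by metis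
  show ?thesis
  proof (rule pl_liftI[of _ "T \<union> G -` S"])
    show "degree_one (F \<circ> G)" using d by (rule degree_one_comp)
    show "(F \<circ> G) x \<in> dyadic \<longleftrightarrow> x \<in> dyadic" for x using F G by (simp add: pl_lift_def)
    show "T \<union> G -` S \<subseteq> dyadic" using S T G by (auto simp: pl_lift_def)
    have "circle_of ` (G -` S) \<subseteq> g -` (circle_of ` S)" by (auto simp: liftsD[OF g])
    moreover have "finite (g -` (circle_of ` S))"
      using S(2) lifts_inv(1)[OF d(2) g] by (intro finite_vimageI) (auto simp: bij_is_inj)
    ultimately show "finite (circle_of ` (T \<union> G -` S))"
      using T(2) by (simp add: image_Un finite_subset)
    fix x assume "x \<notin> T \<union> G -` S"
    then obtain k l :: int where "affine_near F (2 powi k) (G x)" "affine_near G (2 powi l) x"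
      using S(3)[of "G x"] T(3)[of x] by auto
    then have "affine_near (F \<circ> G) (2 powi (k + l)) x"
      by (simp add: power_int_add affine_near_comp)
    then show "\<exists>k::int. affine_near (F \<circ> G) (2 powi k) x" by blast
  qed
qed

lemma pl_lift_inv:
  assumes F: "pl_lift F" shows "pl_lift (fun_inv F)"
proof -
  obtain S where S: "S \<subseteq> dyadic" "finite (circle_of ` S)"
    "\<And>x. x \<notin> S \<Longrightarrow> \<exists>k::int. affine_near F (2 powi k) x" using F by (auto simp: pl_lift_def)
  have d: "degree_one F" using F by (auto simp: pl_lift_def)
  obtain f where f: "lifts F f" using degree_one_descends d by metis
  show ?thesis
  proof (rule pl_liftI[of _ "F ` S"])
    show "degree_one (fun_inv F)" using d by (rule degree_one_inv)
    show "fun_inv F x \<in> dyadic \<longleftrightarrow> x \<in> dyadic" for x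
      using F degree_one_inv_apply(1)[OF d] by (metis pl_lift_def)
    show "F ` S \<subseteq> dyadic" using S F by (auto simp: pl_lift_def)
    have "circle_of ` F ` S = f ` circle_of ` S" by (simp add: image_image liftsD[OF f])
    then show "finite (circle_of ` F ` S)" using S by simp
    fix x assume x: "x \<notin> F ` S"
    have Fx: "F (fun_inv F x) = x" using d by (rule degree_one_inv_apply)
    then have "fun_inv F x \<notin> S" using x by force
    then obtain k :: int where "affine_near F (2 powi k) (fun_inv F x)" using S(3) by blast
    then have "affine_near (fun_inv F) (1 / 2 powi k) x" using affine_near_inv[OF d] Fx by fastforce
    then have "affine_near (fun_inv F) (2 powi (- k)) x"
      by (simp add: power_int_minus inverse_eq_divide)
    then show "\<exists>k::int. affine_near (fun_inv F) (2 powi k) x" by blast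
  qed
qed

lemma pl_lift_translation:
  assumes "c \<in> dyadic" shows "pl_lift (\<lambda>x. x + c)"
proof (rule pl_liftI[of _ "{}"])
  fix x show "\<exists>k::int. affine_near (\<lambda>x. x + c) (2 powi k) x"
    by (rule exI[of _ 0]) (auto intro!: affine_nearI[of UNIV])
qed (use assms in \<open>auto simp: degree_one_translation dyadic_add_iff\<close>)

lemma circle_of_dyadic_iff: "circle_of x \<in> circle_of ` dyadic \<longleftrightarrow> x \<in> dyadic"
proof
  assume "circle_of x \<in> circle_of ` dyadic"
  then obtain d and n :: int where "d \<in> dyadic" "x = d + of_int n" using circle_of_eqD by blast
  then show "x \<in> dyadic" by (simp add: dyadic_add)
qed simp

text \<open>
  By periodicity \<open>F (x + 1) - F x\<close> is a positive integer; if it were at least \<open>2\<close>, the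
  intermediate value theorem would give a point of the open period where \<open>F\<close> exceeds \<open>F x\<close> by exactly \<open>1\<close>, contradicting the
  injectivity of \<open>f\<close>.
\<close>

lemma strict_mono_lift_degree_one:
  assumes mono: "strict_mono F" and cont: "continuous_on UNIV F" and l: "lifts F f" and inj: "inj f"
  shows "degree_one F"
proof -
  have int: "\<exists>n::int. F (x + 1) = F x + of_int n" for x
    using circle_of_eqD[of "F (x + 1)" "F x"] l by (simp add: lifts_def)
  have step: "F (x + 1) = F x + 1" for x
  proof -
    obtain n :: int where n: "F (x + 1) = F x + of_int n" using int by blast
    have "F x < F (x + 1)" using mono by (simp add: strict_mono_less)
    then have "n \<ge> 1" using n by simp
    moreover have "\<not> n \<ge> 2"
    proof
      assume "n \<ge> 2"
      then have "F x \<le> F x + 1" "F x + 1 \<le> F (x + 1)" using n by linarith+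
      then obtain y where y: "x \<le> y" "y \<le> x + 1" "F y = F x + 1"
        using IVT'[of F x "F x + 1" "x + 1"] continuous_on_subset[OF cont, of "{x..x + 1}"] by auto
      then have "y \<noteq> x" "y \<noteq> x + 1" using n \<open>n \<ge> 2\<close> by auto
      have "f (circle_of y) = f (circle_of x)" using l y(3) by (metis circle_of_add_1 lifts_def)
      then have "circle_of y = circle_of x" using inj by (auto dest: injD)
      then have "y = x" using y \<open>y \<noteq> x\<close> \<open>y \<noteq> x + 1\<close> by (intro circle_of_inj_unit) auto
      then show False using \<open>y \<noteq> x\<close> by simp
    qed
    ultimately have "n = 1" by simp
    then show ?thesis using n by simp
  qed
  have "surj F"
    unfolding surj_def
  proof
    fix y
    define n where "n = \<lfloor>y - F 0\<rfloor>"
    have "F (0 + of_int n) = F 0 + of_int n" "F (0 + of_int (n + 1)) = F 0 + of_int (n + 1)"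
      by (rule periodic_add_int, rule step)+
    moreover have "F 0 + of_int n \<le> y" "y \<le> F 0 + of_int (n + 1)" by (simp_all add: n_def) linarith+
    ultimately show "\<exists>x. y = F x"
      using IVT'[of F "of_int n" y "of_int (n + 1)"] continuous_on_subset[OF cont] by fastforce
  qed
  then show ?thesis using mono step by (simp add: degree_one_def)
qed

text \<open>
  Two points are not formal. An element of \<open>T\<close> reflects dyadic points: at a nondyadic \<open>x\<close> the lift is affine with slope
  a power of \<open>2\<close>, so comparison with a nearby dyadic point would make \<open>x\<close> dyadic if \<open>F x\<close> were. Conversely, all
  slopes are powers of \<open>2\<close>, even at points of \<open>S\<close>, because a slope persists at nearby points outside \<open>S\<close>.
\<close>

lemma in_thompson_T_iff: "in_thompson_T f \<longleftrightarrow> (\<exists>F. pl_lift F \<and> lifts F f)"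
proof
  assume "in_thompson_T f"
  then obtain g F where g: "homeomorphism UNIV UNIV f g"
    and D: "f ` (circle_of ` dyadic) \<subseteq> circle_of ` dyadic"
    and F: "is_lift F f" "strict_mono F"
    and br: "finite (circle_of ` breakpoints F)" "breakpoints F \<subseteq> dyadic"
    and sl: "\<And>a x. affine_near F a x \<Longrightarrow> \<exists>k::int. a = 2 powi k"
    unfolding in_thompson_T_def by blast
  have l: "lifts F f" and cont: "continuous_on UNIV F" using F by (auto simp: is_lift_def lifts_def)
  have "inj f" using g by (metis homeomorphism_def inj_on_inverseI)
  then have d: "degree_one F" using strict_mono_lift_degree_one F cont l by blast
  have DF: "F x \<in> dyadic" if "x \<in> dyadic" for x
  proof -
    have "f (circle_of x) \<in> circle_of ` dyadic" using D that by blast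
    then show ?thesis by (simp add: liftsD[OF l] circle_of_dyadic_iff)
  qed
  have FD: "x \<in> dyadic" if "F x \<in> dyadic" for x
  proof (cases "x \<in> breakpoints F")
    case False
    then obtain a where a: "affine_near F a x" by (auto simp: breakpoints_def)
    then obtain k :: int where k: "a = 2 powi k" using sl by blast
    obtain e where e: "e > 0" "\<And>y. dist y x < e \<Longrightarrow> F y = F x + a * (y - x)"
      using a by (auto simp: affine_near_def eventually_nhds_metric)
    obtain q where q: "q \<in> dyadic" "x < q" "q < x + e" using dyadic_dense[of x "x + e"] e by auto
    have "2 powi k * (q - x) = F q - F x" using e(2)[of q] q k by (auto simp: dist_real_def)
    moreover have "F q - F x \<in> dyadic" using that DF q(1) by (intro dyadic_diff)
    ultimately have "q - x \<in> dyadic" using dyadic_powi_mult_iff by metis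
    then show ?thesis using dyadic_diff[of q "q - x"] q(1) by simp
  qed (use br in auto)
  have "pl_lift F"
  proof (rule pl_liftI[of _ "breakpoints F"])
    show "F x \<in> dyadic \<longleftrightarrow> x \<in> dyadic" for x using DF FD by blast
    show "\<exists>k::int. affine_near F (2 powi k) x" if "x \<notin> breakpoints F" for x
      using that sl by (auto simp: breakpoints_def)
  qed (use d br in auto)
  then show "\<exists>F. pl_lift F \<and> lifts F f" using l by blast
next
  assume "\<exists>F. pl_lift F \<and> lifts F f"
  then obtain F where F: "pl_lift F" and l: "lifts F f" by blast
  obtain S where S: "S \<subseteq> dyadic" "finite (circle_of ` S)"
    "\<And>x. x \<notin> S \<Longrightarrow> \<exists>k::int. affine_near F (2 powi k) x" using F by (auto simp: pl_lift_def)
  have d: "degree_one F" using F by (auto simp: pl_lift_def)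
  have "breakpoints F \<subseteq> S" using S(3) by (auto simp: breakpoints_def)
  moreover have "\<exists>k::int. a = 2 powi k" if a: "affine_near F a x" for a x
  proof -
    obtain y where y: "y \<notin> dyadic" "affine_near F a y"
      using nondyadic_near[OF affine_near_open[OF a]] by blast
    then obtain k :: int where "affine_near F (2 powi k) y" using S by blast
    then show ?thesis using affine_near_unique y(2) by blast
  qed
  moreover have "is_lift F f"
    using l degree_one_continuous[OF d] by (simp add: is_lift_def lifts_def)
  moreover have "f ` (circle_of ` dyadic) \<subseteq> circle_of ` dyadic"
    using F by (auto simp: liftsD[OF l] pl_lift_def)
  moreover have "\<exists>g. homeomorphism UNIV UNIV f g" using lifts_homeomorphism[OF d l] by blast
  ultimately show "in_thompson_T f"
    unfolding in_thompson_T_def using S degree_oneD(1)[OF d]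
    by (metis finite_subset image_mono subset_trans)
qed

lemma thompson_T_simps [simp]:
  "carrier thompson_T = {f. in_thompson_T f}" "f \<otimes>\<^bsub>thompson_T\<^esub> g = f \<circ> g" "\<one>\<^bsub>thompson_T\<^esub> = id"
  by (simp_all add: thompson_T_def)

lemma in_thompson_T_comp: "in_thompson_T f \<Longrightarrow> in_thompson_T g \<Longrightarrow> in_thompson_T (f \<circ> g)"
  using pl_lift_comp lifts_comp in_thompson_T_iff by metis

lemma in_thompson_T_id: "in_thompson_T id"
  using pl_lift_translation[of 0] lifts_id unfolding in_thompson_T_iff by (auto simp: id_def)

lemma pl_lift_degree_one: "pl_lift F \<Longrightarrow> degree_one F"
  by (simp add: pl_lift_def)

lemma in_thompson_T_inv: "in_thompson_T f \<Longrightarrow> in_thompson_T (fun_inv f)"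
  using pl_lift_inv lifts_inv(2) pl_lift_degree_one in_thompson_T_iff by metis

lemma in_thompson_T_bij: "in_thompson_T f \<Longrightarrow> bij f"
  using lifts_inv(1) pl_lift_degree_one in_thompson_T_iff by metis

lemma group_thompson_T: "group thompson_T"
proof (rule groupI)
  fix f assume "f \<in> carrier thompson_T"
  then have "in_thompson_T (fun_inv f)" "fun_inv f \<circ> f = id"
    by (auto simp: in_thompson_T_inv dest!: in_thompson_T_bij bij_is_inj)
  then show "\<exists>g\<in>carrier thompson_T. g \<otimes>\<^bsub>thompson_T\<^esub> f = \<one>\<^bsub>thompson_T\<^esub>" by auto
qed (auto simp: in_thompson_T_comp in_thompson_T_id)

lemma thompson_T_m_inv: "in_thompson_T f \<Longrightarrow> inv\<^bsub>thompson_T\<^esub> f = fun_inv f"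
  using in_thompson_T_bij[of f]
  by (intro group.inv_equality[OF group_thompson_T]) (auto simp: in_thompson_T_inv bij_is_inj)

section \<open>Construction of piecewise linear maps\<close>

text \<open>
  The local version of \<open>pl_lift\<close> on a closed interval, made for gluing. The values outside the interval do not matter.
\<close>

definition dyadic_pl :: "(real \<Rightarrow> real) \<Rightarrow> real \<Rightarrow> real \<Rightarrow> bool" where
  "dyadic_pl F s t \<longleftrightarrow> s \<le> t \<and> strict_mono_on {s..t} F \<and> F ` {s..t} = {F s..F t} \<and>
     (\<forall>x\<in>{s..t}. F x \<in> dyadic \<longleftrightarrow> x \<in> dyadic) \<and>
     (\<exists>S\<subseteq>dyadic. finite S \<and> (\<forall>x\<in>{s<..<t} - S. \<exists>k::int. affine_near F (2 powi k) x))"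

lemma affine_near_cong:
  assumes "affine_near F a x" "open U" "x \<in> U" "\<And>y. y \<in> U \<Longrightarrow> G y = F y"
  shows "affine_near G a x"
proof -
  have "\<forall>\<^sub>F y in nhds x. y \<in> U" using assms by (simp add: eventually_nhds_in_open)
  moreover obtain b where "\<forall>\<^sub>F y in nhds x. F y = a * y + b"
    using assms(1) by (auto simp: affine_near_iff)
  ultimately have "\<forall>\<^sub>F y in nhds x. G y = a * y + b"
    by eventually_elim (simp add: assms(4))
  then show ?thesis by (auto simp: affine_near_iff)
qed

lemma dyadic_pl_cong:
  assumes F: "dyadic_pl F s t" and eq: "\<And>x. s \<le> x \<Longrightarrow> x \<le> t \<Longrightarrow> G x = F x"
  shows "dyadic_pl G s t"
proof -
  obtain S where S: "S \<subseteq> dyadic" "finite S"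
    "\<And>x. x \<in> {s<..<t} - S \<Longrightarrow> \<exists>k::int. affine_near F (2 powi k) x"
    using F unfolding dyadic_pl_def by blast
  have "\<exists>k::int. affine_near G (2 powi k) x" if x: "x \<in> {s<..<t} - S" for x
  proof -
    obtain k :: int where k: "affine_near F (2 powi k) x" using S(3)[OF x] by blast
    have "affine_near G (2 powi k) x"
      by (rule affine_near_cong[OF k, of "{s<..<t}"]) (use x eq in auto)
    then show ?thesis by blast
  qed
  then have "\<forall>x\<in>{s<..<t} - S. \<exists>k::int. affine_near G (2 powi k) x" by blast
  moreover have "s \<le> t" using F by (simp add: dyadic_pl_def)
  moreover have "G ` {s..t} = {G s..G t}"
  proof -
    have "G ` {s..t} = F ` {s..t}" using eq by (intro image_cong) auto
    then show ?thesis using F eq[of s] eq[of t] by (simp add: dyadic_pl_def)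
  qed
  moreover have "strict_mono_on {s..t} G"
    using F eq by (auto simp: dyadic_pl_def strict_mono_on_def)
  moreover have "\<forall>x\<in>{s..t}. G x \<in> dyadic \<longleftrightarrow> x \<in> dyadic"
    using F eq by (simp add: dyadic_pl_def)
  ultimately show ?thesis using S(1,2) unfolding dyadic_pl_def by blast
qed

lemma dyadic_pl_affine:
  assumes "s \<le> t" "d \<in> dyadic" shows "dyadic_pl (\<lambda>x. 2 powi k * x + d) s t"
proof -
  have "affine_near (\<lambda>x. 2 powi k * x + d) (2 powi k) x" for x
    by (rule affine_nearI[of UNIV]) auto
  moreover have "(2::real) powi k > 0" by (simp add: zero_less_power_int)
  moreover have "(\<lambda>x. 2 powi k * x + d) ` {s..t} = {2 powi k * s + d..2 powi k * t + d}"
    using assms calculation(2) by (simp add: image_affinity_atLeastAtMost)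
  ultimately show ?thesis using assms
    by (auto simp: dyadic_pl_def strict_mono_on_def dyadic_add_iff dyadic_powi_mult_iff
        intro!: exI[of _ "{}"])
qed

lemma dyadic_pl_id: "s \<le> t \<Longrightarrow> dyadic_pl (\<lambda>x. x) s t"
  using dyadic_pl_affine[of s t 0 0] by simp

lemma dyadic_pl_join:
  assumes F: "dyadic_pl F s m" and G: "dyadic_pl F m t" and m: "m \<in> dyadic"
  shows "dyadic_pl F s t"
proof -
  obtain S where S: "S \<subseteq> dyadic" "finite S"
    "\<And>x. x \<in> {s<..<m} - S \<Longrightarrow> \<exists>k::int. affine_near F (2 powi k) x"
    using F unfolding dyadic_pl_def by blast
  obtain T where T: "T \<subseteq> dyadic" "finite T"
    "\<And>x. x \<in> {m<..<t} - T \<Longrightarrow> \<exists>k::int. affine_near F (2 powi k) x"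
    using G unfolding dyadic_pl_def by blast
  have le: "s \<le> m" "m \<le> t" using F G by (auto simp: dyadic_pl_def)
  have mono: "strict_mono_on {s..m} F" "strict_mono_on {m..t} F"
    using F G by (auto simp: dyadic_pl_def)
  have "strict_mono_on {s..t} F"
  proof (rule strict_mono_onI)
    fix x y assume xy: "x \<in> {s..t}" "y \<in> {s..t}" "x < y"
    consider "y \<le> m" | "m \<le> x" | "x < m" "m < y" by linarith
    then show "F x < F y"
    proof cases
      case 3
      then have "F x < F m" "F m < F y"
        using mono xy le by (auto simp: strict_mono_on_def)
      then show ?thesis by simp
    qed (use mono xy in \<open>auto simp: strict_mono_on_def\<close>)
  qed
  moreover have "F ` {s..t} = {F s..F t}"
  proof -
    have "{s..t} = {s..m} \<union> {m..t}" using le by auto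
    then have "F ` {s..t} = {F s..F m} \<union> {F m..F t}"
      using F G by (simp add: dyadic_pl_def image_Un)
    moreover have "F s \<le> F m" "F m \<le> F t"
      using mono le by (auto simp: strict_mono_on_def le_less)
    ultimately show ?thesis by auto
  qed
  moreover have "F x \<in> dyadic \<longleftrightarrow> x \<in> dyadic" if "x \<in> {s..t}" for x
    using F G that by (cases "x \<le> m") (auto simp: dyadic_pl_def)
  moreover have "\<exists>k::int. affine_near F (2 powi k) x" if "x \<in> {s<..<t} - insert m (S \<union> T)" for x
  proof (cases "x < m")
    case True
    show ?thesis by (rule S(3)) (use True that in auto)
  next
    case False
    show ?thesis by (rule T(3)) (use False that in auto)
  qed
  moreover have "insert m (S \<union> T) \<subseteq> dyadic" "finite (insert m (S \<union> T))" using S T m by auto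
  ultimately show ?thesis
    unfolding dyadic_pl_def using le by (meson order_trans)
qed

lemma dyadic_pl_glue:
  assumes F: "dyadic_pl F s m" and G: "dyadic_pl G m t" and m: "m \<in> dyadic" "F m = G m"
  shows "dyadic_pl (\<lambda>x. if x \<le> m then F x else G x) s t"
proof (rule dyadic_pl_join[OF _ _ m(1)])
  show "dyadic_pl (\<lambda>x. if x \<le> m then F x else G x) s m" by (rule dyadic_pl_cong[OF F]) simp
  show "dyadic_pl (\<lambda>x. if x \<le> m then F x else G x) m t" by (rule dyadic_pl_cong[OF G]) (simp add: m)
qed

text \<open>
  Two affine pieces suffice. Let \<open>L\<close> and \<open>M\<close> be the two lengths and choose \<open>j\<close> with \<open>2\<^sup>j L \<le> M \<le> 2\<^sup>j\<^sup>+\<^sup>1 L\<close>. Slope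
  \<open>2\<^sup>j\<^sup>+\<^sup>1\<close> on an initial piece of length \<open>\<xi>\<close> and slope \<open>2\<^sup>j\<close> on the rest give total length \<open>2\<^sup>j (L + \<xi>)\<close>, so
  \<open>\<xi> = M / 2\<^sup>j - L\<close>, which is dyadic and lies between \<open>0\<close> and \<open>L\<close>.
\<close>

lemma dyadic_pl_interpolate:
  assumes "a < b" "c < d" and D: "a \<in> dyadic" "b \<in> dyadic" "c \<in> dyadic" "d \<in> dyadic"
  obtains F where "dyadic_pl F a b" "F a = c" "F b = d"
proof -
  define L M where "L = b - a" and "M = d - c"
  have LM: "L > 0" "M > 0" "L \<in> dyadic" "M \<in> dyadic"
    using assms by (auto simp: L_def M_def dyadic_diff)
  define j where "j = \<lfloor>log 2 (M / L)\<rfloor>"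
  define q :: real where "q = 2 powi j"
  have q: "q > 0" by (simp add: q_def zero_less_power_int)
  have "2 powr of_int j \<le> 2 powr log 2 (M / L)" "2 powr log 2 (M / L) \<le> 2 powr (of_int j + 1)"
    unfolding j_def by (intro powr_mono; linarith)+
  then have "q \<le> M / L" "M / L \<le> 2 * q"
    using LM by (auto simp: q_def powr_add powr_real_of_int')
  then have qLM: "q * L \<le> M" "M \<le> 2 * q * L" using LM by (auto simp: field_simps)
  define m where "m = a + (M / q - L)"
  have m: "a \<le> m" "m \<le> b" using qLM q by (auto simp: m_def L_def[symmetric] field_simps) (auto simp: L_def algebra_simps)
  have Mq: "M / q = 2 powi (- j) * M" by (simp add: q_def power_int_minus field_simps)
  have mD: "m \<in> dyadic"
    unfolding m_def Mq using D LM by (intro dyadic_add dyadic_diff dyadic_mult dyadic_powi)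
  define A where "A = (\<lambda>x. 2 powi (j + 1) * x + (c - 2 powi (j + 1) * a))"
  define B where "B = (\<lambda>x. 2 powi j * x + (d - 2 powi j * b))"
  have A: "dyadic_pl A a m" unfolding A_def
    using D m by (intro dyadic_pl_affine dyadic_diff dyadic_mult dyadic_powi)
  have B: "dyadic_pl B m b" unfolding B_def
    using D m by (intro dyadic_pl_affine dyadic_diff dyadic_mult dyadic_powi)
  have q2: "2 powi (j + 1) = 2 * q" by (simp add: q_def power_int_add)
  have "A m = c + 2 * q * (m - a)" unfolding A_def q2 by (simp add: algebra_simps)
  also have "\<dots> = c + 2 * M - 2 * q * L" using q by (simp add: m_def field_simps)
  also have "\<dots> = d - q * (b - m)" using q by (simp add: m_def L_def M_def field_simps)
  also have "\<dots> = B m" by (simp add: B_def q_def algebra_simps)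
  finally have AB: "A m = B m" .
  have "A a = c" by (simp add: A_def)
  moreover have "B b = d" by (simp add: B_def)
  ultimately show ?thesis using that[OF dyadic_pl_glue[OF A B mD AB]] m AB by auto
qed

lemma dyadic_frac_iff: "frac x \<in> dyadic \<longleftrightarrow> x \<in> dyadic"
  using dyadic_add_iff[of "of_int \<lfloor>x\<rfloor>" "frac x"] by (simp add: frac_def)

lemma degree_one_extension:
  fixes F0 :: "real \<Rightarrow> real"
  assumes mono: "strict_mono_on {0..<1} F0" and img: "F0 ` {0..<1} = {0..<1}"
  shows "degree_one (\<lambda>x. F0 (frac x) + of_int \<lfloor>x\<rfloor>)"
  unfolding degree_one_def
proof (intro conjI allI)
  let ?F = "\<lambda>x. F0 (frac x) + of_int \<lfloor>x\<rfloor>"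
  have fr: "frac x \<in> {0..<1}" for x :: real by (simp add: frac_lt_1)
  have bd: "F0 (frac x) \<in> {0..<1}" for x using img fr by blast
  show "strict_mono ?F"
  proof (rule strict_monoI)
    fix x y :: real assume "x < y"
    show "?F x < ?F y"
    proof (cases "\<lfloor>x\<rfloor> = \<lfloor>y\<rfloor>")
      case True
      then have "frac x < frac y" using \<open>x < y\<close> by (simp add: frac_def)
      then have "F0 (frac x) < F0 (frac y)" using strict_mono_onD[OF mono] fr by blast
      then show ?thesis using True by simp
    next
      case False
      then have "\<lfloor>x\<rfloor> + 1 \<le> \<lfloor>y\<rfloor>" using \<open>x < y\<close> floor_mono[of x y] by linarith
      then have "of_int \<lfloor>x\<rfloor> + 1 \<le> (of_int \<lfloor>y\<rfloor> :: real)" by linarith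
      moreover have "F0 (frac x) < 1" "0 \<le> F0 (frac y)" using bd by auto
      ultimately show ?thesis by linarith
    qed
  qed
  show "surj ?F" unfolding surj_def
  proof
    fix y :: real
    obtain t where t: "t \<in> {0..<1}" "frac y = F0 t" using img fr[of y] by (metis imageE)
    then have "\<lfloor>t + of_int \<lfloor>y\<rfloor>\<rfloor> = \<lfloor>y\<rfloor>" by (intro floor_unique) auto
    then have "y = ?F (t + of_int \<lfloor>y\<rfloor>)" using t(2) by (simp add: frac_def)
    then show "\<exists>x. y = ?F x" ..
  qed
  show "?F (x + 1) = ?F x + 1" for x by (simp add: frac_def)
qed

lemma periodic_extension:
  assumes F0: "dyadic_pl F0 0 1" "F0 0 = 0" "F0 1 = 1"
  obtains F where "pl_lift F" "\<And>x. 0 \<le> x \<Longrightarrow> x \<le> 1 \<Longrightarrow> F x = F0 x"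
proof -
  define F where "F x = F0 (frac x) + of_int \<lfloor>x\<rfloor>" for x
  have mono: "strict_mono_on {0..1} F0" and img: "F0 ` {0..1} = {0..1}"
    using F0 by (auto simp: dyadic_pl_def)
  obtain S0 where S0: "S0 \<subseteq> dyadic" "finite S0"
    "\<And>x. x \<in> {0<..<1} - S0 \<Longrightarrow> \<exists>k::int. affine_near F0 (2 powi k) x"
    using F0 unfolding dyadic_pl_def by blast
  have fr: "frac x \<in> {0..1}" "frac x < 1" for x :: real by (auto simp: frac_lt_1 less_imp_le)
  have bd: "0 \<le> F0 (frac x)" "F0 (frac x) < 1" for x
  proof -
    show "0 \<le> F0 (frac x)" using img fr by force
    have "F0 (frac x) < F0 1" using mono fr[of x] unfolding strict_mono_on_def by auto
    then show "F0 (frac x) < 1" using F0 by simp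
  qed
  have img': "F0 ` {0..<1} = {0..<1}"
  proof (intro subset_antisym subsetI)
    fix y assume "y \<in> F0 ` {0..<1}"
    then obtain t where "0 \<le> t" "t < 1" "y = F0 t" by auto
    then show "y \<in> {0..<1}" using bd[of t] by (simp add: frac_eq)
  next
    fix y :: real assume y: "y \<in> {0..<1}"
    then obtain t where t: "t \<in> {0..1}" "y = F0 t" using img by (metis atLeastAtMost_iff atLeastLessThan_iff imageE less_imp_le)
    then have "t \<noteq> 1" using F0(3) y by auto
    then show "y \<in> F0 ` {0..<1}" using t by auto
  qed
  have "degree_one F" unfolding F_def
    by (rule degree_one_extension[OF _ img']) (use mono in \<open>auto simp: strict_mono_on_def\<close>)
  moreover have "F x \<in> dyadic \<longleftrightarrow> x \<in> dyadic" for x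
  proof -
    have "F x \<in> dyadic \<longleftrightarrow> F0 (frac x) \<in> dyadic" unfolding F_def by (rule dyadic_add_iff) simp
    also have "\<dots> \<longleftrightarrow> frac x \<in> dyadic" using F0(1) fr(1)[of x] unfolding dyadic_pl_def by blast
    finally show ?thesis by (simp add: dyadic_frac_iff)
  qed
  moreover define S where "S = {x. frac x \<in> insert 0 S0}"
  moreover have "S \<subseteq> dyadic"
  proof
    fix x assume "x \<in> S"
    then have "frac x = 0 \<or> frac x \<in> S0" unfolding S_def by blast
    then have "frac x \<in> dyadic" using S0(1) dyadic_0 by (metis subsetD)
    then show "x \<in> dyadic" by (simp add: dyadic_frac_iff)
  qed
  moreover have "finite (circle_of ` S)"
  proof (rule finite_subset)
    show "circle_of ` S \<subseteq> circle_of ` insert 0 S0"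
      unfolding S_def by (metis (mono_tags, lifting) circle_of_frac image_eqI image_subsetI mem_Collect_eq)
  qed (use S0 in simp)
  moreover have "\<exists>k::int. affine_near F (2 powi k) x" if "x \<notin> S" for x
  proof -
    define n where "n = \<lfloor>x\<rfloor>"
    have "frac x \<in> {0<..<1} - S0" using that fr[of x] by (auto simp: S_def less_le)
    then obtain k :: int where k: "affine_near F0 (2 powi k) (frac x)" using S0(3) by blast
    have "affine_near (\<lambda>y. y - of_int n) 1 x" by (rule affine_nearI[of UNIV _ _ _ "- of_int n"]) auto
    then have 1: "affine_near (F0 \<circ> (\<lambda>y. y - of_int n)) (2 powi k) x"
      using affine_near_comp[of F0 "2 powi k" "\<lambda>y. y - of_int n" x 1] k by (simp add: n_def frac_def)
    have "affine_near (\<lambda>y. y + of_int n) 1 y" for y :: real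
      by (rule affine_nearI[of UNIV _ _ _ "of_int n"]) auto
    then have "affine_near ((\<lambda>y. y + of_int n) \<circ> (F0 \<circ> (\<lambda>y. y - of_int n))) (1 * 2 powi k) x"
      using 1 by (intro affine_near_comp)
    then have "affine_near F (1 * 2 powi k) x"
    proof (rule affine_near_cong)
      have "frac x \<noteq> 0" using that by (simp add: S_def)
      then have "of_int n \<noteq> x" by (auto simp: n_def frac_def)
      moreover have "of_int n \<le> x" "x < of_int n + 1" unfolding n_def by linarith+
      ultimately have "of_int n < x" "x < of_int n + 1" by linarith+
      then show "x \<in> {of_int n<..<of_int n + 1}" by simp
      fix y assume "y \<in> {of_int n<..<of_int n + (1::real)}"
      then have "\<lfloor>y\<rfloor> = n" by (intro floor_unique) auto
      then show "F y = ((\<lambda>y. y + of_int n) \<circ> (F0 \<circ> (\<lambda>y. y - of_int n))) y"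
        by (simp add: F_def frac_def)
    qed simp
    then show ?thesis by auto
  qed
  ultimately have "pl_lift F" by (intro pl_liftI) auto
  moreover have "F x = F0 x" if "0 \<le> x" "x \<le> 1" for x
    using that F0 by (cases "x = 1") (auto simp: F_def frac_def floor_unique[of 0 x, simplified])
  ultimately show ?thesis using that by blast
qed

lemma pl_lift_conj_translation:
  assumes "pl_lift F" "a \<in> dyadic" shows "pl_lift (\<lambda>x. F (x - a) + a)"
proof -
  have "pl_lift ((\<lambda>x. x + a) \<circ> F \<circ> (\<lambda>x. x + - a))"
    using assms by (intro pl_lift_comp pl_lift_translation dyadic_minus)
  then show ?thesis by (simp add: comp_def)
qed

lemma pl_bump_unit:
  assumes "0 < c" "c < b" "b \<le> 1" "0 < d" "d < b"
    and D: "b \<in> dyadic" "c \<in> dyadic" "d \<in> dyadic"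
  obtains F where "pl_lift F" "F c = d" "\<And>x. b \<le> x \<Longrightarrow> x \<le> 1 \<Longrightarrow> F x = x"
proof -
  obtain E1 where E1: "dyadic_pl E1 0 c" "E1 0 = 0" "E1 c = d"
    using dyadic_pl_interpolate[of 0 c 0 d] assms by auto
  obtain E2 where E2: "dyadic_pl E2 c b" "E2 c = d" "E2 b = b"
    using dyadic_pl_interpolate[of c b d b] assms by auto
  let ?E = "\<lambda>x. if x \<le> c then E1 x else E2 x"
  let ?F = "\<lambda>x. if x \<le> b then ?E x else x"
  have E: "dyadic_pl ?E 0 b" by (rule dyadic_pl_glue[OF E1(1) E2(1) D(2)]) (simp add: E1 E2)
  have I: "dyadic_pl (\<lambda>x. x) b 1" using assms by (intro dyadic_pl_id)
  have "dyadic_pl ?F 0 1" by (rule dyadic_pl_glue[OF E I D(1)]) (use assms E2 in simp)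
  moreover have "?F 0 = 0" "?F 1 = 1" using assms E1 E2 by auto
  ultimately obtain G where G: "pl_lift G" "\<And>x. 0 \<le> x \<Longrightarrow> x \<le> 1 \<Longrightarrow> G x = ?F x"
    by (rule periodic_extension) blast
  show ?thesis
  proof (rule that)
    show "G c = d" using G(2)[of c] assms E1 by simp
    show "G x = x" if "b \<le> x" "x \<le> 1" for x using G(2)[of x] assms E2 that by (cases "x = b") auto
  qed (fact G(1))
qed

text \<open>
  The map is supported in the arc from \<open>a\<close> to \<open>b\<close>; all the elements of \<open>T\<close> needed for transitivity are
  compositions of such maps.
\<close>

lemma pl_bump:
  assumes "a < c" "c < b" "b \<le> a + 1" "a < d" "d < b"
    and D: "a \<in> dyadic" "b \<in> dyadic" "c \<in> dyadic" "d \<in> dyadic"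
  obtains F where "pl_lift F" "F c = d" "\<And>x. b \<le> x \<Longrightarrow> x \<le> a + 1 \<Longrightarrow> F x = x"
proof -
  obtain F where F: "pl_lift F" "F (c - a) = d - a" "\<And>x. b - a \<le> x \<Longrightarrow> x \<le> 1 \<Longrightarrow> F x = x"
    using pl_bump_unit[of "c - a" "b - a" "d - a"] assms by (auto simp: dyadic_diff)
  show ?thesis
    by (rule that[of "\<lambda>x. F (x - a) + a"]) (use F D in \<open>auto intro: pl_lift_conj_translation\<close>)
qed

text \<open>
  This element generates the right germs at \<open>0\<close> and has trivial left germ there.
\<close>

lemma pl_doubling:
  obtains K where "pl_lift K" "\<And>x. 0 \<le> x \<Longrightarrow> x \<le> 1 / 8 \<Longrightarrow> K x = 2 * x"
    "\<And>x. 1 / 2 \<le> x \<Longrightarrow> x \<le> 1 \<Longrightarrow> K x = x"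
proof -
  have D: "1 / 8 \<in> dyadic" "1 / 4 \<in> dyadic" "1 / 2 \<in> dyadic"
    using dyadicI[of 1 3] dyadicI[of 1 2] dyadicI[of 1 1] by simp_all
  have A: "dyadic_pl (\<lambda>x. 2 * x) 0 (1 / 8)"
    using dyadic_pl_affine[of 0 "1 / 8" 0 1] by simp
  obtain B where B: "dyadic_pl B (1 / 8) (1 / 2)" "B (1 / 8) = 1 / 4" "B (1 / 2) = 1 / 2"
    using dyadic_pl_interpolate[of "1 / 8" "1 / 2" "1 / 4" "1 / 2"] D by auto
  let ?E = "\<lambda>x. if x \<le> 1 / 8 then 2 * x else B x"
  let ?F = "\<lambda>x. if x \<le> 1 / 2 then ?E x else x"
  have E: "dyadic_pl ?E 0 (1 / 2)" by (rule dyadic_pl_glue[OF A B(1) D(1)]) (simp add: B)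
  have I: "dyadic_pl (\<lambda>x. x) (1 / 2) 1" by (intro dyadic_pl_id) simp
  have "dyadic_pl ?F 0 1" by (rule dyadic_pl_glue[OF E I D(3)]) (simp add: B)
  moreover have "?F 0 = 0" "?F 1 = 1" by auto
  ultimately obtain G where G: "pl_lift G" "\<And>x. 0 \<le> x \<Longrightarrow> x \<le> 1 \<Longrightarrow> G x = ?F x"
    by (rule periodic_extension) blast
  show ?thesis
  proof (rule that)
    show "G x = 2 * x" if "0 \<le> x" "x \<le> 1 / 8" for x using G(2)[of x] that by simp
    show "G x = x" if "1 / 2 \<le> x" "x \<le> 1" for x
    proof (cases "x = 1 / 2")
      case True
      have "G (1 / 2) = B (1 / 2)" using G(2)[of "1 / 2"] by simp
      then show ?thesis using B(3) unfolding True by argo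
    next
      case False
      then have "\<not> x \<le> 1 / 2" using that by simp
      then show ?thesis using G(2)[of x] that by simp
    qed
  qed (fact G(1))
qed

section \<open>Thompson's group as a locally dense group\<close>

lemma supp_lift_subset:
  assumes F: "degree_one F" "lifts F f" and fixed: "\<And>x. b \<le> x \<Longrightarrow> x \<le> a + 1 \<Longrightarrow> F x = x" and "b \<le> a + 1"
  shows "supp f \<subseteq> circle_of ` {a<..<b}"
proof
  fix z assume z: "z \<in> supp f"
  obtain y where y: "z = circle_of y" by (rule circle_cases[of z])
  define x where "x = y - of_int \<lfloor>y - a\<rfloor>"
  have x: "z = circle_of x" "a \<le> x" "x \<le> a + 1"
    using circle_of_add_int[of x "\<lfloor>y - a\<rfloor>"] y by (auto simp: x_def) linarith+
  have "F a = a" using fixed[of "a + 1"] assms(4) degree_oneD(3)[OF F(1), of a] by simp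
  then have "x \<noteq> a" "\<not> b \<le> x" using z fixed[of x] x F(2) by (auto simp: supp_def liftsD)
  then show "z \<in> circle_of ` {a<..<b}" using x by auto
qed

lemma dyadic_arc_inside:
  assumes "open U" "circle_of x \<in> U"
  obtains a b where "a \<in> dyadic" "b \<in> dyadic" "a < x" "x < b" "b \<le> a + 1" "circle_of ` {a<..<b} \<subseteq> U"
proof -
  have "open (circle_of -` U)" "x \<in> circle_of -` U" using assms by (auto simp: open_circle_iff)
  then obtain e where e: "e > 0" "ball x e \<subseteq> circle_of -` U" by (meson open_contains_ball)
  \<comment> \<open>The bound \<open>1 / 2\<close> keeps the arc shorter than the circle.\<close>
  define r where "r = min e (1 / 2)"
  have r: "r > 0" "r \<le> e" "r \<le> 1 / 2" using e by (auto simp: r_def)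
  obtain a where a: "a \<in> dyadic" "x - r < a" "a < x" using dyadic_dense[of "x - r" x] r by auto
  obtain b where b: "b \<in> dyadic" "x < b" "b < x + r" using dyadic_dense[of x "x + r"] r by auto
  have "{a<..<b} \<subseteq> ball x e" using a b r by (auto simp: dist_real_def)
  then show ?thesis using that[of a b] a b r e by force
qed

definition thompson_set :: "(circle \<Rightarrow> circle) set" where
  "thompson_set = {f. in_thompson_T f}"

lemma thompson_bump:
  assumes "a < c" "c < b" "b \<le> a + 1" "a < d" "d < b"
    and D: "a \<in> dyadic" "b \<in> dyadic" "c \<in> dyadic" "d \<in> dyadic"
  obtains F f where "f \<in> thompson_set" "lifts F f" "degree_one F" "F c = d" "F a = a" "F b = b"
    "supp f \<subseteq> circle_of ` {a<..<b}" "\<And>x. x \<in> dyadic \<Longrightarrow> F x \<in> dyadic"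
proof -
  obtain F where F: "pl_lift F" "F c = d" "\<And>x. b \<le> x \<Longrightarrow> x \<le> a + 1 \<Longrightarrow> F x = x"
    using pl_bump[OF assms] by blast
  have d: "degree_one F" using F pl_lift_degree_one by blast
  obtain f where f: "lifts F f" using degree_one_descends d by metis
  have "f \<in> thompson_set" using f F(1) by (auto simp: thompson_set_def in_thompson_T_iff)
  moreover have "F a = a" using F(3)[of "a + 1"] assms degree_oneD(3)[OF d, of a] by simp
  moreover have "supp f \<subseteq> circle_of ` {a<..<b}"
    using supp_lift_subset[OF d f F(3)] assms by simp
  moreover have "F x \<in> dyadic" if "x \<in> dyadic" for x using F(1) that by (simp add: pl_lift_def)
  ultimately show ?thesis using that[of f F] f d F assms by simp
qed

lemma thompson_homeo_group: "homeo_group thompson_set"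
proof
  fix f assume "f \<in> thompson_set"
  then obtain F where "pl_lift F" "lifts F f" by (auto simp: thompson_set_def in_thompson_T_iff)
  then show "continuous_on UNIV f"
    using lifts_continuous degree_one_continuous pl_lift_degree_one by blast
next
  fix U :: "circle set" and z assume U: "open U" "z \<in> U"
  obtain x where x: "z = circle_of x" by (rule circle_cases)
  obtain a b where ab: "a \<in> dyadic" "b \<in> dyadic" "a < x" "x < b" "b \<le> a + 1"
    "circle_of ` {a<..<b} \<subseteq> U"
    using dyadic_arc_inside U x by metis
  obtain c where c: "c \<in> dyadic" "a < c" "c < x" using dyadic_dense[OF ab(3)] by blast
  obtain d where d: "d \<in> dyadic" "x < d" "d < b" using dyadic_dense[OF ab(4)] by blast
  obtain F f where F: "f \<in> thompson_set" "lifts F f" "degree_one F" "F c = d" "F b = b"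
    "supp f \<subseteq> circle_of ` {a<..<b}"
    by (rule thompson_bump[of a c b d]) (use ab(1-5) c d in simp_all)
  have "x < F x" using degree_one_less_iff[OF F(3), of c x] F(4) c d by simp
  then have inc: "(F ^^ n) x < (F ^^ Suc n) x \<and> (F ^^ n) x < b" for n
  proof (induction n)
    case (Suc n)
    then show ?case using degree_one_less_iff[OF F(3)] F(5) by (metis funpow.simps(2) comp_apply)
  qed (use ab in simp)
  have "x < (F ^^ Suc n) x" for n
  proof (induction n)
    case (Suc n)
    then show ?case using inc[of "Suc n"] by linarith
  qed (use inc[of 0] in simp)
  from this[of 11] have gt: "x < (F ^^ 12) x" by simp
  have "circle_of ((F ^^ 12) x) \<noteq> circle_of x"
  proof
    assume "circle_of ((F ^^ 12) x) = circle_of x"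
    then have "(F ^^ 12) x = x"
      by (rule circle_of_inj_unit) (use gt inc[of 12] ab in linarith)
    then show False using gt by simp
  qed
  then have "(f ^^ 12) z \<noteq> z" using lifts_funpow[OF F(2), of 12] by (simp add: x liftsD)
  then show "\<exists>g\<in>thompson_set. supp g \<subseteq> U \<and> (g ^^ 12) z \<noteq> z" using F ab by blast
qed (auto simp: thompson_set_def in_thompson_T_comp in_thompson_T_id in_thompson_T_inv in_thompson_T_bij)

text \<open>
  Every \<open>x\<close> in a dyadic arc \<open>(a, b)\<close> can be moved into any smaller dyadic arc \<open>(c, d)\<close> by elements supported in
  \<open>(a, b)\<close>: first a bump of \<open>(a, b)\<close> takes a dyadic point to the left of \<open>x\<close> to \<open>c\<close>, so that \<open>x\<close> passes \<open>c\<close>; then a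
  bump of \<open>(c, b)\<close> takes a dyadic point to the right of the image to \<open>d\<close>.
\<close>

lemma thompson_locally_dense:
  fixes U :: "circle set"
  assumes U: "open U" "z \<in> U"
  shows "interior (closure {g z |g. g \<in> thompson_set \<and> supp g \<subseteq> U}) \<noteq> {}"
proof -
  let ?O = "{g z |g. g \<in> thompson_set \<and> supp g \<subseteq> U}"
  obtain x where x: "z = circle_of x" by (rule circle_cases)
  obtain a b where ab: "a \<in> dyadic" "b \<in> dyadic" "a < x" "x < b" "b \<le> a + 1"
    "circle_of ` {a<..<b} \<subseteq> U"
    using dyadic_arc_inside U x by metis
  have "circle_of ` {a<..<b} \<subseteq> closure ?O"
  proof (rule ccontr)
    assume "\<not> circle_of ` {a<..<b} \<subseteq> closure ?O"
    then obtain w where w: "w \<in> circle_of ` {a<..<b}" "w \<notin> closure ?O" by blast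
    then obtain y where y: "a < y" "y < b" "circle_of y \<notin> closure ?O" by auto
    let ?V = "{a<..<b} \<inter> circle_of -` (- closure ?O)"
    have "open ?V" by (intro open_Int open_circle_iff[THEN iffD1]) auto
    moreover have "y \<in> ?V" using y by auto
    ultimately obtain e where e: "e > 0" "ball y e \<subseteq> ?V" by (meson open_contains_ball)
    obtain c where c: "c \<in> dyadic" "y - e < c" "c < y" using dyadic_dense[of "y - e" y] e by auto
    obtain d where d: "d \<in> dyadic" "y < d" "d < y + e" using dyadic_dense[of y "y + e"] e by auto
    have sub: "{c..d} \<subseteq> ?V"
    proof (rule order_trans[OF _ e(2)])
      show "{c..d} \<subseteq> ball y e" using c d by (auto simp: dist_real_def)
    qed
    have "c \<in> ?V" "d \<in> ?V" by (rule subsetD[OF sub], use c d in simp)+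
    then have cd: "a < c" "c < d" "d < b" using c d by simp_all
    obtain p where p: "p \<in> dyadic" "a < p" "p < x" using dyadic_dense[OF ab(3)] by blast
    obtain q where q: "q \<in> dyadic" "x < q" "q < b" using dyadic_dense[OF ab(4)] by blast
    obtain F f where F: "f \<in> thompson_set" "lifts F f" "degree_one F" "F p = c" "F b = b"
      "supp f \<subseteq> circle_of ` {a<..<b}" "F q \<in> dyadic"
      by (rule thompson_bump[of a p b c]) (use ab(1-5) c(1) p q(1) cd in simp_all)
    have Fx: "c < F x" "F x < F q" "F q < b"
      using p q F(4,5) degree_one_less_iff[OF F(3), of p x] degree_one_less_iff[OF F(3), of x q]
        degree_one_less_iff[OF F(3), of q b] by simp_all
    obtain G g where G: "g \<in> thompson_set" "lifts G g" "degree_one G" "G (F q) = d" "G c = c"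
      "supp g \<subseteq> circle_of ` {c<..<b}"
      by (rule thompson_bump[of c "F q" b d]) (use ab(1,2,5) c(1) d(1) F(7) Fx cd in simp_all)
    have "c < G (F x)" "G (F x) < d"
      using Fx G(4,5) degree_one_less_iff[OF G(3), of c "F x"]
        degree_one_less_iff[OF G(3), of "F x" "F q"] by simp_all
    then have "G (F x) \<in> ?V" by (intro subsetD[OF sub]) simp
    then have "circle_of (G (F x)) \<notin> closure ?O" by simp
    moreover have "circle_of (G (F x)) = (g \<circ> f) z" using F(2) G(2) by (simp add: x liftsD)
    moreover have "g \<circ> f \<in> thompson_set"
      using F(1) G(1) by (simp add: thompson_set_def in_thompson_T_comp)
    moreover have "supp (g \<circ> f) \<subseteq> U"
      using supp_comp[of g f] F(6) G(6) ab(6) cd by force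
    ultimately show False using closure_subset[of ?O] by blast
  qed
  then have "circle_of ` {a<..<b} \<subseteq> interior (closure ?O)"
    by (intro interior_maximal open_circle_image) auto
  moreover have "circle_of ` {a<..<b} \<noteq> {}" using ab by auto
  ultimately show ?thesis by blast
qed

section \<open>The homeomorphism that induces an automorphism\<close>

lemma homeo_group_automorphism_supp_image:
  assumes "homeo_group_automorphism G \<phi>" "bij h" and conj: "\<And>g x. g \<in> G \<Longrightarrow> h (g x) = \<phi> g (h x)"
    and g: "g \<in> G"
  shows "h ` supp g = supp (\<phi> g)"
proof -
  have "h x \<in> supp (\<phi> g) \<longleftrightarrow> x \<in> supp g" for x
    using conj[OF g, of x] inj_eq[OF bij_is_inj[OF assms(2)], of "g x" x] by (simp add: supp_def)
  then show ?thesis using bij_is_surj[OF assms(2)] by (auto simp: image_iff) (metis surjD)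
qed

text \<open>
  Supports of elements of the group form a basis of the topology, and \<open>h\<close> permutes them.
\<close>

lemma homeo_group_automorphism_continuous:
  fixes G :: "('a::t2_space \<Rightarrow> 'a) set"
  assumes aut: "homeo_group_automorphism G \<phi>" and h: "bij h" and conj: "\<And>g x. g \<in> G \<Longrightarrow> h (g x) = \<phi> g (h x)"
  shows "continuous_on UNIV h"
  unfolding continuous_on_topological
proof (intro ballI allI impI)
  interpret homeo_group_automorphism G \<phi> by fact
  fix x B assume B: "open B" "h x \<in> B"
  then obtain f where f: "f \<in> G" "supp f \<subseteq> B" "f (h x) \<noteq> h x" using moving_point by metis
  obtain k where k: "k \<in> G" "f = \<phi> k" using auto_surj[OF f(1)] by blast
  have img: "h ` supp k = supp f" using homeo_group_automorphism_supp_image[OF aut h conj k(1)] k by simp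
  have "h x \<in> h ` supp k" using img f(3) by (simp add: supp_def)
  then have "x \<in> supp k" using bij_is_inj[OF h] by (auto dest: injD)
  then show "\<exists>A. open A \<and> x \<in> A \<and> (\<forall>y\<in>UNIV. y \<in> A \<longrightarrow> h y \<in> B)"
    using open_supp[OF k(1)] img f(2) by blast
qed

lemma bij_image_closure:
  fixes h :: "'a::t2_space \<Rightarrow> 'a"
  assumes "compact (UNIV :: 'a set)" "continuous_on UNIV h"
  shows "h ` closure A = closure (h ` A)"
proof
  show "h ` closure A \<subseteq> closure (h ` A)"
    by (rule continuous_image_closure_subset[OF assms(2)]) simp
  have "compact (closure A)" using compact_Int_closed[OF assms(1) closed_closure] by simp
  then have "closed (h ` closure A)"
    by (intro compact_imp_closed compact_continuous_image continuous_on_subset[OF assms(2)]) auto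
  then show "closure (h ` A) \<subseteq> h ` closure A"
    by (intro closure_minimal image_mono closure_subset)
qed

text \<open>
  For elements of \<open>T\<close> this is a set of dyadic points, and every dyadic point occurs. It is defined by closures and
  complements only, so homeomorphisms that normalise \<open>T\<close> respect it.
\<close>

definition boundary_of_supp :: "('a::topological_space \<Rightarrow> 'a) \<Rightarrow> 'a set" where
  "boundary_of_supp k = closure (supp k) \<inter> closure (- closure (supp k))"

lemma dyadic_is_boundary:
  assumes "x \<in> dyadic" shows "\<exists>k\<in>thompson_set. circle_of x \<in> boundary_of_supp k"
proof -
  obtain K where K: "pl_lift K" "\<And>x. 0 \<le> x \<Longrightarrow> x \<le> 1 / 8 \<Longrightarrow> K x = 2 * x"
    "\<And>x. 1 / 2 \<le> x \<Longrightarrow> x \<le> 1 \<Longrightarrow> K x = x" by (rule pl_doubling) blast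
  define F where "F y = K (y - x) + x" for y
  have F: "pl_lift F" unfolding F_def using K(1) assms by (rule pl_lift_conj_translation)
  then have d: "degree_one F" by (rule pl_lift_degree_one)
  then obtain f where f: "lifts F f" using degree_one_descends by blast
  have fT: "f \<in> thompson_set" using F f by (auto simp: thompson_set_def in_thompson_T_iff)
  have right: "circle_of ` {x<..<x + 1 / 8} \<subseteq> supp f"
  proof
    fix z assume "z \<in> circle_of ` {x<..<x + 1 / 8}"
    then obtain y where y: "z = circle_of y" "x < y" "y < x + 1 / 8" by auto
    have "F y = y + (y - x)" using K(2)[of "y - x"] y by (simp add: F_def)
    then have "circle_of (F y) \<noteq> circle_of y" using circle_of_inj_unit[of "F y" y] y by auto
    then show "z \<in> supp f" using y by (simp add: supp_def liftsD[OF f])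
  qed
  have "supp f \<subseteq> circle_of ` {x<..<x + 1 / 2}"
    by (rule supp_lift_subset[OF d f]) (use K(3) in \<open>auto simp: F_def\<close>)
  moreover have "circle_of ` {x - 1 / 2<..<x} \<inter> circle_of ` {x<..<x + 1 / 2} = {}"
  proof (rule ccontr)
    assume "circle_of ` {x - 1 / 2<..<x} \<inter> circle_of ` {x<..<x + 1 / 2} \<noteq> {}"
    then obtain s t where st: "x - 1 / 2 < s" "s < x" "x < t" "t < x + 1 / 2" "circle_of s = circle_of t"
      by force
    then have "s = t" by (intro circle_of_inj_unit) auto
    then show False using st by simp
  qed
  ultimately have "circle_of ` {x - 1 / 2<..<x} \<inter> closure (supp f) = {}"
    by (subst open_Int_closure_eq_empty) (auto intro: open_circle_image)
  then have left: "circle_of ` {x - 1 / 2<..<x} \<subseteq> - closure (supp f)" by blast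
  have cl: "circle_of ` closure A \<subseteq> closure (circle_of ` A)" for A
    by (rule continuous_image_closure_subset[OF continuous_circle_of]) simp
  have "circle_of x \<in> closure (circle_of ` {x<..<x + 1 / 8})"
    using cl[of "{x<..<x + 1 / 8}"] by (auto simp: image_subset_iff)
  then have "circle_of x \<in> closure (supp f)" using closure_mono[OF right] by blast
  moreover have "circle_of x \<in> closure (circle_of ` {x - 1 / 2<..<x})"
    using cl[of "{x - 1 / 2<..<x}"] by (auto simp: image_subset_iff)
  then have "circle_of x \<in> closure (- closure (supp f))" using closure_mono[OF left] by blast
  ultimately show ?thesis using fT by (auto simp: boundary_of_supp_def)
qed

lemma pl_lift_fixing:
  assumes k: "k \<in> thompson_set" and fixed: "k (circle_of x) = circle_of x"
  obtains K where "pl_lift K" "lifts K k" "K x = x"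
proof -
  obtain K0 where K0: "pl_lift K0" "lifts K0 k"
    using k by (auto simp: thompson_set_def in_thompson_T_iff)
  obtain n :: int where n: "K0 x = x + of_int n"
    using circle_of_eqD[of "K0 x" x] fixed by (auto simp: liftsD[OF K0(2)])
  have "pl_lift ((\<lambda>y. y + of_int (- n)) \<circ> K0)"
    using K0(1) by (intro pl_lift_comp pl_lift_translation dyadic_of_int)
  moreover have "lifts ((\<lambda>y. y + of_int (- n)) \<circ> K0) k"
    using K0(2) by (simp only: lifts_def comp_apply circle_of_add_int) simp
  ultimately show ?thesis using that n by simp
qed

text \<open>
  At a nondyadic fixed point an element of \<open>T\<close> is affine. With slope \<open>1\<close> it is the identity nearby; with any other slope it
  moves all other nearby points. In neither case is the point on the boundary of the support.
\<close>

lemma boundary_is_dyadic: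
  assumes k: "k \<in> thompson_set" and x: "circle_of x \<in> boundary_of_supp k"
  shows "x \<in> dyadic"
proof (rule ccontr)
  assume nd: "x \<notin> dyadic"
  interpret homeo_group thompson_set by (rule thompson_homeo_group)
  have "closure (- closure (supp k)) \<subseteq> closure (- supp k)"
    using closure_subset[of "supp k"] by (intro closure_mono) auto
  also have "\<dots> = - supp k" using open_supp[OF k] by (intro closure_closed) (simp add: closed_Compl)
  finally have "k (circle_of x) = circle_of x"
    using x by (auto simp: boundary_of_supp_def supp_def)
  then obtain K where K: "pl_lift K" "lifts K k" "K x = x" using pl_lift_fixing[OF k] by blast
  obtain j :: int where "affine_near K (2 powi j) x" using K(1) nd unfolding pl_lift_def by blast
  then obtain e where e: "e > 0" "\<And>y. dist y x < e \<Longrightarrow> K y = x + 2 powi j * (y - x)"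
    using K(3) by (auto simp: affine_near_def eventually_nhds_metric)
  have jpos: "(2::real) powi j > 0" by (simp add: zero_less_power_int)
  then have jpos1: "0 < 1 + (2::real) powi j" by linarith
  \<comment> \<open>On a ball of this radius the lift moves points by less than \<open>1\<close>,
    so a point moved by the lift is also moved on the circle.\<close>
  define r where "r = min e (1 / (1 + 2 powi j))"
  have r: "r > 0" "r \<le> e" "r * (1 + 2 powi j) \<le> 1"
  proof -
    show "r > 0" "r \<le> e" using e jpos by (auto simp: r_def add_pos_pos)
    have "r \<le> 1 / (1 + 2 powi j)" by (simp add: r_def)
    then show "r * (1 + 2 powi j) \<le> 1" using jpos by (simp add: field_simps)
  qed
  let ?V = "circle_of ` ball x r"
  have V: "open ?V" "circle_of x \<in> ?V" using r by (auto intro: open_circle_image)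
  show False
  proof (cases "(2::real) powi j = 1")
    case True
    have "K y = y" if "y \<in> ball x r" for y
      using e(2)[of y] that r True by (simp add: dist_commute)
    then have "?V \<inter> supp k = {}" by (auto simp: supp_def liftsD[OF K(2)])
    then have "?V \<inter> closure (supp k) = {}" using V(1) by (simp add: open_Int_closure_eq_empty)
    then show False using x V by (auto simp: boundary_of_supp_def)
  next
    case False
    have "?V \<subseteq> closure (supp k)"
    proof
      fix z assume "z \<in> ?V"
      then obtain y where y: "z = circle_of y" "dist x y < r" by auto
      show "z \<in> closure (supp k)"
      proof (cases "y = x")
        case True then show ?thesis using x y by (simp add: boundary_of_supp_def)
      next
        case ne: False
        have Kd: "K y - y = (2 powi j - 1) * (y - x)"
          using e(2)[of y] y r by (simp add: dist_commute algebra_simps)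
        moreover have "\<bar>K y - y\<bar> < 1"
        proof -
          have "\<bar>(2 powi j - 1) * (y - x)\<bar> = \<bar>2 powi j - 1\<bar> * \<bar>y - x\<bar>" by (rule abs_mult)
          also have "\<dots> \<le> (1 + 2 powi j) * \<bar>y - x\<bar>"
            using jpos by (intro mult_right_mono) (simp_all add: abs_le_iff)
          also have "\<dots> < (1 + 2 powi j) * r"
            using y by (intro mult_strict_left_mono jpos1) (auto simp: dist_real_def abs_minus_commute)
          also have "\<dots> \<le> 1" using r by (simp add: mult.commute)
          finally show ?thesis unfolding Kd .
        qed
        ultimately have "circle_of (K y) \<noteq> circle_of y"
          using circle_of_inj_unit[of "K y" y] ne False by auto
        then have "z \<in> supp k" using y by (simp add: supp_def liftsD[OF K(2)])
        then show ?thesis using closure_subset by blast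
      qed
    qed
    then have "?V \<inter> - closure (supp k) = {}" by blast
    then have "?V \<inter> closure (- closure (supp k)) = {}"
      using V(1) by (simp add: open_Int_closure_eq_empty)
    then show False using x V by (auto simp: boundary_of_supp_def)
  qed
qed

lemma thompson_spatial:
  assumes "homeo_group_automorphism thompson_set \<phi>"
  obtains h where "bij h" "continuous_on UNIV h"
    "\<And>g. g \<in> thompson_set \<Longrightarrow> h \<circ> g = \<phi> g \<circ> h"
    "h ` (circle_of ` dyadic) \<subseteq> circle_of ` dyadic"
proof -
  interpret homeo_group_automorphism thompson_set \<phi> by fact
  obtain h where h: "bij h" "\<And>g x. g \<in> thompson_set \<Longrightarrow> h (g x) = \<phi> g (h x)"
    using spatial_automorphism[OF assms compact_circle thompson_locally_dense] by blast
  have cont: "continuous_on UNIV h"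
    using homeo_group_automorphism_continuous[OF assms h] .
  have "h (circle_of x) \<in> circle_of ` dyadic" if x: "x \<in> dyadic" for x
  proof -
    obtain k where k: "k \<in> thompson_set" "circle_of x \<in> boundary_of_supp k"
      using dyadic_is_boundary[OF x] by blast
    have cl: "h ` closure A = closure (h ` A)" for A
      using bij_image_closure[OF compact_circle cont] .
    have "h ` boundary_of_supp k = boundary_of_supp (\<phi> k)"
      unfolding boundary_of_supp_def
      using h(1) by (simp add: image_Int bij_is_inj bij_image_Compl_eq cl
          homeo_group_automorphism_supp_image[OF assms h k(1)])
    then have "h (circle_of x) \<in> boundary_of_supp (\<phi> k)" using k(2) by blast
    moreover obtain y where "h (circle_of x) = circle_of y" by (rule circle_cases)
    ultimately show ?thesis using boundary_is_dyadic[OF auto_mem[OF k(1)]] by auto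
  qed
  moreover have "h \<circ> g = \<phi> g \<circ> h" if "g \<in> thompson_set" for g using h(2)[OF that] by auto
  ultimately show ?thesis using that[OF h(1) cont] by blast
qed

text \<open>
  Cutting the circle at the fixed base point turns \<open>h\<close> into a continuous injection of the open unit interval, which must be
  monotone. In the decreasing case the function \<open>1 - h0\<close> is extended, and the sign reappears in the lift.
\<close>

lemma circle_homeo_lift:
  assumes h: "bij h" "continuous_on UNIV h" "h (circle_of 0) = circle_of 0"
  obtains H where "degree_one H" "H 0 = 0" "lifts H h"
  | H where "degree_one H" "H 0 = 0" "lifts (\<lambda>x. - H x) h"
proof -
  define h0 where "h0 t = (SOME s. s \<in> {0..<1} \<and> circle_of s = h (circle_of t))" for t :: real
  have h0: "h0 t \<in> {0..<1}" "circle_of (h0 t) = h (circle_of t)" for t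
  proof -
    have "\<exists>s. s \<in> {0..<1} \<and> circle_of s = h (circle_of t)"
      by (rule circle_cases[of "h (circle_of t)"]) auto
    then show "h0 t \<in> {0..<1}" "circle_of (h0 t) = h (circle_of t)"
      unfolding h0_def by (metis (mono_tags, lifting) someI_ex)+
  qed
  have inj: "s = t" if "h0 s = h0 t" "\<bar>s - t\<bar> < 1" for s t
  proof -
    have "h (circle_of s) = h (circle_of t)" using h0(2) that(1) by metis
    then have "circle_of s = circle_of t" using h(1) by (auto dest: bij_is_inj injD)
    then show ?thesis using that(2) by (rule circle_of_inj_unit)
  qed
  have h00: "h0 0 = 0" using h0[of 0] h(3) circle_of_inj_unit[of "h0 0" 0] by simp
  have h0_int: "h0 t \<in> {0<..<1}" if "t \<in> {0<..<1}" for t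
    using h0(1)[of t] inj[of t 0] h00 that by force
  have surj: "\<exists>t\<in>{0..<1}. h0 t = s" if "s \<in> {0..<1}" for s
  proof -
    obtain z where z: "h z = circle_of s" using bij_is_surj[OF h(1)] by (metis surjD)
    obtain t where t: "z = circle_of t" "0 \<le> t" "t < 1" by (rule circle_cases)
    have "circle_of (h0 t) = circle_of s" using h0(2) z t by simp
    then have "h0 t = s" by (rule circle_of_inj_unit) (use h0(1)[of t] that in auto)
    then show ?thesis using t by auto
  qed
  have "continuous_on {0<..<1} h0"
    unfolding continuous_on_open_vimage[OF open_greaterThanLessThan]
  proof (intro allI impI)
    fix B :: "real set" assume "open B"
    have eq: "h0 -` B \<inter> {0<..<1} = (h \<circ> circle_of) -` (circle_of ` (B \<inter> {0<..<1})) \<inter> {0<..<1}"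
    proof (intro subset_antisym subsetI)
      fix t assume "t \<in> h0 -` B \<inter> {0<..<1}"
      then show "t \<in> (h \<circ> circle_of) -` (circle_of ` (B \<inter> {0<..<1})) \<inter> {0<..<1}"
        using h0(2)[of t, symmetric] h0_int[of t] by auto
    next
      fix t assume t: "t \<in> (h \<circ> circle_of) -` (circle_of ` (B \<inter> {0<..<1})) \<inter> {0<..<1}"
      then obtain s where s: "s \<in> B" "s \<in> {0<..<1}" "circle_of (h0 t) = circle_of s"
        using h0(2)[of t] by auto
      then have "h0 t = s" by (intro circle_of_inj_unit) (use h0(1)[of t] in auto)
      then show "t \<in> h0 -` B \<inter> {0<..<1}" using s t by simp
    qed
    have "continuous_on UNIV (h \<circ> circle_of)"
      by (rule continuous_on_compose[OF continuous_circle_of]) (rule continuous_on_subset[OF h(2)], simp)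
    then have "open ((h \<circ> circle_of) -` (circle_of ` (B \<inter> {0<..<1})))"
      using \<open>open B\<close> by (intro open_vimage open_circle_image open_Int) auto
    then show "open (h0 -` B \<inter> {0<..<1})" unfolding eq by (intro open_Int) auto
  qed
  moreover have "inj_on h0 {0<..<1}" using inj by (auto simp: inj_on_def)
  moreover have "is_interval {0<..<1::real}" by simp
  ultimately consider "strict_mono_on {0<..<1} h0" | "strict_antimono_on {0<..<1} h0"
    using injective_eq_monotone_map by metis
  then show thesis
  proof cases
    case 1
    define H where "H x = h0 (frac x) + of_int \<lfloor>x\<rfloor>" for x
    have "strict_mono_on {0..<1} h0"
    proof (rule strict_mono_onI)
      fix s t :: real assume st: "s \<in> {0..<1}" "t \<in> {0..<1}" "s < t"
      show "h0 s < h0 t"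
      proof (cases "s = 0")
        case True then show ?thesis using h0_int[of t] h00 st by auto
      qed (use 1 st in \<open>auto simp: strict_mono_on_def\<close>)
    qed
    moreover have "h0 ` {0..<1} = {0..<1}" using h0(1) surj by (auto simp: image_iff) metis
    ultimately have "degree_one H" unfolding H_def by (rule degree_one_extension)
    moreover have "H 0 = 0" using h00 by (simp add: H_def)
    moreover have "lifts H h" by (simp add: lifts_def H_def h0(2) circle_of_frac)
    ultimately show thesis by (rule that(1))
  next
    case 2
    define g0 where "g0 t = (if t = 0 then 0 else 1 - h0 t)" for t
    define H where "H x = g0 (frac x) + of_int \<lfloor>x\<rfloor>" for x
    have g0_int: "g0 t \<in> {0<..<1}" if "t \<in> {0<..<1}" for t
      using h0_int[OF that] that by (auto simp: g0_def)
    have "strict_mono_on {0..<1} g0"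
    proof (rule strict_mono_onI)
      fix s t :: real assume st: "s \<in> {0..<1}" "t \<in> {0..<1}" "s < t"
      show "g0 s < g0 t"
      proof (cases "s = 0")
        case True then show ?thesis using g0_int[of t] st by (auto simp: g0_def)
      next
        case False
        then have "h0 t < h0 s" using 2 st by (auto simp: monotone_on_def)
        then show ?thesis using False st by (simp add: g0_def)
      qed
    qed
    moreover have "g0 ` {0..<1} = {0..<1}"
    proof (intro subset_antisym subsetI)
      fix s assume "s \<in> g0 ` {0..<1}"
      then obtain t where t: "s = g0 t" "0 \<le> t" "t < 1" by auto
      show "s \<in> {0..<1}" using g0_int[of t] t by (cases "t = 0") (auto simp: g0_def)
    next
      fix s :: real assume s: "s \<in> {0..<1}"
      show "s \<in> g0 ` {0..<1}"
      proof (cases "s = 0")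
        case True then show ?thesis by (auto simp: g0_def intro!: image_eqI[of _ _ 0])
      next
        case False
        then obtain t where t: "t \<in> {0..<1}" "h0 t = 1 - s" using surj[of "1 - s"] s by auto
        then have "t \<noteq> 0" using h00 s by auto
        then have "g0 t = s" using t by (simp add: g0_def)
        then show ?thesis using t by auto
      qed
    qed
    ultimately have "degree_one H" unfolding H_def by (rule degree_one_extension)
    moreover have "H 0 = 0" by (simp add: H_def g0_def)
    moreover have "lifts (\<lambda>x. - H x) h" unfolding lifts_def
    proof
      fix x
      have "circle_of (- g0 (frac x)) = h (circle_of (frac x))"
      proof (cases "frac x = 0")
        case True show ?thesis unfolding True using h(3) by (simp add: g0_def)
      next
        case False
        then show ?thesis
          using h0(2)[of "frac x"] circle_of_add_int[of "h0 (frac x)" "-1"] by (simp add: g0_def)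
      qed
      moreover have "- H x = - g0 (frac x) + of_int (- \<lfloor>x\<rfloor>)" by (simp add: H_def)
      ultimately show "circle_of (- H x) = h (circle_of x)"
        by (simp only: circle_of_add_int circle_of_frac)
    qed
    ultimately show thesis by (rule that(2))
  qed
qed

section \<open>Orientation preserving case: rotation numbers\<close>

text \<open>
  For \<open>n > 0\<close>, this is the presence of a periodic orbit of \<open>n\<close> points along which \<open>f\<close> advances by one step in the cyclic order,
  that is, rotation number \<open>1 / n\<close> modulo \<open>1\<close>.
\<close>

definition rotates_once :: "nat \<Rightarrow> (circle \<Rightarrow> circle) \<Rightarrow> bool" where
  "rotates_once n f \<longleftrightarrow> (\<exists>F x. degree_one F \<and> lifts F f \<and> (F ^^ n) x = x + 1)"

lemma rotates_once_conj:
  assumes "rotates_once n f" and G: "degree_one G" "lifts G g" and eq: "f \<circ> g = g \<circ> f'"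
  shows "rotates_once n f'"
proof -
  obtain F x where F: "degree_one F" "lifts F f" "(F ^^ n) x = x + 1"
    using assms(1) by (auto simp: rotates_once_def)
  define F' where "F' = fun_inv G \<circ> F \<circ> G"
  have d: "degree_one F'" unfolding F'_def using F G by (intro degree_one_comp degree_one_inv)
  have "lifts F' (fun_inv g \<circ> f \<circ> g)" unfolding F'_def using F G lifts_inv by (intro lifts_comp) auto
  moreover have "fun_inv g \<circ> f \<circ> g = f'"
    using lifts_inv(1)[OF G] unfolding comp_assoc eq by (simp add: bij_is_inj flip: comp_assoc)
  ultimately have "lifts F' f'" by simp
  moreover have "(F' ^^ n) (fun_inv G y) = fun_inv G ((F ^^ n) y)" for y
    by (induction n) (simp_all add: F'_def degree_one_inv_apply[OF G(1)])
  then have "(F' ^^ n) (fun_inv G x) = fun_inv G x + 1"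
    using F(3) degree_oneD(3)[OF degree_one_inv[OF G(1)]] by simp
  ultimately show ?thesis using d by (auto simp: rotates_once_def)
qed

lemma degree_one_iterate_shift:
  assumes F: "degree_one F" and "(F ^^ n) x = x + of_int a"
  shows "(F ^^ (n * m)) x = x + of_int (a * int m)"
proof (induction m)
  case (Suc m)
  have "(F ^^ (n * Suc m)) x = (F ^^ n) ((F ^^ (n * m)) x)" by (simp add: funpow_add)
  also have "\<dots> = (F ^^ n) x + of_int (a * int m)"
    unfolding Suc by (rule degree_one_add_int) (rule degree_one_funpow[OF F])
  finally show ?case using assms(2) by (simp add: algebra_simps)
qed simp

text \<open>
  After a shift by an integer, \<open>y\<close> lies in \<open>{x..<x + 1}\<close>, and then the values of \<open>Q\<close> differ by less than \<open>1\<close> as well.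
\<close>

lemma translation_numbers_agree:
  assumes Q: "degree_one Q" and x: "Q x = x + of_int a" and y: "Q y = y + of_int b"
  shows "a = b"
proof -
  define t where "t = y - of_int \<lfloor>y - x\<rfloor>"
  have t: "x \<le> t" "t < x + 1" unfolding t_def by linarith+
  have "Q t = t + of_int b" using degree_one_add_int[OF Q, of y "- \<lfloor>y - x\<rfloor>"] y by (simp add: t_def)
  moreover have "Q x \<le> Q t" "Q t < Q x + 1"
    using t degree_one_le_iff[OF Q, of x t] degree_one_less_iff[OF Q, of t "x + 1"]
      degree_oneD(3)[OF Q, of x] by simp_all
  ultimately show ?thesis using x t by linarith
qed

text \<open>
  The two conditions may refer to lifts that differ by an integer \<open>j\<close>. Comparing how far the \<open>n m\<close>-th iterate of one
  lift moves the two points gives \<open>m = (1 - j m) n\<close>.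
\<close>

lemma rotates_once_dvd:
  assumes "rotates_once n f" "rotates_once m f" shows "n dvd m"
proof -
  obtain F x where F: "degree_one F" "lifts F f" "(F ^^ n) x = x + 1"
    using assms(1) by (auto simp: rotates_once_def)
  obtain G y where G: "degree_one G" "lifts G f" "(G ^^ m) y = y + 1"
    using assms(2) by (auto simp: rotates_once_def)
  obtain j :: int where j: "\<And>z. G z = F z + of_int j"
    using degree_one_int_shift[OF F(1) G(1) F(2) G(2)] by blast
  have "(G ^^ i) z = (F ^^ i) z + of_int (j * int i)" for i z
  proof (induction i)
    case (Suc i)
    then show ?case by (simp add: j degree_one_add_int[OF F(1)] algebra_simps del: of_int_mult)
  qed simp
  then have "(F ^^ m) y = y + of_int (1 - j * int m)" using G(3) by (simp add: algebra_simps)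
  from degree_one_iterate_shift[OF F(1) this, of n]
  have "(F ^^ (m * n)) y = y + of_int ((1 - j * int m) * int n)" .
  moreover have "(F ^^ (n * m)) x = x + of_int (1 * int m)"
    using degree_one_iterate_shift[OF F(1), of n x 1 m] F(3) by simp
  ultimately have "1 * int m = (1 - j * int m) * int n"
    using translation_numbers_agree[OF degree_one_funpow[OF F(1)], of "n * m"] by (metis mult.commute)
  then have "int n dvd int m" by (metis dvd_triv_right mult_1)
  then show ?thesis by simp
qed

text \<open>
  The points are put in place one at a time: a bump supported to the right of \<open>p j\<close> corrects the next point and
  leaves the previous ones alone.
\<close>

lemma pl_lift_interpolate:
  fixes p q :: "nat \<Rightarrow> real"
  assumes mono: "strict_mono_on {..n} p" "strict_mono_on {..n} q"
    and ends: "p 0 = 0" "q 0 = 0" "p n = 1" "q n = 1"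
    and D: "\<And>i. i \<le> n \<Longrightarrow> p i \<in> dyadic" "\<And>i. i \<le> n \<Longrightarrow> q i \<in> dyadic"
  obtains W where "pl_lift W" "\<And>i. i \<le> n \<Longrightarrow> W (q i) = p i"
proof -
  have "j \<le> n \<Longrightarrow> \<exists>W. pl_lift W \<and> (\<forall>i\<le>j. W (q i) = p i)" for j
  proof (induction j)
    case 0
    show ?case using ends pl_lift_translation[of 0] by (intro exI[of _ "\<lambda>x. x"]) simp
  next
    case (Suc j)
    then obtain W where W: "pl_lift W" "\<And>i. i \<le> j \<Longrightarrow> W (q i) = p i" by auto
    have d: "degree_one W" using W(1) by (rule pl_lift_degree_one)
    have W0: "W 0 = 0" using W(2)[of 0] ends by simp
    have W1: "W 1 = 1" using degree_oneD(3)[OF d, of 0] W0 by simp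
    show ?case
    proof (cases "Suc j = n")
      case True
      then have "\<forall>i\<le>Suc j. W (q i) = p i" using W W1 ends le_Suc_eq by metis
      then show ?thesis using W(1) by blast
    next
      case False
      then have lt: "Suc j < n" using Suc.prems by simp
      have p: "0 \<le> p j" "p j < p (Suc j)" "p (Suc j) < 1"
        using strict_mono_onD[OF mono(1), of j "Suc j"] strict_mono_onD[OF mono(1), of "Suc j" n]
          strict_mono_onD[OF mono(1), of 0 j] lt ends by (cases "j = 0"; auto)+
      have "q j < q (Suc j)" "q (Suc j) < 1"
        using strict_mono_onD[OF mono(2), of j "Suc j"] strict_mono_onD[OF mono(2), of "Suc j" n] lt ends
        by auto
      then have Wq: "p j < W (q (Suc j))" "W (q (Suc j)) < 1"
        using degree_one_less_iff[OF d, of "q j" "q (Suc j)"] degree_one_less_iff[OF d, of "q (Suc j)" 1]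
          W(2)[of j] W1 by auto
      have "W (q (Suc j)) \<in> dyadic" using W(1) D(2)[of "Suc j"] lt by (simp add: pl_lift_def)
      then obtain V where V: "pl_lift V" "V (W (q (Suc j))) = p (Suc j)"
        "\<And>x. 1 \<le> x \<Longrightarrow> x \<le> p j + 1 \<Longrightarrow> V x = x"
        by (rule pl_bump[of "p j" "W (q (Suc j))" 1 "p (Suc j)", rotated 7])
          (use Wq p D(1) lt in simp_all)
      have "V (W (q i)) = p i" if "i \<le> j" for i
      proof -
        have "0 \<le> p i" "p i \<le> p j"
          using strict_mono_on_leD[OF mono(1), of 0 i] strict_mono_on_leD[OF mono(1), of i j] that lt ends
          by auto
        then have "V (p i + 1) = p i + 1" by (intro V(3)) auto
        then show ?thesis
          using W(2)[OF that] degree_oneD(3)[OF pl_lift_degree_one[OF V(1)], of "p i"] by simp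
      qed
      then have "\<forall>i\<le>Suc j. (V \<circ> W) (q i) = p i" using V(2) by (auto simp: le_Suc_eq)
      then show ?thesis using pl_lift_comp[OF V(1) W(1)] by blast
    qed
  qed
  then show ?thesis using that by blast
qed

lemma thompson_rotates_once:
  assumes H: "degree_one H" "lifts H h" "H 0 = 0" and D: "h ` (circle_of ` dyadic) \<subseteq> circle_of ` dyadic"
  obtains y where "y \<in> thompson_set" "rotates_once (2 ^ k) (y \<circ> h)"
proof -
  define n :: nat where "n = 2 ^ k"
  have n: "n > 0" by (simp add: n_def)
  have frac_D: "real i / real n \<in> dyadic" for i
    using dyadicI[of "int i" k] by (simp add: n_def)
  have HD: "H x \<in> dyadic" if "x \<in> dyadic" for x
  proof -
    have "h (circle_of x) \<in> circle_of ` dyadic" using D that by blast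
    then show ?thesis by (simp add: liftsD[OF H(2)] circle_of_dyadic_iff)
  qed
  have H1: "H 1 = 1" using degree_oneD(3)[OF H(1), of 0] H(3) by simp
  obtain W where W: "pl_lift W" "\<And>i. i \<le> n \<Longrightarrow> W (H (real i / real n)) = real i / real n"
    by (rule pl_lift_interpolate[of n "\<lambda>i. real i / real n" "\<lambda>i. H (real i / real n)"])
      (use n H H1 in \<open>auto simp: frac_D HD strict_mono_on_def degree_one_less_iff divide_strict_right_mono\<close>)
  \<comment> \<open>\<open>W\<close> brings the images of the points \<open>i / n\<close> back to \<open>i / n\<close>, and the rotation by \<open>1 / n\<close> then
    makes them a single orbit.\<close>
  define Y where "Y = (\<lambda>x. x + 1 / real n) \<circ> W"
  have Y: "pl_lift Y" unfolding Y_def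
    using W(1) frac_D[of 1] by (intro pl_lift_comp pl_lift_translation) simp_all
  obtain y where y: "lifts Y y" using degree_one_descends[OF pl_lift_degree_one[OF Y]] by blast
  have "((Y \<circ> H) ^^ i) 0 = real i / real n" if "i \<le> n" for i
    using that
  proof (induction i)
    case (Suc i)
    then show ?case using W(2)[of i] by (simp add: Y_def add_divide_distrib)
  qed simp
  then have "((Y \<circ> H) ^^ n) 0 = 0 + 1" using n by simp
  then have "rotates_once n (y \<circ> h)"
    unfolding rotates_once_def
    using degree_one_comp[OF pl_lift_degree_one[OF Y] H(1)] lifts_comp[OF y H(2)] by blast
  moreover have "y \<in> thompson_set" using Y y by (auto simp: thompson_set_def in_thompson_T_iff)
  ultimately show ?thesis using that by (simp add: n_def)
qed

section \<open>Orientation reversing case: germs at a fixed point\<close>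

lemma degree_one_at_right_0:
  assumes "degree_one F" "F 0 = 0" shows "filterlim F (at_right 0) (at_right 0)"
proof -
  have "continuous_on UNIV F" using assms(1) by (rule degree_one_continuous)
  then have "isCont F 0" by (simp add: continuous_on_eq_continuous_at)
  then have "(F \<longlongrightarrow> F 0) (at 0)" by (simp add: isCont_def)
  then have "(F \<longlongrightarrow> 0) (at_right 0)"
    using assms(2) by (simp add: filterlim_at_split)
  moreover have "\<forall>\<^sub>F x in at_right 0. F x \<in> {0<..} \<and> F x \<noteq> 0"
  proof (rule eventually_mono[OF eventually_at_right_less])
    fix x :: real assume "0 < x"
    then have "F 0 < F x" by (simp add: degree_one_less_iff[OF assms(1)])
    then show "F x \<in> {0<..} \<and> F x \<noteq> 0" using assms(2) by simp
  qed
  ultimately show ?thesis by (simp add: filterlim_at)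
qed

text \<open>
  Slope and intercept are locally constant on the interval, hence constant.
\<close>

lemma affine_on_interval:
  fixes F :: "real \<Rightarrow> real"
  assumes "\<And>x. x \<in> {s<..<t} \<Longrightarrow> \<exists>k::int. affine_near F (2 powi k) x" and "s < t"
  obtains k :: int and b where "\<And>x. x \<in> {s<..<t} \<Longrightarrow> F x = 2 powi k * x + b"
proof -
  define P where "P x p \<longleftrightarrow> (\<forall>\<^sub>F y in nhds x. F y = 2 powi (fst p) * y + snd p)" for x and p :: "int \<times> real"
  have ex: "\<exists>p. P x p" if "x \<in> {s<..<t}" for x
    using assms(1)[OF that] by (auto simp: P_def affine_near_iff)
  have uniq: "p = q" if "P x p" "P x q" for x p q
  proof -
    have "affine_near F (2 powi fst p) x" "affine_near F (2 powi fst q) x"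
      using that unfolding affine_near_iff P_def by blast+
    then have eq: "(2::real) powi fst p = 2 powi fst q" by (rule affine_near_unique)
    have "fst p = fst q"
    proof (rule ccontr)
      assume "fst p \<noteq> fst q"
      then consider "fst p < fst q" | "fst q < fst p" by linarith
      then show False
        using power_int_strict_increasing[of "fst p" "fst q" "2::real"]
          power_int_strict_increasing[of "fst q" "fst p" "2::real"] eq by cases auto
    qed
    moreover have "F x = 2 powi fst p * x + snd p" "F x = 2 powi fst q * x + snd q"
      using that unfolding P_def by (auto dest: eventually_nhds_x_imp_x)
    ultimately show ?thesis by (simp add: prod_eq_iff)
  qed
  define c where "c x = (SOME p. P x p)" for x
  have c: "P x (c x)" if "x \<in> {s<..<t}" for x using someI_ex[OF ex[OF that]] by (simp add: c_def)
  have loc: "\<forall>\<^sub>F y in at x within {s<..<t}. c x = c y" if x: "x \<in> {s<..<t}" for x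
  proof -
    have "\<forall>\<^sub>F y in nhds x. P y (c x)" using c[OF x] unfolding P_def by (simp add: eventually_eventually)
    moreover have "\<forall>\<^sub>F y in nhds x. y \<in> {s<..<t}" using x by (intro eventually_nhds_in_open) auto
    ultimately have "\<forall>\<^sub>F y in nhds x. c x = c y" by eventually_elim (use uniq c in blast)
    then show ?thesis by (rule filter_leD[OF at_within_le_nhds])
  qed
  define m where "m = (s + t) / 2"
  have m: "m \<in> {s<..<t}" using assms(2) by (simp add: m_def)
  have const: "c x = c m" if "x \<in> {s<..<t}" for x
    by (rule connected_local_const[OF _ that m]) (use loc in auto)
  have "F x = 2 powi fst (c m) * x + snd (c m)" if "x \<in> {s<..<t}" for x
    using c[OF that] unfolding const[OF that] P_def by (rule eventually_nhds_x_imp_x)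
  then show ?thesis using that by blast
qed

lemma pl_lift_germ:
  assumes F: "pl_lift F" "F 0 = 0"
  obtains k :: int where "\<forall>\<^sub>F x in at_right 0. F x = 2 powi k * x"
proof -
  obtain S where S: "finite (circle_of ` S)" "\<And>x. x \<notin> S \<Longrightarrow> \<exists>k::int. affine_near F (2 powi k) x"
    using F(1) by (auto simp: pl_lift_def)
  let ?S = "S \<inter> {0<..<1}"
  have "inj_on circle_of ?S"
  proof (rule inj_onI)
    fix x y assume "x \<in> ?S" "y \<in> ?S" "circle_of x = circle_of y"
    then show "x = y" by (intro circle_of_inj_unit) auto
  qed
  moreover have "finite (circle_of ` ?S)" using S(1) by (rule finite_subset[rotated]) auto
  ultimately have fin: "finite (insert 1 ?S)" using finite_imageD by blast
  define e where "e = Min (insert 1 ?S)"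
  have e: "e > 0" "e \<le> 1" using fin by (auto simp: e_def)
  have "x \<notin> S" if "x \<in> {0<..<e}" for x
    using that Min_le[OF fin, of x] e by (auto simp: e_def)
  then obtain k :: int and b where kb: "\<And>x. x \<in> {0<..<e} \<Longrightarrow> F x = 2 powi k * x + b"
    using affine_on_interval[of 0 e F] S(2) e by blast
  have ev: "\<forall>\<^sub>F x in at_right 0. F x = 2 powi k * x + b"
    using eventually_at_right_real[OF e(1)] by eventually_elim (rule kb)
  have "filterlim F (at_right 0) (at_right 0)"
    using degree_one_at_right_0 pl_lift_degree_one F by blast
  then have "(F \<longlongrightarrow> 0) (at_right 0)" by (simp add: filterlim_at)
  then have "((\<lambda>x. 2 powi k * x + b) \<longlongrightarrow> 0) (at_right 0)"
    using ev by (rule Lim_transform_eventually)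
  moreover have "((\<lambda>x. 2 powi k * x + b) \<longlongrightarrow> 2 powi k * 0 + b) (at_right 0)"
    by (intro tendsto_intros)
  ultimately have "0 = 2 powi k * 0 + b" by (intro tendsto_unique[OF trivial_limit_at_right_real])
  then show ?thesis using ev that by simp
qed

lemma two_le_powi: "1 < (2::real) powi d \<Longrightarrow> 2 \<le> (2::real) powi d"
proof -
  assume a: "1 < (2::real) powi d"
  have "\<not> d \<le> 0"
  proof
    assume "d \<le> 0"
    then have "(2::real) powi d \<le> 2 powi 0" by (intro power_int_increasing) auto
    then show False using a by simp
  qed
  then have "(2::real) powi 1 \<le> 2 powi d" by (intro power_int_increasing) auto
  then show ?thesis by simp
qed

text \<open>
  Conjugation by \<open>A\<close> in either direction turns the germ of doubling into multiplication by a power of \<open>2\<close>, say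
  \<open>A (2\<^sup>d x) = 2 A x\<close> and \<open>A (2 x) = 2 ^ d' A x\<close> near \<open>0\<close>. Both powers exceed \<open>1\<close> because \<open>A\<close> preserves the order, so both are
  at least \<open>2\<close>, and monotonicity gives \<open>A (2 x) \<le> A (2\<^sup>d x) = 2 A x \<le> A (2 x)\<close>.
\<close>

lemma normalizing_germ_commutes_with_doubling:
  assumes A: "degree_one A" "A 0 = 0"
    and K: "pl_lift K" "\<forall>\<^sub>F x in at_right 0. K x = 2 * x"
    and K': "pl_lift K'" "K' 0 = 0" "A \<circ> K' = K \<circ> A"
    and K'': "pl_lift K''" "K'' 0 = 0" "K'' \<circ> A = A \<circ> K"
  shows "\<forall>\<^sub>F x in at_right 0. A (2 * x) = 2 * A x"
proof -
  have lim: "filterlim A (at_right 0) (at_right 0)" using A by (rule degree_one_at_right_0)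
  obtain d where d: "\<forall>\<^sub>F x in at_right 0. K' x = 2 powi d * x" using pl_lift_germ[OF K'(1,2)] by blast
  obtain d' where d': "\<forall>\<^sub>F x in at_right 0. K'' x = 2 powi d' * x" using pl_lift_germ[OF K''(1,2)] by blast
  have "\<forall>\<^sub>F x in at_right 0. K (A x) = 2 * A x" by (rule eventually_compose_filterlim[OF K(2) lim])
  then have e1: "\<forall>\<^sub>F x in at_right 0. A (2 powi d * x) = 2 * A x"
    using d by eventually_elim (use K'(3) in \<open>metis comp_apply\<close>)
  have "\<forall>\<^sub>F x in at_right 0. K'' (A x) = 2 powi d' * A x"
    by (rule eventually_compose_filterlim[OF d' lim])
  then have e2: "\<forall>\<^sub>F x in at_right 0. A (2 * x) = 2 powi d' * A x"
    using K(2) by eventually_elim (use K''(3) in \<open>metis comp_apply\<close>)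
  show ?thesis
    using e1 e2 eventually_at_right_less[of 0]
  proof eventually_elim
    case (elim x)
    have Ax: "A x > 0" using degree_one_less_iff[OF A(1), of 0 x] A(2) elim by simp
    then have "A x < A (2 powi d * x)" "A x < A (2 * x)"
      using elim degree_one_less_iff[OF A(1), of x "2 * x"] by simp_all
    then have "x < 2 powi d * x" "A x < 2 powi d' * A x"
      using degree_one_less_iff[OF A(1)] elim(2) by simp_all
    then have "2 \<le> (2::real) powi d" "2 \<le> (2::real) powi d'"
      using elim Ax by (auto intro: two_le_powi)
    then have "2 * x \<le> 2 powi d * x" "2 * A x \<le> 2 powi d' * A x"
      using elim Ax by (auto intro: mult_right_mono)
    then have "A (2 * x) \<le> 2 * A x" "2 * A x \<le> A (2 * x)"
      using degree_one_le_iff[OF A(1)] elim by metis+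
    then show ?case by simp
  qed
qed

lemma germ_commutes_with_powi:
  assumes "\<forall>\<^sub>F x in at_right 0. A (2 * x) = 2 * (A x :: real)"
  shows "\<forall>\<^sub>F x in at_right (0::real). A (2 powi j * x) = 2 powi j * A x"
proof -
  have scale: "filterlim (\<lambda>x. c * x) (at_right 0) (at_right (0::real))" if "c > 0" for c
  proof -
    have "((\<lambda>x. c * x) \<longlongrightarrow> c * 0) (at_right 0)" by (intro tendsto_intros)
    moreover have "\<forall>\<^sub>F x in at_right 0. c * x \<in> {0<..} \<and> c * x \<noteq> 0"
      using eventually_at_right_less[of 0] by eventually_elim (use that in auto)
    ultimately show ?thesis by (simp add: filterlim_at)
  qed
  have nat: "\<forall>\<^sub>F x in at_right 0. A (2 ^ n * x) = 2 ^ n * A x" for n :: nat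
  proof (induction n)
    case (Suc n)
    have "\<forall>\<^sub>F x in at_right 0. A (2 * (2 ^ n * x)) = 2 * A (2 ^ n * x)"
      by (rule eventually_compose_filterlim[OF assms scale]) simp
    then show ?case using Suc by eventually_elim (simp add: mult.assoc)
  qed simp
  show ?thesis
  proof (cases "j \<ge> 0")
    case True
    then show ?thesis using nat[of "nat j"] by (simp add: power_int_def)
  next
    case False
    define n where "n = nat (- j)"
    have j: "2 powi j * x = inverse (2 ^ n) * x" for x :: real
      using False by (simp add: n_def power_int_def inverse_eq_divide power_one_over)
    have "\<forall>\<^sub>F x in at_right 0. A (2 ^ n * (inverse (2 ^ n) * x)) = 2 ^ n * A (inverse (2 ^ n) * x)"
      by (rule eventually_compose_filterlim[OF nat scale]) simp
    then show ?thesis unfolding j by eventually_elim (simp add: field_simps)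
  qed
qed

lemma degree_one_neg_conj:
  assumes "degree_one H" "degree_one R" shows "degree_one (\<lambda>x. - H (R (- H x)))"
  unfolding degree_one_def
proof (intro conjI allI)
  show "strict_mono (\<lambda>x. - H (R (- H x)))"
    using assms by (intro strict_monoI) (simp add: degree_one_less_iff)
  show "surj (\<lambda>x. - H (R (- H x)))" unfolding surj_def
  proof
    fix y
    have "y = - H (R (- H (fun_inv H (- fun_inv R (fun_inv H (- y))))))"
      using assms by (simp add: degree_one_inv_apply)
    then show "\<exists>x. y = - H (R (- H x))" by blast
  qed
  show "- H (R (- H (x + 1))) = - H (R (- H x)) + 1" for x
  proof -
    have "R (- H x + of_int (- 1)) = R (- H x) + of_int (- 1)"
      "H (R (- H x) + of_int (- 1)) = H (R (- H x)) + of_int (- 1)"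
      by (rule degree_one_add_int, fact)+
    then show ?thesis using degree_oneD(3)[OF assms(1), of x] by simp
  qed
qed

lemma funpow_fixed: "f x = x \<Longrightarrow> (f ^^ n) x = x"
  by (induction n) auto

text \<open>
  Compare the lifts of the squares of both sides to the right of \<open>0\<close>. For small \<open>x > 0\<close> the point \<open>- H x\<close> is to the left of \<open>0\<close>,
  where \<open>K\<close> is the identity, so the square of \<open>k ^^ m \<circ> h\<close> has the lift \<open>2 ^ m A x\<close>, where \<open>A\<close> is the lift of \<open>h \<circ> h\<close>
  that fixes \<open>0\<close>. Since \<open>A\<close> commutes with the germ of \<open>g\<close>, the conjugation equation reduces to \<open>2 ^ m = 2 ^ n\<close>.
\<close>

lemma reversing_germ_rigidity:
  assumes h: "bij h" "degree_one H" "H 0 = 0" "lifts (\<lambda>x. - H x) h"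
    and normal: "\<And>g. g \<in> thompson_set \<Longrightarrow> \<exists>g'\<in>thompson_set. h \<circ> g = g' \<circ> h"
      "\<And>g. g \<in> thompson_set \<Longrightarrow> \<exists>g'\<in>thompson_set. g \<circ> h = h \<circ> g'"
    and K: "pl_lift K" "lifts K k" "\<And>x. 0 \<le> x \<Longrightarrow> x \<le> 1 / 8 \<Longrightarrow> K x = 2 * x"
      "\<And>x. 1 / 2 \<le> x \<Longrightarrow> x \<le> 1 \<Longrightarrow> K x = x"
    and g: "g \<in> thompson_set" "g (circle_of 0) = circle_of 0"
    and conj: "(k ^^ m \<circ> h) \<circ> g = g \<circ> (k ^^ n \<circ> h)"
  shows "m = n"
proof -
  define N where "N = (\<lambda>x. - H x)"
  define A where "A = (\<lambda>x. - H (id (- H x)))"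
  have kT: "k \<in> thompson_set" using K(1,2) by (auto simp: thompson_set_def in_thompson_T_iff)
  have N: "lifts N h" using h(4) by (simp add: N_def)
  have A: "degree_one A" unfolding A_def by (rule degree_one_neg_conj[OF h(2) degree_one_id])
  have A0: "A 0 = 0" by (simp add: A_def h)
  have "A = N \<circ> N" by (simp add: A_def N_def fun_eq_iff)
  then have lA: "lifts A (h \<circ> h)" using lifts_comp[OF N N] by simp
  have K0: "K 0 = 0" using K(3)[of 0] by simp
  have hc: "h (circle_of 0) = circle_of 0" using liftsD[OF N, of 0] by (simp add: N_def h)
  have kc: "k (circle_of 0) = circle_of 0" using liftsD[OF K(2), of 0] K0 by simp
  have Kdeg: "degree_one (K ^^ i)" for i
    using degree_one_funpow pl_lift_degree_one K(1) by blast
  have Ki0: "(K ^^ i) 0 = 0" for i using K0 by (rule funpow_fixed)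
  have Kgerm: "\<forall>\<^sub>F x in at_right 0. K x = 2 * x"
  proof -
    have "\<forall>\<^sub>F x in at_right (0::real). x \<in> {0<..<1 / 8}" by (rule eventually_at_right_real) simp
    then show ?thesis by eventually_elim (simp add: K(3))
  qed
  have Kigerm: "\<forall>\<^sub>F x in at_right 0. (K ^^ i) x = 2 ^ i * x" for i
  proof (induction i)
    case (Suc i)
    have "\<forall>\<^sub>F x in at_right 0. K ((K ^^ i) x) = 2 * (K ^^ i) x"
      by (rule eventually_compose_filterlim[OF Kgerm degree_one_at_right_0[OF Kdeg Ki0]])
    then show ?case using Suc by eventually_elim simp
  qed simp
  have Kid: "(K ^^ i) x = x" if "- 1 / 2 \<le> x" "x \<le> 0" for i x
  proof (rule funpow_fixed)
    show "K x = x" using K(4)[of "x + 1"] that degree_oneD(3)[OF pl_lift_degree_one[OF K(1)], of x] by simp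
  qed
  \<comment> \<open>The conjugates of \<open>k\<close> by \<open>h \<circ> h\<close> in both directions are elements of \<open>T\<close>.\<close>
  obtain k1 k' where k': "k' \<in> thompson_set" "k \<circ> h = h \<circ> k1" "k1 \<circ> h = h \<circ> k'"
    using normal(2) kT by metis
  obtain k2 k'' where k'': "k'' \<in> thompson_set" "h \<circ> k = k2 \<circ> h" "h \<circ> k2 = k'' \<circ> h"
    using normal(1) kT by metis
  have kh': "h \<circ> h \<circ> k' = k \<circ> (h \<circ> h)" using k'(2,3) by (metis comp_assoc)
  have kh'': "k'' \<circ> (h \<circ> h) = h \<circ> h \<circ> k" using k''(2,3) by (metis comp_assoc)
  have "h (h (k' (circle_of 0))) = h (h (circle_of 0))" using kh' hc kc by (metis comp_apply)
  then have "k' (circle_of 0) = circle_of 0" using h(1) by (metis bij_is_inj injD)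
  then obtain K' where K': "pl_lift K'" "lifts K' k'" "K' 0 = 0" using pl_lift_fixing[OF k'(1)] by blast
  have "k'' (circle_of 0) = circle_of 0" using kh'' hc kc by (metis comp_apply)
  then obtain K'' where K'': "pl_lift K''" "lifts K'' k''" "K'' 0 = 0"
    using pl_lift_fixing[OF k''(1)] by blast
  have deg: "degree_one K" "degree_one K'" "degree_one K''"
    using K(1) K'(1) K''(1) by (auto intro: pl_lift_degree_one)
  have "A \<circ> K' = K \<circ> A"
  proof (rule degree_one_fix_eq)
    show "lifts (A \<circ> K') (h \<circ> h \<circ> k')" using lA K'(2) by (rule lifts_comp)
    show "lifts (K \<circ> A) (h \<circ> h \<circ> k')" unfolding kh' using K(2) lA by (rule lifts_comp)
    show "(A \<circ> K') 0 = 0" "(K \<circ> A) 0 = 0" using A0 K0 K' by auto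
  qed (use A deg in \<open>auto intro: degree_one_comp\<close>)
  moreover have "K'' \<circ> A = A \<circ> K"
  proof (rule degree_one_fix_eq)
    show "lifts (A \<circ> K) (h \<circ> h \<circ> k)" using lA K(2) by (rule lifts_comp)
    show "lifts (K'' \<circ> A) (h \<circ> h \<circ> k)" unfolding kh''[symmetric] using K''(2) lA by (rule lifts_comp)
    show "(K'' \<circ> A) 0 = 0" "(A \<circ> K) 0 = 0" using A0 K0 K'' by auto
  qed (use A deg in \<open>auto intro: degree_one_comp\<close>)
  ultimately have "\<forall>\<^sub>F x in at_right 0. A (2 * x) = 2 * A x"
    using normalizing_germ_commutes_with_doubling A A0 K(1) Kgerm K' K'' by blast
  note Acomm = germ_commutes_with_powi[OF this]
  obtain G where G: "pl_lift G" "lifts G g" "G 0 = 0" using pl_lift_fixing[OF g] by blast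
  have Gdeg: "degree_one G" using G(1) by (rule pl_lift_degree_one)
  obtain j :: int where j: "\<forall>\<^sub>F x in at_right 0. G x = 2 powi j * x"
    using pl_lift_germ[OF G(1,3)] by blast
  define Q where "Q i = K ^^ i \<circ> (\<lambda>x. - H ((K ^^ i) (- H x)))" for i
  have Qdeg: "degree_one (Q i)" for i
    unfolding Q_def by (intro degree_one_comp Kdeg degree_one_neg_conj h)
  have Q0: "Q i 0 = 0" for i using Ki0 h(3) by (simp add: Q_def)
  have Ql: "lifts (Q i) ((k ^^ i \<circ> h) \<circ> (k ^^ i \<circ> h))" for i
  proof -
    have "lifts ((K ^^ i \<circ> N) \<circ> (K ^^ i \<circ> N)) ((k ^^ i \<circ> h) \<circ> (k ^^ i \<circ> h))"
      using N lifts_funpow[OF K(2), of i] by (intro lifts_comp)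
    moreover have "(K ^^ i \<circ> N) \<circ> (K ^^ i \<circ> N) = Q i" by (simp add: Q_def N_def fun_eq_iff)
    ultimately show ?thesis by simp
  qed
  have Qgerm: "\<forall>\<^sub>F x in at_right 0. Q i x = 2 ^ i * A x" for i
  proof -
    have "\<forall>\<^sub>F x in at_right 0. H x \<in> {0<..<1 / 2}"
      by (rule eventually_compose_filterlim[OF eventually_at_right_real degree_one_at_right_0[OF h(2,3)]]) simp
    moreover have "\<forall>\<^sub>F x in at_right 0. (K ^^ i) (A x) = 2 ^ i * A x"
      by (rule eventually_compose_filterlim[OF Kigerm degree_one_at_right_0[OF A A0]])
    ultimately show ?thesis
    proof eventually_elim
      case (elim x)
      then have "(K ^^ i) (- H x) = - H x" by (intro Kid) auto
      then show ?case using elim by (simp add: Q_def A_def)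
    qed
  qed
  have "Q m \<circ> G = G \<circ> Q n"
  proof (rule degree_one_fix_eq)
    have "(k ^^ m \<circ> h) \<circ> (k ^^ m \<circ> h) \<circ> g = (k ^^ m \<circ> h) \<circ> (g \<circ> (k ^^ n \<circ> h))"
      unfolding comp_assoc[of "k ^^ m \<circ> h"] conj ..
    also have "\<dots> = g \<circ> ((k ^^ n \<circ> h) \<circ> (k ^^ n \<circ> h))"
      using conj by (metis comp_assoc)
    finally have eq: "(k ^^ m \<circ> h) \<circ> (k ^^ m \<circ> h) \<circ> g = g \<circ> ((k ^^ n \<circ> h) \<circ> (k ^^ n \<circ> h))" .
    show "lifts (Q m \<circ> G) ((k ^^ m \<circ> h) \<circ> (k ^^ m \<circ> h) \<circ> g)" using Ql G(2) by (rule lifts_comp)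
    show "lifts (G \<circ> Q n) ((k ^^ m \<circ> h) \<circ> (k ^^ m \<circ> h) \<circ> g)"
      unfolding eq using G(2) Ql by (rule lifts_comp)
    show "(Q m \<circ> G) 0 = 0" "(G \<circ> Q n) 0 = 0" using Q0 G by auto
  qed (use Qdeg Gdeg in \<open>auto intro: degree_one_comp\<close>)
  then have QG: "Q m (G x) = G (Q n x)" for x by (metis comp_apply)
  have "\<forall>\<^sub>F x in at_right 0. Q m (G x) = 2 ^ m * A (G x)"
    by (rule eventually_compose_filterlim[OF Qgerm degree_one_at_right_0[OF Gdeg G(3)]])
  moreover have "\<forall>\<^sub>F x in at_right 0. G (Q n x) = 2 powi j * Q n x"
    by (rule eventually_compose_filterlim[OF j degree_one_at_right_0[OF Qdeg Q0]])
  ultimately have "\<forall>\<^sub>F x in at_right (0::real). (2::real) ^ m = 2 ^ n"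
    using Qgerm[of n] j Acomm[of j] eventually_at_right_less[of 0]
  proof eventually_elim
    case (elim x)
    have "A x > 0" using degree_one_less_iff[OF A, of 0 x] A0 elim by simp
    moreover have "2 ^ m * (2 powi j * A x) = 2 powi j * (2 ^ n * A x)"
      using elim QG[of x] by metis
    ultimately show ?case by simp
  qed
  then have "(2::real) ^ m = 2 ^ n" by (simp add: eventually_const_iff)
  then show ?thesis by simp
qed

text \<open>
  The lift is decreasing and maps the open unit interval into \<open>(-1, 0)\<close>, so a fixed point there solves \<open>K (- H x) = x - 1\<close>, where the
  left side decreases and the right side increases.
\<close>

lemma reversing_fixed_point_unique:
  assumes H: "degree_one H" "H 0 = 0" and K: "degree_one K" "K 0 = 0"
    and f: "lifts (\<lambda>x. K (- H x)) f"
    and p: "f p = p" "p \<noteq> circle_of 0" and q: "f q = q" "q \<noteq> circle_of 0"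
  shows "p = q"
proof -
  have key: "\<exists>x. z = circle_of x \<and> K (- H x) = x - 1" if z: "f z = z" "z \<noteq> circle_of 0" for z
  proof -
    obtain x where x: "z = circle_of x" "0 \<le> x" "x < 1" by (rule circle_cases)
    then have "0 < x" using z(2) by (cases "x = 0") auto
    then have "0 < H x" "H x < 1"
      using degree_one_less_iff[OF H(1), of 0 x] degree_one_less_iff[OF H(1), of x 1]
        degree_oneD(3)[OF H(1), of 0] H(2) x by auto
    then have "- 1 < K (- H x)" "K (- H x) < 0"
      using degree_one_less_iff[OF K(1), of "- 1" "- H x"] degree_one_less_iff[OF K(1), of "- H x" 0]
        degree_oneD(3)[OF K(1), of "- 1"] K(2) by auto
    moreover have "circle_of (K (- H x)) = circle_of (x - 1)"
      using z(1) liftsD[OF f, of x] circle_of_add_int[of x "- 1"] x by simp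
    ultimately have "K (- H x) = x - 1"
      using x \<open>0 < x\<close> by (intro circle_of_inj_unit) auto
    then show ?thesis using x by blast
  qed
  obtain x where x: "p = circle_of x" "K (- H x) = x - 1" using key p by blast
  obtain y where y: "q = circle_of y" "K (- H y) = y - 1" using key q by blast
  have "s \<ge> t" if "K (- H s) = s - 1" "K (- H t) = t - 1" for s t
  proof (rule ccontr)
    assume "\<not> s \<ge> t"
    then have "K (- H t) < K (- H s)" using H(1) K(1) by (simp add: degree_one_less_iff)
    then show False using that \<open>\<not> s \<ge> t\<close> by simp
  qed
  then have "x = y" using x(2) y(2) by (meson order_antisym)
  then show ?thesis using x y by simp
qed

section \<open>Twisted conjugacy classes\<close>

text \<open>
  Pigeonhole: a class may contain several terms of the sequence, as can happen in the orientation
  reversing case, but not infinitely many.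
\<close>

lemma infinite_quotientI:
  assumes mem: "\<And>m::nat. y m \<in> C" and refl: "\<And>m. (y m, y m) \<in> R"
    and fin: "\<And>m. finite {n. (y m, y n) \<in> R}"
  shows "infinite (C // R)"
proof
  assume "finite (C // R)"
  moreover have "range (\<lambda>m. R `` {y m}) \<subseteq> C // R" using mem by (auto simp: quotient_def)
  ultimately have "finite (range (\<lambda>m. R `` {y m}))" by (rule finite_subset[rotated])
  then obtain m0 where inf: "infinite {m. R `` {y m} = R `` {y m0}}"
    using pigeonhole_infinite[of UNIV "\<lambda>m. R `` {y m}"] by auto
  have "{m. R `` {y m} = R `` {y m0}} \<subseteq> {n. (y m0, y n) \<in> R}" using refl by auto
  then show False using inf fin[of m0] finite_subset by blast
qed

lemma auto_thompson_T:
  assumes "\<phi> \<in> auto thompson_T" shows "homeo_group_automorphism thompson_set \<phi>"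
proof -
  interpret homeo_group thompson_set by (rule thompson_homeo_group)
  show ?thesis
    using assms by unfold_locales (auto simp: auto_def hom_def Bij_def thompson_set_def)
qed

theorem theorem1p5: "has_R_infinity thompson_T"
  unfolding has_R_infinity_def
proof (intro conjI ballI group_thompson_T)
  fix \<phi> assume "\<phi> \<in> auto thompson_T"
  then have aut: "homeo_group_automorphism thompson_set \<phi>" by (rule auto_thompson_T)
  then interpret homeo_group_automorphism thompson_set \<phi> .
  let ?T = thompson_set and ?R = "twisted_conj thompson_T \<phi>"
  obtain h where h: "bij h" "continuous_on UNIV h" "\<And>g. g \<in> ?T \<Longrightarrow> h \<circ> g = \<phi> g \<circ> h"
    "h ` (circle_of ` dyadic) \<subseteq> circle_of ` dyadic"
    using thompson_spatial[OF aut] by blast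
  have refl: "(y, y) \<in> ?R" if "y \<in> ?T" for y
    using that id_mem by (auto simp: twisted_conj_def thompson_set_def thompson_T_m_inv auto_id
        intro!: bexI[of _ id])
  have conjugate: "\<exists>g\<in>?T. (y \<circ> h) \<circ> g = g \<circ> (z \<circ> h)" if yz: "(y, z) \<in> ?R" for y z
  proof -
    obtain g where g: "g \<in> ?T" "z = fun_inv g \<circ> y \<circ> \<phi> g"
      using yz by (auto simp: twisted_conj_def thompson_set_def thompson_T_m_inv)
    have "g \<circ> (z \<circ> h) = (g \<circ> fun_inv g) \<circ> y \<circ> (\<phi> g \<circ> h)" unfolding g(2) by (simp add: comp_assoc)
    also have "g \<circ> fun_inv g = id" using bij_is_surj[OF bijective[OF g(1)]] by (simp add: surj_iff)
    also have "id \<circ> y \<circ> (\<phi> g \<circ> h) = (y \<circ> h) \<circ> g" using h(3)[OF g(1)] by (simp add: comp_assoc)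
    finally show ?thesis using g(1) by metis
  qed
  \<comment> \<open>A dyadic rotation \<open>r\<close> makes \<open>h1 = r \<circ> h\<close> fix the base point. The coset \<open>T h\<close> is also \<open>T h1\<close>:
    the element \<open>(w \<circ> r) \<circ> h\<close> is \<open>w \<circ> h1\<close>.\<close>
  obtain t where t: "t \<in> dyadic" "h (circle_of 0) = circle_of t" using h(4) dyadic_0 by blast
  obtain r where r: "lifts (\<lambda>x. x + - t) r" using degree_one_descends degree_one_translation by metis
  have rT: "r \<in> ?T"
    using r pl_lift_translation[OF dyadic_minus[OF t(1)]] by (auto simp: thompson_set_def in_thompson_T_iff)
  define h1 where "h1 = r \<circ> h"
  have "continuous_on (range h) r" using continuous[OF rT] by (rule continuous_on_subset) simp
  then have h1: "bij h1" "continuous_on UNIV h1"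
    unfolding h1_def using bij_comp[OF h(1) bijective[OF rT]] continuous_on_compose[OF h(2)] by blast+
  have h1_0: "h1 (circle_of 0) = circle_of 0" using t liftsD[OF r, of t] by (simp add: h1_def)
  have h1_D: "h1 ` (circle_of ` dyadic) \<subseteq> circle_of ` dyadic"
  proof -
    have "r (circle_of x) \<in> circle_of ` dyadic" if "x \<in> dyadic" for x
      using that t(1) by (simp add: liftsD[OF r] circle_of_dyadic_iff dyadic_diff)
    then have "r ` (circle_of ` dyadic) \<subseteq> circle_of ` dyadic" by blast
    then show ?thesis using image_mono[OF h(4), of r] unfolding h1_def image_comp[symmetric] by blast
  qed
  show "infinite (carrier thompson_T // ?R)"
  proof (rule circle_homeo_lift[OF h1 h1_0])
    fix H assume H: "degree_one H" "H 0 = 0" "lifts H h1"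
    have "\<exists>w. w \<in> ?T \<and> rotates_once (2 ^ i) (w \<circ> h1)" for i
      using thompson_rotates_once[OF H(1,3,2) h1_D] by metis
    then obtain w where w: "\<And>i. w i \<in> ?T \<and> rotates_once (2 ^ i) (w i \<circ> h1)" by metis
    show ?thesis
    proof (rule infinite_quotientI[of "\<lambda>i. w i \<circ> r"])
      show "w i \<circ> r \<in> carrier thompson_T" "(w i \<circ> r, w i \<circ> r) \<in> ?R" for i
        using w rT comp_mem refl by (auto simp: thompson_set_def)
      fix i
      have "j = i" if ij: "(w i \<circ> r, w j \<circ> r) \<in> ?R" for j
      proof -
        obtain g where g: "g \<in> ?T" "(w i \<circ> h1) \<circ> g = g \<circ> (w j \<circ> h1)"
          using conjugate[OF ij] by (auto simp: h1_def comp_assoc)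
        obtain G where G: "degree_one G" "lifts G g"
          using g(1) pl_lift_degree_one by (auto simp: thompson_set_def in_thompson_T_iff)
        have "rotates_once (2 ^ i) (w j \<circ> h1)" using rotates_once_conj[OF _ G g(2)] w by blast
        then have "2 ^ i dvd (2 ^ j :: nat)" "2 ^ j dvd (2 ^ i :: nat)"
          using rotates_once_dvd w by blast+
        then have "(2 ^ i :: nat) = 2 ^ j" by (rule dvd_antisym)
        then show ?thesis by simp
      qed
      then have "{j. (w i \<circ> r, w j \<circ> r) \<in> ?R} \<subseteq> {i}" by auto
      then show "finite {j. (w i \<circ> r, w j \<circ> r) \<in> ?R}" by (rule finite_subset) simp
    qed
  next
    fix H assume H: "degree_one H" "H 0 = 0" "lifts (\<lambda>x. - H x) h1"
    obtain K where K: "pl_lift K" "\<And>x. 0 \<le> x \<Longrightarrow> x \<le> 1 / 8 \<Longrightarrow> K x = 2 * x"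
      "\<And>x. 1 / 2 \<le> x \<Longrightarrow> x \<le> 1 \<Longrightarrow> K x = x" by (rule pl_doubling) blast
    have Kdeg: "degree_one K" using K(1) by (rule pl_lift_degree_one)
    obtain k where k: "lifts K k" using degree_one_descends[OF Kdeg] by blast
    have kT: "k \<in> ?T" using K(1) k by (auto simp: thompson_set_def in_thompson_T_iff)
    have K0: "K 0 = 0" using K(2)[of 0] by simp
    have rinv: "fun_inv r \<circ> r = id" "r \<circ> fun_inv r = id"
      using bijective[OF rT] by (auto simp: bij_is_inj bij_is_surj simp flip: surj_iff)
    have normal1: "\<exists>g'\<in>?T. h1 \<circ> g = g' \<circ> h1" if g: "g \<in> ?T" for g
    proof
      show "r \<circ> \<phi> g \<circ> fun_inv r \<in> ?T" using rT g by (intro comp_mem inv_mem auto_mem)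
      have "r \<circ> \<phi> g \<circ> fun_inv r \<circ> h1 = r \<circ> \<phi> g \<circ> (fun_inv r \<circ> r) \<circ> h"
        by (simp add: h1_def comp_assoc)
      then show "h1 \<circ> g = r \<circ> \<phi> g \<circ> fun_inv r \<circ> h1"
        using h(3)[OF g] rinv by (simp add: h1_def comp_assoc)
    qed
    have normal2: "\<exists>g'\<in>?T. g \<circ> h1 = h1 \<circ> g'" if g: "g \<in> ?T" for g
    proof -
      have "fun_inv r \<circ> g \<circ> r \<in> ?T" using rT g by (intro comp_mem inv_mem)
      then obtain g' where g': "g' \<in> ?T" "fun_inv r \<circ> g \<circ> r = \<phi> g'" using auto_surj by metis
      have "h1 \<circ> g' = r \<circ> (\<phi> g' \<circ> h)" using h(3)[OF g'(1)] by (simp add: h1_def comp_assoc)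
      also have "\<dots> = (r \<circ> fun_inv r) \<circ> g \<circ> h1"
        unfolding g'(2)[symmetric] by (simp add: h1_def comp_assoc)
      finally have "g \<circ> h1 = h1 \<circ> g'" using rinv by simp
      then show ?thesis using g'(1) by blast
    qed
    have rigid: "m = n" if "g \<in> ?T" "g (circle_of 0) = circle_of 0"
      "(k ^^ m \<circ> h1) \<circ> g = g \<circ> (k ^^ n \<circ> h1)" for g m n
      using reversing_germ_rigidity[OF h1(1) H normal1 normal2 K(1) k K(2,3) that] by blast
    have fix0: "(k ^^ n \<circ> h1) (circle_of 0) = circle_of 0" for n
      using funpow_fixed[of k "circle_of 0" n] liftsD[OF k, of 0] K0 h1_0 by simp
    have fixed_unique: "p = q" if "(k ^^ m \<circ> h1) p = p" "p \<noteq> circle_of 0"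
      "(k ^^ m \<circ> h1) q = q" "q \<noteq> circle_of 0" for m p q
    proof (rule reversing_fixed_point_unique[OF H(1,2) degree_one_funpow[OF Kdeg, of m] _ _ that])
      show "(K ^^ m) 0 = 0" using K0 by (rule funpow_fixed)
      show "lifts (\<lambda>x. (K ^^ m) (- H x)) (k ^^ m \<circ> h1)"
        using lifts_comp[OF lifts_funpow[OF k, of m] H(3)] by (simp add: comp_def)
    qed
    show ?thesis
    proof (rule infinite_quotientI[of "\<lambda>m. k ^^ m \<circ> r"])
      show "k ^^ m \<circ> r \<in> carrier thompson_T" "(k ^^ m \<circ> r, k ^^ m \<circ> r) \<in> ?R" for m
        using power_mem[OF kT] rT comp_mem refl by (auto simp: thompson_set_def)
      fix m
      let ?N = "{n. (k ^^ m \<circ> r, k ^^ n \<circ> r) \<in> ?R}"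
      have ex: "\<exists>g. g \<in> ?T \<and> (k ^^ m \<circ> h1) \<circ> g = g \<circ> (k ^^ n \<circ> h1)" if "n \<in> ?N" for n
        using conjugate[of "k ^^ m \<circ> r" "k ^^ n \<circ> r"] that by (auto simp: h1_def comp_assoc)
      have fp: "(k ^^ m \<circ> h1) (g (circle_of 0)) = g (circle_of 0)"
        if "(k ^^ m \<circ> h1) \<circ> g = g \<circ> (k ^^ n \<circ> h1)" for g n
        using fix0[of n] that by (metis comp_apply)
      \<comment> \<open>A conjugator between the \<open>m\<close>-th and another element moves \<open>0\<close> to the second fixed point of the
        \<open>m\<close>-th one, so two such conjugators differ by an element that fixes \<open>0\<close>.\<close>
      have two: "n = n'" if n: "n \<in> ?N" "n \<noteq> m" and n': "n' \<in> ?N" "n' \<noteq> m" for n n'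
      proof -
        obtain g where g: "g \<in> ?T" "(k ^^ m \<circ> h1) \<circ> g = g \<circ> (k ^^ n \<circ> h1)" using ex[OF n(1)] by blast
        obtain g' where g': "g' \<in> ?T" "(k ^^ m \<circ> h1) \<circ> g' = g' \<circ> (k ^^ n' \<circ> h1)"
          using ex[OF n'(1)] by blast
        have "g (circle_of 0) \<noteq> circle_of 0" "g' (circle_of 0) \<noteq> circle_of 0"
          using rigid[OF g(1) _ g(2)] rigid[OF g'(1) _ g'(2)] n n' by auto
        then have eq: "g (circle_of 0) = g' (circle_of 0)"
          using fixed_unique[OF fp[OF g(2)] _ fp[OF g'(2)]] by blast
        have ginv: "fun_inv g \<circ> g = id" "g \<circ> fun_inv g = id"
          using bijective[OF g(1)] by (auto simp: bij_is_inj bij_is_surj simp flip: surj_iff)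
        show "n = n'"
        proof (rule rigid)
          show "fun_inv g \<circ> g' \<in> ?T" using g(1) g'(1) by (intro comp_mem inv_mem)
          show "(fun_inv g \<circ> g') (circle_of 0) = circle_of 0"
            using ginv(1) eq by (metis comp_apply id_apply)
          have "(k ^^ n \<circ> h1) \<circ> (fun_inv g \<circ> g') = fun_inv g \<circ> (g \<circ> (k ^^ n \<circ> h1)) \<circ> fun_inv g \<circ> g'"
            using ginv(1) by (metis comp_assoc id_comp)
          also have "\<dots> = fun_inv g \<circ> (k ^^ m \<circ> h1) \<circ> (g \<circ> fun_inv g) \<circ> g'"
            unfolding g(2)[symmetric] by (simp add: comp_assoc)
          also have "\<dots> = fun_inv g \<circ> ((k ^^ m \<circ> h1) \<circ> g')" unfolding ginv by (simp add: comp_assoc)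
          also have "\<dots> = (fun_inv g \<circ> g') \<circ> (k ^^ n' \<circ> h1)" unfolding g'(2) by (simp add: comp_assoc)
          finally show "(k ^^ n \<circ> h1) \<circ> (fun_inv g \<circ> g') = (fun_inv g \<circ> g') \<circ> (k ^^ n' \<circ> h1)" .
        qed
      qed
      have "finite (?N - {m})"
      proof (cases "?N - {m} = {}")
        case True show ?thesis unfolding True by simp
      next
        case False
        then obtain n where "n \<in> ?N - {m}" by blast
        then have "?N - {m} \<subseteq> {n}" using two[of _ n] by blast
        then show ?thesis by (rule finite_subset) simp
      qed
      then show "finite ?N" by simp
    qed
  qed
qed

end
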